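(* Let $(\mathcal{C},\mathbb{E},\mathfrak{s})$ be a small $R$-linear extriangulated category with enough projective morphisms. Then for every $n\ge 0$, $\mathbb{E}_{\mathrm{I}}^{-n}$ is the $n$-th left covariant derived functor of the bifunctor $\mathrm{Hom}_{\mathcal{C}}=\mathcal{C}(-,-)$. That is, $((\mathbb{E}_{\mathrm{I}}^{n})_{n\le0},\delta_\sharp)$ is a covariant partial $\delta$-functor with degree-zero term $\mathcal{C}(-,-)$, and for every covariant partial $\delta$-functor $((G^n)_{n\le0},\delta_\sharp)$ with $G^0=\mathcal{C}(-,-)$ there exists a unique sequence of natural transformations $\{\varphi^n\colon G^n\to\mathbb{E}_{\mathrm{I}}^n\}_{n\le0}$ such that $\varphi^0=\mathrm{id}$ and $\varphi^{n+1}_{-,A}\circ\delta_\sharp=\delta_\sharp\circ\varphi^n_{-,C}$ for all $n<0$ and all $\delta\in\mathbb{E}(C,A)$.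
   Context: $R$ is a commutative ring with $1$; $\mathcal{C}$ is an additive $R$-linear category. Extriangulated categories: let $\mathbb{E}\colon\mathcal{C}^{\mathrm{op}}\times\mathcal{C}\to\mathrm{Mod}\,R$ be an $R$-bilinear functor. An element $\delta\in\mathbb{E}(C,A)$ is called an extension; for $a\colon A\to A'$ and $c\colon C'\to C$ put $a_*\delta=\mathbb{E}(C,a)(\delta)$ and $c^*\delta=\mathbb{E}(c,A)(\delta)$. A morphism of extensions from $\delta\in\mathbb{E}(C,A)$ to $\delta'\in\mathbb{E}(C',A')$ is a pair $(a\colon A\to A',\,c\colon C\to C')$ with $a_*\delta=c^*\delta'$. The extension $\delta\oplus\delta'\in\mathbb{E}(C\oplus C',A\oplus A')$ is the one with diagonal components $\delta,\delta'$ and zero off-diagonal components. Sequences $A\xrightarrow{x}B\xrightarrow{y}C$ and $A\xrightarrow{x'}B'\xrightarrow{y'}C$ are equivalent if there is an isomorphism $b\colon B\to B'$ with $bx=x'$, $y'b=y$; the class is written $[A\xrightarrow{x}B\xrightarrow{y}C]$. An additive realization $\mathfrak{s}$ assigns to each $\delta\in\mathbb{E}(C,A)$ such a class $\mathfrak{s}(\delta)=[A\xrightarrow{x}B\xrightarrow{y}C]$ so that: for each morphism $(a,c)\colon\delta\to\delta'$ with $\mathfrak{s}(\delta')=[A'\xrightarrow{x'}B'\xrightarrow{y'}C']$ there is $b\colon B\to B'$ with $bx=x'a$, $y'b=cy$; $\mathfrak{s}(0)=[A\to A\oplus C\to C]$ (canonical maps); and $\mathfrak{s}(\delta\oplus\delta')=\mathfrak{s}(\delta)\oplus\mathfrak{s}(\delta')$.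 The triple $(\mathcal{C},\mathbb{E},\mathfrak{s})$ is an ($R$-linear) extriangulated category if moreover: (ET3) if $\mathfrak{s}(\delta)=[A\xrightarrow{x}B\xrightarrow{y}C]$, $\mathfrak{s}(\delta')=[A'\xrightarrow{x'}B'\xrightarrow{y'}C']$ and $bx=x'a$, then there is $c$ with $cy=y'b$ and $a_*\delta=c^*\delta'$; (ET3)$^{\mathrm{op}}$ the dual; (ET4) if $\delta\in\mathbb{E}(D,A)$ and $\delta'\in\mathbb{E}(F,B)$ are realized by $A\xrightarrow{f}B\xrightarrow{f'}D$ and $B\xrightarrow{g}C\xrightarrow{g'}F$, then there are an object $E$, morphisms $d\colon D\to E$, $e\colon E\to F$, $h=gf$, $h'\colon C\to E$ with $h'g=df'$, $eh'=g'$, and $\delta''\in\mathbb{E}(E,A)$ realized by $A\xrightarrow{h}C\xrightarrow{h'}E$, such that $D\xrightarrow{d}E\xrightarrow{e}F$ realizes $f'_*\delta'$, $d^*\delta''=\delta$ and $f_*\delta''=e^*\delta'$; (ET4)$^{\mathrm{op}}$ the dual. If $\mathfrak{s}(\delta)=[A\xrightarrow{x}B\xrightarrow{y}C]$ one writes $A\xrightarrow{x}B\xrightarrow{y}C\overset{\delta}{\dashrightarrow}$ and calls it an $\mathfrak{s}$-triangle; $x$ is an inflation, $y$ a deflation, $A\to B\to C$ a conflation. A morphism $f$ is projective if $\mathbb{E}(f,-)=0$. There are enough projective morphisms if every object $C$ admits a deflation $G\to C$ which is a projective morphism. $\mathrm{Mod}\,\mathcal{C}$ (resp. $\mathcal{C}\,\mathrm{Mod}$)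 is the category of $R$-linear functors $\mathcal{C}^{\mathrm{op}}\to\mathrm{Mod}\,R$ (resp. $\mathcal{C}\to\mathrm{Mod}\,R$). For $\mathcal{C}$ small, positive extensions are defined by $\mathbb{E}^0=\mathcal{C}(-,-)$, $\mathbb{E}^1=\mathbb{E}$ and inductively by the coend $\mathbb{E}^n(X,Y)=\int^{M\in\mathcal{C}}\mathbb{E}^{n-1}(M,Y)\otimes_R\mathbb{E}(X,M)$; there are natural isomorphisms $\mathbb{E}^{s+t}(X,Y)\cong\int^{M}\mathbb{E}^s(M,Y)\otimes_R\mathbb{E}^t(X,M)$. Write $\rho\cup\lambda\in\mathbb{E}^{s+t}(X,Y)$ for the class of $\rho\otimes\lambda$, $\rho\in\mathbb{E}^s(M,Y)$, $\lambda\in\mathbb{E}^t(X,M)$. For $\delta\in\mathbb{E}(C,A)$ and $n\ge0$, $\delta^\sharp\colon\mathbb{E}^n(A,-)\to\mathbb{E}^{n+1}(C,-)$ is $\lambda\mapsto\lambda\cup\delta$; for $n=0$ this is $f\mapsto f_*\delta$. Negative extensions: for $n\ge0$ put $\mathbb{E}_{\mathrm{I}}^{-n}(C,A)=(\mathcal{C}\,\mathrm{Mod})(\mathbb{E}^n(A,-),\mathcal{C}(C,-))$, an $R$-bilinear functor of $(C,A)$ ($\mathbb{E}_{\mathrm{I}}^0=\mathcal{C}(-,-)$ by Yoneda). For $\delta\in\mathbb{E}(C,A)$ and $n\ge0$, $\delta_\sharp\colon\mathbb{E}_{\mathrm{I}}^{-(n+1)}(-,C)\to\mathbb{E}_{\mathrm{I}}^{-n}(-,A)$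 is precomposition with $\delta^\sharp\colon\mathbb{E}^n(A,-)\to\mathbb{E}^{n+1}(C,-)$. A covariant partial $\delta$-functor $((G^n)_{n\le0},\delta_\sharp)$ in non-positive degrees is a sequence of $R$-bilinear functors $G^n\colon\mathcal{C}^{\mathrm{op}}\times\mathcal{C}\to\mathrm{Mod}\,R$ ($n\le0$) with morphisms $\delta_\sharp\colon G^n(-,C)\to G^{n+1}(-,A)$ in $\mathrm{Mod}\,\mathcal{C}$ for all $\delta\in\mathbb{E}(C,A)$ and $n<0$, natural with respect to morphisms of extensions (for $(a,c)\colon\delta\to\delta'$: $G^{n+1}(-,a)\circ\delta_\sharp=\delta'_\sharp\circ G^n(-,c)$), such that for every $\mathfrak{s}$-triangle $A\xrightarrow{x}B\xrightarrow{y}C\overset{\delta}{\dashrightarrow}$ the complex $\cdots\to G^{-1}(-,C)\xrightarrow{\delta_\sharp}G^0(-,A)\xrightarrow{x_*}G^0(-,B)\xrightarrow{y_*}G^0(-,C)$ is exact except possibly at the end term $G^0(-,C)$. *)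

theory Defs
  imports "HOL-Algebra.Module"
begin

section \<open>R-linear and additive categories\<close>

text \<open>
  A small category with hom-modules. As usual, hom-sets are pairwise disjoint: every morphism
  \<open>f\<close> determines its domain \<open>dom f\<close> and codomain \<open>cod f\<close>. Composition \<open>g \<cdot> f\<close> means \<open>g\<close> after \<open>f\<close>.
  Of a \<^typ>\<open>('r, 'x) module\<close> record only carrier, addition, zero and scalar multiplication are
  meaningful; its fields \<open>mult\<close> and \<open>one\<close> are ignored throughout.
\<close>

record ('r, 'o, 'm) lincat =
  Ob :: "'o set"
  Hom :: "'o \<Rightarrow> 'o \<Rightarrow> ('r, 'm) module"
  dom :: "'m \<Rightarrow> 'o"
  cod :: "'m \<Rightarrow> 'o"
  ident :: "'o \<Rightarrow> 'm"
  cmp :: "'m \<Rightarrow> 'm \<Rightarrow> 'm" (infixl \<open>\<cdot>\<index>\<close> 70)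

abbreviation arr :: "('r, 'o, 'm) lincat \<Rightarrow> 'o \<Rightarrow> 'o \<Rightarrow> 'm set"
  where "arr K X Y \<equiv> carrier (Hom K X Y)"

definition lin_maps ::
    "('r, 'z) ring_scheme \<Rightarrow> ('r, 'x) module \<Rightarrow> ('r, 'y) module \<Rightarrow> ('x \<Rightarrow> 'y) set"
  where "lin_maps R M N = {f \<in> carrier M \<rightarrow>\<^sub>E carrier N.
     (\<forall>u \<in> carrier M. \<forall>v \<in> carrier M. f (u \<oplus>\<^bsub>M\<^esub> v) = f u \<oplus>\<^bsub>N\<^esub> f v) \<and>
     (\<forall>r \<in> carrier R. \<forall>u \<in> carrier M. f (r \<odot>\<^bsub>M\<^esub> u) = r \<odot>\<^bsub>N\<^esub> f u)}"

locale linear_category =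
  fixes R :: "('r, 'z) ring_scheme" and K :: "('r, 'o, 'm) lincat"
  assumes cring_R: "cring R"
    and hom_module: "\<lbrakk>X \<in> Ob K; Y \<in> Ob K\<rbrakk> \<Longrightarrow> module R (Hom K X Y)"
    and dom_cod: "\<lbrakk>X \<in> Ob K; Y \<in> Ob K; f \<in> arr K X Y\<rbrakk> \<Longrightarrow> dom K f = X \<and> cod K f = Y"
    and ident_in: "X \<in> Ob K \<Longrightarrow> ident K X \<in> arr K X X"
    and cmp_in: "\<lbrakk>X \<in> Ob K; Y \<in> Ob K; Z \<in> Ob K; f \<in> arr K X Y; g \<in> arr K Y Z\<rbrakk>
      \<Longrightarrow> g \<cdot>\<^bsub>K\<^esub> f \<in> arr K X Z"
    and cmp_ident: "\<lbrakk>X \<in> Ob K; Y \<in> Ob K; f \<in> arr K X Y\<rbrakk>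
      \<Longrightarrow> f \<cdot>\<^bsub>K\<^esub> ident K X = f \<and> ident K Y \<cdot>\<^bsub>K\<^esub> f = f"
    and cmp_assoc: "\<lbrakk>W \<in> Ob K; X \<in> Ob K; Y \<in> Ob K; Z \<in> Ob K;
        f \<in> arr K W X; g \<in> arr K X Y; h \<in> arr K Y Z\<rbrakk>
      \<Longrightarrow> h \<cdot>\<^bsub>K\<^esub> (g \<cdot>\<^bsub>K\<^esub> f) = (h \<cdot>\<^bsub>K\<^esub> g) \<cdot>\<^bsub>K\<^esub> f"
    and cmp_linear_right: "\<lbrakk>X \<in> Ob K; Y \<in> Ob K; Z \<in> Ob K; g \<in> arr K Y Z\<rbrakk>
      \<Longrightarrow> (\<lambda>f \<in> arr K X Y. g \<cdot>\<^bsub>K\<^esub> f) \<in> lin_maps R (Hom K X Y) (Hom K X Z)"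
    and cmp_linear_left: "\<lbrakk>X \<in> Ob K; Y \<in> Ob K; Z \<in> Ob K; f \<in> arr K X Y\<rbrakk>
      \<Longrightarrow> (\<lambda>g \<in> arr K Y Z. g \<cdot>\<^bsub>K\<^esub> f) \<in> lin_maps R (Hom K Y Z) (Hom K X Z)"

definition opp :: "('r, 'o, 'm) lincat \<Rightarrow> ('r, 'o, 'm) lincat"
  where "opp K = \<lparr>Ob = Ob K, Hom = (\<lambda>X Y. Hom K Y X), dom = cod K, cod = dom K,
     ident = ident K, cmp = (\<lambda>g f. f \<cdot>\<^bsub>K\<^esub> g)\<rparr>"

definition is_iso :: "('r, 'o, 'm) lincat \<Rightarrow> 'o \<Rightarrow> 'o \<Rightarrow> 'm \<Rightarrow> bool"
  where "is_iso K X Y f \<longleftrightarrow> f \<in> arr K X Y \<and>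
     (\<exists>g \<in> arr K Y X. g \<cdot>\<^bsub>K\<^esub> f = ident K X \<and> f \<cdot>\<^bsub>K\<^esub> g = ident K Y)"

definition zero_object :: "('r, 'o, 'm) lincat \<Rightarrow> 'o \<Rightarrow> bool"
  where "zero_object K Z \<longleftrightarrow> Z \<in> Ob K \<and>
     (\<forall>X \<in> Ob K. (\<exists>!f. f \<in> arr K X Z) \<and> (\<exists>!f. f \<in> arr K Z X))"

record ('o, 'm) biprod =
  bip :: 'o
  in1 :: 'm
  in2 :: 'm
  pr1 :: 'm
  pr2 :: 'm

definition is_biproduct :: "('r, 'o, 'm) lincat \<Rightarrow> 'o \<Rightarrow> 'o \<Rightarrow> ('o, 'm) biprod \<Rightarrow> bool"
  where "is_biproduct K X Y S \<longleftrightarrow> bip S \<in> Ob K \<and>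
     in1 S \<in> arr K X (bip S) \<and> in2 S \<in> arr K Y (bip S) \<and>
     pr1 S \<in> arr K (bip S) X \<and> pr2 S \<in> arr K (bip S) Y \<and>
     pr1 S \<cdot>\<^bsub>K\<^esub> in1 S = ident K X \<and> pr2 S \<cdot>\<^bsub>K\<^esub> in2 S = ident K Y \<and>
     pr1 S \<cdot>\<^bsub>K\<^esub> in2 S = \<zero>\<^bsub>Hom K Y X\<^esub> \<and> pr2 S \<cdot>\<^bsub>K\<^esub> in1 S = \<zero>\<^bsub>Hom K X Y\<^esub> \<and>
     in1 S \<cdot>\<^bsub>K\<^esub> pr1 S \<oplus>\<^bsub>Hom K (bip S) (bip S)\<^esub> in2 S \<cdot>\<^bsub>K\<^esub> pr2 S = ident K (bip S)"

locale additive_category = linear_category R K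
  for R :: "('r, 'z) ring_scheme" and K :: "('r, 'o, 'm) lincat" +
  assumes has_zero_object: "\<exists>Z. zero_object K Z"
    and has_biproducts: "\<lbrakk>X \<in> Ob K; Y \<in> Ob K\<rbrakk> \<Longrightarrow> \<exists>S. is_biproduct K X Y S"

text \<open>The morphism \<open>f \<oplus> f'\<close> from the biproduct \<open>S\<close> to the biproduct \<open>T\<close>.\<close>

definition mor_dsum ::
    "('r, 'o, 'm) lincat \<Rightarrow> ('o, 'm) biprod \<Rightarrow> ('o, 'm) biprod \<Rightarrow> 'm \<Rightarrow> 'm \<Rightarrow> 'm"
  where "mor_dsum K S T f f' =
     in1 T \<cdot>\<^bsub>K\<^esub> (f \<cdot>\<^bsub>K\<^esub> pr1 S) \<oplus>\<^bsub>Hom K (bip S) (bip T)\<^esub> in2 T \<cdot>\<^bsub>K\<^esub> (f' \<cdot>\<^bsub>K\<^esub> pr2 S)"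


section \<open>Linear functors and natural transformations\<close>

text \<open>
  A bifunctor \<open>F\<close>, contravariant in the first and covariant in the second variable: for
  \<open>c : C' \<rightarrow> C\<close> and \<open>a : A \<rightarrow> A'\<close>, \<open>act F c a\<close> is the map \<open>F(c, a) : F(C, A) \<rightarrow> F(C', A')\<close>.
\<close>

record ('r, 'o, 'm, 'x) bifun =
  val :: "'o \<Rightarrow> 'o \<Rightarrow> ('r, 'x) module"
  act :: "'m \<Rightarrow> 'm \<Rightarrow> 'x \<Rightarrow> 'x"

locale bilinear_functor = linear_category R K
  for R :: "('r, 'z) ring_scheme" and K :: "('r, 'o, 'm) lincat"
    and F :: "('r, 'o, 'm, 'x) bifun" +
  assumes val_module: "\<lbrakk>C \<in> Ob K; A \<in> Ob K\<rbrakk> \<Longrightarrow> module R (val F C A)"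
    and act_linear: "\<lbrakk>C \<in> Ob K; A \<in> Ob K; C' \<in> Ob K; A' \<in> Ob K; c \<in> arr K C' C; a \<in> arr K A A'\<rbrakk>
      \<Longrightarrow> (\<lambda>u \<in> carrier (val F C A). act F c a u) \<in> lin_maps R (val F C A) (val F C' A')"
    and act_ident: "\<lbrakk>C \<in> Ob K; A \<in> Ob K; u \<in> carrier (val F C A)\<rbrakk>
      \<Longrightarrow> act F (ident K C) (ident K A) u = u"
    and act_cmp: "\<lbrakk>C \<in> Ob K; A \<in> Ob K; C' \<in> Ob K; A' \<in> Ob K; C'' \<in> Ob K; A'' \<in> Ob K;
        c \<in> arr K C' C; a \<in> arr K A A'; c' \<in> arr K C'' C'; a' \<in> arr K A' A'';
        u \<in> carrier (val F C A)\<rbrakk>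
      \<Longrightarrow> act F (c \<cdot>\<^bsub>K\<^esub> c') (a' \<cdot>\<^bsub>K\<^esub> a) u = act F c' a' (act F c a u)"
    and act_linear_contra: "\<lbrakk>C \<in> Ob K; A \<in> Ob K; C' \<in> Ob K; A' \<in> Ob K; a \<in> arr K A A';
        u \<in> carrier (val F C A)\<rbrakk>
      \<Longrightarrow> (\<lambda>c \<in> arr K C' C. act F c a u) \<in> lin_maps R (Hom K C' C) (val F C' A')"
    and act_linear_cov: "\<lbrakk>C \<in> Ob K; A \<in> Ob K; C' \<in> Ob K; A' \<in> Ob K; c \<in> arr K C' C;
        u \<in> carrier (val F C A)\<rbrakk>
      \<Longrightarrow> (\<lambda>a \<in> arr K A A'. act F c a u) \<in> lin_maps R (Hom K A A') (val F C' A')"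

definition hom_bifun :: "('r, 'o, 'm) lincat \<Rightarrow> ('r, 'o, 'm, 'm) bifun"
  where "hom_bifun K = \<lparr>val = Hom K, act = (\<lambda>c a f. a \<cdot>\<^bsub>K\<^esub> f \<cdot>\<^bsub>K\<^esub> c)\<rparr>"

text \<open>
  \<open>push K F C a\<close> is \<open>a\<^sub>* = F(C, a)\<close> and \<open>pull K F A c\<close> is \<open>c\<^sup>* = F(c, A)\<close>. The object argument is
  needed because the sets \<open>F(C, A)\<close> may overlap.
\<close>

definition push :: "('r, 'o, 'm) lincat \<Rightarrow> ('r, 'o, 'm, 'x) bifun \<Rightarrow> 'o \<Rightarrow> 'm \<Rightarrow> 'x \<Rightarrow> 'x"
  where "push K F C a = act F (ident K C) a"

definition pull :: "('r, 'o, 'm) lincat \<Rightarrow> ('r, 'o, 'm, 'x) bifun \<Rightarrow> 'o \<Rightarrow> 'm \<Rightarrow> 'x \<Rightarrow> 'x"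
  where "pull K F A c = act F c (ident K A)"

record ('r, 'o, 'm, 'x) linfun =
  fobj :: "'o \<Rightarrow> ('r, 'x) module"
  fmor :: "'m \<Rightarrow> 'x \<Rightarrow> 'x"

text \<open>The functors \<open>F(C, -)\<close> on \<open>K\<close> and \<open>F(-, A)\<close> on \<open>opp K\<close>.\<close>

definition cov :: "('r, 'o, 'm) lincat \<Rightarrow> ('r, 'o, 'm, 'x) bifun \<Rightarrow> 'o \<Rightarrow> ('r, 'o, 'm, 'x) linfun"
  where "cov K F C = \<lparr>fobj = (\<lambda>Y. val F C Y), fmor = push K F C\<rparr>"

definition contra :: "('r, 'o, 'm) lincat \<Rightarrow> ('r, 'o, 'm, 'x) bifun \<Rightarrow> 'o \<Rightarrow> ('r, 'o, 'm, 'x) linfun"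
  where "contra K F A = \<lparr>fobj = (\<lambda>X. val F X A), fmor = pull K F A\<rparr>"

text \<open>
  Natural transformations are extensional families of extensional maps, so that equality of
  functions is equality of natural transformations. With \<open>opp K\<close> in place of \<open>K\<close> one obtains
  the morphisms between contravariant functors.
\<close>

definition nat_trans :: "('r, 'z) ring_scheme \<Rightarrow> ('r, 'o, 'm) lincat
    \<Rightarrow> ('r, 'o, 'm, 'x) linfun \<Rightarrow> ('r, 'o, 'm, 'y) linfun \<Rightarrow> ('o \<Rightarrow> 'x \<Rightarrow> 'y) set"
  where "nat_trans R K P Q = {\<eta> \<in> (\<Pi>\<^sub>E X \<in> Ob K. lin_maps R (fobj P X) (fobj Q X)).
     \<forall>X \<in> Ob K. \<forall>Y \<in> Ob K. \<forall>f \<in> arr K X Y. \<forall>u \<in> carrier (fobj P X).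
       \<eta> Y (fmor P f u) = fmor Q f (\<eta> X u)}"

definition bifun_trans :: "('r, 'z) ring_scheme \<Rightarrow> ('r, 'o, 'm) lincat
    \<Rightarrow> ('r, 'o, 'm, 'x) bifun \<Rightarrow> ('r, 'o, 'm, 'y) bifun \<Rightarrow> ('o \<Rightarrow> 'o \<Rightarrow> 'x \<Rightarrow> 'y) set"
  where "bifun_trans R K F G =
    {\<phi> \<in> (\<Pi>\<^sub>E C \<in> Ob K. \<Pi>\<^sub>E A \<in> Ob K. lin_maps R (val F C A) (val G C A)).
     \<forall>C \<in> Ob K. \<forall>A \<in> Ob K. \<forall>C' \<in> Ob K. \<forall>A' \<in> Ob K. \<forall>c \<in> arr K C' C. \<forall>a \<in> arr K A A'.
       \<forall>u \<in> carrier (val F C A). \<phi> C' A' (act F c a u) = act G c a (\<phi> C A u)}"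

definition bifun_iso :: "('r, 'z) ring_scheme \<Rightarrow> ('r, 'o, 'm) lincat
    \<Rightarrow> ('r, 'o, 'm, 'x) bifun \<Rightarrow> ('r, 'o, 'm, 'y) bifun \<Rightarrow> ('o \<Rightarrow> 'o \<Rightarrow> 'x \<Rightarrow> 'y) set"
  where "bifun_iso R K F G = {\<phi> \<in> bifun_trans R K F G.
     \<forall>C \<in> Ob K. \<forall>A \<in> Ob K. bij_betw (\<phi> C A) (carrier (val F C A)) (carrier (val G C A))}"


section \<open>Extriangulated categories\<close>

definition ext_morphism :: "('r, 'o, 'm) lincat \<Rightarrow> ('r, 'o, 'm, 'e) bifun
    \<Rightarrow> 'o \<Rightarrow> 'o \<Rightarrow> 'e \<Rightarrow> 'o \<Rightarrow> 'o \<Rightarrow> 'e \<Rightarrow> 'm \<Rightarrow> 'm \<Rightarrow> bool"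
  where "ext_morphism K E C A \<delta> C' A' \<delta>' a c \<longleftrightarrow>
     a \<in> arr K A A' \<and> c \<in> arr K C C' \<and> push K E C a \<delta> = pull K E A' c \<delta>'"

text \<open>\<open>\<theta> = \<delta> \<oplus> \<delta>'\<close>, relative to biproducts \<open>T\<close> of \<open>C, C'\<close> and \<open>S\<close> of \<open>A, A'\<close>.\<close>

definition is_ext_dsum :: "('r, 'o, 'm, 'e) bifun \<Rightarrow> 'o \<Rightarrow> 'o \<Rightarrow> 'o \<Rightarrow> 'o
    \<Rightarrow> ('o, 'm) biprod \<Rightarrow> ('o, 'm) biprod \<Rightarrow> 'e \<Rightarrow> 'e \<Rightarrow> 'e \<Rightarrow> bool"
  where "is_ext_dsum E C A C' A' T S \<delta> \<delta>' \<theta> \<longleftrightarrow> \<theta> \<in> carrier (val E (bip T) (bip S)) \<and>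
     act E (in1 T) (pr1 S) \<theta> = \<delta> \<and> act E (in2 T) (pr2 S) \<theta> = \<delta>' \<and>
     act E (in1 T) (pr2 S) \<theta> = \<zero>\<^bsub>val E C A'\<^esub> \<and> act E (in2 T) (pr1 S) \<theta> = \<zero>\<^bsub>val E C' A\<^esub>"

text \<open>A sequence \<open>A \<rightarrow> B \<rightarrow> C\<close> with morphisms \<open>x, y\<close> is the triple \<open>(x, B, y)\<close>.\<close>

definition seqs :: "('r, 'o, 'm) lincat \<Rightarrow> 'o \<Rightarrow> 'o \<Rightarrow> ('m \<times> 'o \<times> 'm) set"
  where "seqs K A C = {(x, B, y). B \<in> Ob K \<and> x \<in> arr K A B \<and> y \<in> arr K B C}"

definition seq_equiv ::
    "('r, 'o, 'm) lincat \<Rightarrow> 'o \<Rightarrow> 'o \<Rightarrow> (('m \<times> 'o \<times> 'm) \<times> ('m \<times> 'o \<times> 'm)) set"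
  where "seq_equiv K A C = {((x, B, y), (x', B', y')).
     (x, B, y) \<in> seqs K A C \<and> (x', B', y') \<in> seqs K A C \<and>
     (\<exists>b. is_iso K B B' b \<and> b \<cdot>\<^bsub>K\<^esub> x = x' \<and> y' \<cdot>\<^bsub>K\<^esub> b = y)}"

text \<open>
  \<open>s C A \<delta>\<close> is the equivalence class \<open>\<ss>(\<delta>)\<close> of \<open>\<delta> \<in> E(C, A)\<close>, so
  \<open>(x, B, y) \<in> s C A \<delta>\<close> expresses \<open>\<ss>(\<delta>) = [A \<rightarrow> B \<rightarrow> C]\<close>.
\<close>

type_synonym ('o, 'm, 'e) realization = "'o \<Rightarrow> 'o \<Rightarrow> 'e \<Rightarrow> ('m \<times> 'o \<times> 'm) set"

locale additive_realization =
  fixes K :: "('r, 'o, 'm) lincat" and E :: "('r, 'o, 'm, 'e) bifun"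
    and s :: "('o, 'm, 'e) realization"
  assumes real_class: "\<lbrakk>C \<in> Ob K; A \<in> Ob K; \<delta> \<in> carrier (val E C A)\<rbrakk>
      \<Longrightarrow> s C A \<delta> \<in> seqs K A C // seq_equiv K A C"
    and real_lift: "\<lbrakk>C \<in> Ob K; A \<in> Ob K; C' \<in> Ob K; A' \<in> Ob K;
        \<delta> \<in> carrier (val E C A); \<delta>' \<in> carrier (val E C' A'); ext_morphism K E C A \<delta> C' A' \<delta>' a c;
        (x, B, y) \<in> s C A \<delta>; (x', B', y') \<in> s C' A' \<delta>'\<rbrakk>
      \<Longrightarrow> \<exists>b \<in> arr K B B'. b \<cdot>\<^bsub>K\<^esub> x = x' \<cdot>\<^bsub>K\<^esub> a \<and> y' \<cdot>\<^bsub>K\<^esub> b = c \<cdot>\<^bsub>K\<^esub> y"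
    and real_zero: "\<lbrakk>C \<in> Ob K; A \<in> Ob K; is_biproduct K A C S\<rbrakk>
      \<Longrightarrow> (in1 S, bip S, pr2 S) \<in> s C A \<zero>\<^bsub>val E C A\<^esub>"
    and real_dsum: "\<lbrakk>C \<in> Ob K; A \<in> Ob K; C' \<in> Ob K; A' \<in> Ob K;
        \<delta> \<in> carrier (val E C A); \<delta>' \<in> carrier (val E C' A');
        (x, B, y) \<in> s C A \<delta>; (x', B', y') \<in> s C' A' \<delta>';
        is_biproduct K A A' SA; is_biproduct K B B' SB; is_biproduct K C C' SC;
        is_ext_dsum E C A C' A' SC SA \<delta> \<delta>' \<theta>\<rbrakk>
      \<Longrightarrow> (mor_dsum K SA SB x x', bip SB, mor_dsum K SB SC y y') \<in> s (bip SC) (bip SA) \<theta>"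

definition ET3 :: "('r, 'o, 'm) lincat \<Rightarrow> ('r, 'o, 'm, 'e) bifun \<Rightarrow> ('o, 'm, 'e) realization \<Rightarrow> bool"
  where "ET3 K E s \<longleftrightarrow> (\<forall>A \<in> Ob K. \<forall>C \<in> Ob K. \<forall>A' \<in> Ob K. \<forall>C' \<in> Ob K.
     \<forall>\<delta> \<in> carrier (val E C A). \<forall>\<delta>' \<in> carrier (val E C' A'). \<forall>x B y x' B' y' a b.
       (x, B, y) \<in> s C A \<delta> \<and> (x', B', y') \<in> s C' A' \<delta>' \<and>
       a \<in> arr K A A' \<and> b \<in> arr K B B' \<and> b \<cdot>\<^bsub>K\<^esub> x = x' \<cdot>\<^bsub>K\<^esub> a \<longrightarrow>
       (\<exists>c \<in> arr K C C'. c \<cdot>\<^bsub>K\<^esub> y = y' \<cdot>\<^bsub>K\<^esub> b \<and> push K E C a \<delta> = pull K E A' c \<delta>'))"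

definition ET4 :: "('r, 'o, 'm) lincat \<Rightarrow> ('r, 'o, 'm, 'e) bifun \<Rightarrow> ('o, 'm, 'e) realization \<Rightarrow> bool"
  where "ET4 K E s \<longleftrightarrow> (\<forall>A \<in> Ob K. \<forall>B \<in> Ob K. \<forall>C \<in> Ob K. \<forall>D \<in> Ob K. \<forall>F \<in> Ob K.
     \<forall>\<delta> \<in> carrier (val E D A). \<forall>\<delta>' \<in> carrier (val E F B). \<forall>f f' g g'.
       (f, B, f') \<in> s D A \<delta> \<and> (g, C, g') \<in> s F B \<delta>' \<longrightarrow>
       (\<exists>L \<in> Ob K. \<exists>d \<in> arr K D L. \<exists>e \<in> arr K L F. \<exists>h' \<in> arr K C L. \<exists>\<delta>'' \<in> carrier (val E L A).
          h' \<cdot>\<^bsub>K\<^esub> g = d \<cdot>\<^bsub>K\<^esub> f' \<and> e \<cdot>\<^bsub>K\<^esub> h' = g' \<and>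
          (g \<cdot>\<^bsub>K\<^esub> f, C, h') \<in> s L A \<delta>'' \<and>
          (d, L, e) \<in> s F D (push K E F f' \<delta>') \<and>
          pull K E A d \<delta>'' = \<delta> \<and> push K E L f \<delta>'' = pull K E B e \<delta>'))"

text \<open>The opposite structure, used to state the dual axioms.\<close>

definition opp_bifun :: "('r, 'o, 'm, 'e) bifun \<Rightarrow> ('r, 'o, 'm, 'e) bifun"
  where "opp_bifun E = \<lparr>val = (\<lambda>X Y. val E Y X), act = (\<lambda>c a. act E a c)\<rparr>"

definition opp_real :: "('o, 'm, 'e) realization \<Rightarrow> ('o, 'm, 'e) realization"
  where "opp_real s = (\<lambda>X Y \<delta>. {(y, B, x). (x, B, y) \<in> s Y X \<delta>})"

locale extriangulated_category =
  additive_category R K + bilinear_functor R K E + additive_realization K E s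
  for R :: "('r, 'z) ring_scheme" and K :: "('r, 'o, 'm) lincat"
    and E :: "('r, 'o, 'm, 'e) bifun" and s :: "('o, 'm, 'e) realization" +
  assumes ET3: "ET3 K E s"
    and ET3_op: "ET3 (opp K) (opp_bifun E) (opp_real s)"
    and ET4: "ET4 K E s"
    and ET4_op: "ET4 (opp K) (opp_bifun E) (opp_real s)"

definition deflation :: "('r, 'o, 'm) lincat \<Rightarrow> ('r, 'o, 'm, 'e) bifun \<Rightarrow> ('o, 'm, 'e) realization
    \<Rightarrow> 'o \<Rightarrow> 'o \<Rightarrow> 'm \<Rightarrow> bool"
  where "deflation K E s B C y \<longleftrightarrow>
     (\<exists>A \<in> Ob K. \<exists>\<delta> \<in> carrier (val E C A). \<exists>x. (x, B, y) \<in> s C A \<delta>)"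

definition projective_morphism ::
    "('r, 'o, 'm) lincat \<Rightarrow> ('r, 'o, 'm, 'e) bifun \<Rightarrow> 'o \<Rightarrow> 'o \<Rightarrow> 'm \<Rightarrow> bool"
  where "projective_morphism K E X Y f \<longleftrightarrow> f \<in> arr K X Y \<and>
     (\<forall>A \<in> Ob K. \<forall>\<delta> \<in> carrier (val E Y A). pull K E A f \<delta> = \<zero>\<^bsub>val E X A\<^esub>)"

definition enough_projective_morphisms ::
    "('r, 'o, 'm) lincat \<Rightarrow> ('r, 'o, 'm, 'e) bifun \<Rightarrow> ('o, 'm, 'e) realization \<Rightarrow> bool"
  where "enough_projective_morphisms K E s \<longleftrightarrow>
     (\<forall>C \<in> Ob K. \<exists>G \<in> Ob K. \<exists>g. deflation K E s G C g \<and> projective_morphism K E G C g)"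


section \<open>Coends and positive extensions\<close>

text \<open>
  The coend of \<open>F(M, Y) \<otimes>\<^sub>R G(X, M)\<close> over \<open>M\<close>. A list of triples \<open>(M, \<rho>, \<lambda>)\<close> stands for the sum
  of the classes of \<open>\<rho> \<otimes> \<lambda>\<close>. Rule \<open>zero\<close> has to be included because formal sums form a monoid
  only; with it the quotient is a group, \<open>(M, -\<rho>, \<lambda>)\<close> being inverse to \<open>(M, \<rho>, \<lambda>)\<close>. As scalars can
  be absorbed into \<open>\<rho>\<close>, formal sums need no coefficients.
\<close>

definition coend_sums :: "('r, 'o, 'm) lincat \<Rightarrow> ('r, 'o, 'm, 'x) bifun \<Rightarrow> ('r, 'o, 'm, 'y) bifun
    \<Rightarrow> 'o \<Rightarrow> 'o \<Rightarrow> ('o \<times> 'x \<times> 'y) list set"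
  where "coend_sums K F G X Y =
     lists {(M, \<rho>, l). M \<in> Ob K \<and> \<rho> \<in> carrier (val F M Y) \<and> l \<in> carrier (val G X M)}"

inductive coend_eq :: "('r, 'z) ring_scheme \<Rightarrow> ('r, 'o, 'm) lincat \<Rightarrow> ('r, 'o, 'm, 'x) bifun
    \<Rightarrow> ('r, 'o, 'm, 'y) bifun \<Rightarrow> 'o \<Rightarrow> 'o \<Rightarrow> ('o \<times> 'x \<times> 'y) list \<Rightarrow> ('o \<times> 'x \<times> 'y) list \<Rightarrow> bool"
  for R K F G X Y where
  refl: "ts \<in> coend_sums K F G X Y \<Longrightarrow> coend_eq R K F G X Y ts ts"
| sym: "coend_eq R K F G X Y ts us \<Longrightarrow> coend_eq R K F G X Y us ts"
| trans: "\<lbrakk>coend_eq R K F G X Y ts us; coend_eq R K F G X Y us vs\<rbrakk> \<Longrightarrow> coend_eq R K F G X Y ts vs"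
| append: "\<lbrakk>coend_eq R K F G X Y ts ts'; coend_eq R K F G X Y us us'\<rbrakk>
    \<Longrightarrow> coend_eq R K F G X Y (ts @ us) (ts' @ us')"
| commute: "\<lbrakk>ts \<in> coend_sums K F G X Y; us \<in> coend_sums K F G X Y\<rbrakk>
    \<Longrightarrow> coend_eq R K F G X Y (ts @ us) (us @ ts)"
| zero: "\<lbrakk>M \<in> Ob K; l \<in> carrier (val G X M)\<rbrakk>
    \<Longrightarrow> coend_eq R K F G X Y [(M, \<zero>\<^bsub>val F M Y\<^esub>, l)] []"
| add_left: "\<lbrakk>M \<in> Ob K; \<rho> \<in> carrier (val F M Y); \<rho>' \<in> carrier (val F M Y); l \<in> carrier (val G X M)\<rbrakk>
    \<Longrightarrow> coend_eq R K F G X Y [(M, \<rho> \<oplus>\<^bsub>val F M Y\<^esub> \<rho>', l)] [(M, \<rho>, l), (M, \<rho>', l)]"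
| add_right: "\<lbrakk>M \<in> Ob K; \<rho> \<in> carrier (val F M Y); l \<in> carrier (val G X M); l' \<in> carrier (val G X M)\<rbrakk>
    \<Longrightarrow> coend_eq R K F G X Y [(M, \<rho>, l \<oplus>\<^bsub>val G X M\<^esub> l')] [(M, \<rho>, l), (M, \<rho>, l')]"
| balanced: "\<lbrakk>M \<in> Ob K; r \<in> carrier R; \<rho> \<in> carrier (val F M Y); l \<in> carrier (val G X M)\<rbrakk>
    \<Longrightarrow> coend_eq R K F G X Y [(M, r \<odot>\<^bsub>val F M Y\<^esub> \<rho>, l)] [(M, \<rho>, r \<odot>\<^bsub>val G X M\<^esub> l)]"
| dinatural: "\<lbrakk>M \<in> Ob K; M' \<in> Ob K; f \<in> arr K M M';
      \<rho> \<in> carrier (val F M' Y); l \<in> carrier (val G X M)\<rbrakk>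
    \<Longrightarrow> coend_eq R K F G X Y [(M, pull K F Y f \<rho>, l)] [(M', \<rho>, push K G X f l)]"

text \<open>
  The elements of the coend are chosen representatives of the equivalence classes rather than
  the classes themselves; this keeps the type small enough to be iterated.
\<close>

definition coend_class :: "('r, 'z) ring_scheme \<Rightarrow> ('r, 'o, 'm) lincat \<Rightarrow> ('r, 'o, 'm, 'x) bifun
    \<Rightarrow> ('r, 'o, 'm, 'y) bifun \<Rightarrow> 'o \<Rightarrow> 'o \<Rightarrow> ('o \<times> 'x \<times> 'y) list \<Rightarrow> ('o \<times> 'x \<times> 'y) list"
  where "coend_class R K F G X Y ts = (SOME us. coend_eq R K F G X Y ts us)"

definition coend :: "('r, 'z) ring_scheme \<Rightarrow> ('r, 'o, 'm) lincat \<Rightarrow> ('r, 'o, 'm, 'x) bifun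
    \<Rightarrow> ('r, 'o, 'm, 'y) bifun \<Rightarrow> ('r, 'o, 'm, ('o \<times> 'x \<times> 'y) list) bifun"
  where "coend R K F G = \<lparr>
     val = (\<lambda>X Y. \<lparr>
       carrier = coend_class R K F G X Y ` coend_sums K F G X Y,
       mult = (\<lambda>_ _. undefined), one = undefined,
       zero = coend_class R K F G X Y [],
       add = (\<lambda>ts us. coend_class R K F G X Y (ts @ us)),
       smult = (\<lambda>r ts. coend_class R K F G X Y (map (\<lambda>(M, \<rho>, l). (M, r \<odot>\<^bsub>val F M Y\<^esub> \<rho>, l)) ts))\<rparr>),
     act = (\<lambda>c a ts. coend_class R K F G (dom K c) (cod K a)
       (map (\<lambda>(M, \<rho>, l). (M, push K F M a \<rho>, pull K G M c l)) ts))\<rparr>"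

text \<open>A common type for the elements of all positive extension modules.\<close>

datatype ('o, 'm, 'e) pos =
    Hom_el 'm
  | Ext_el 'e
  | Sum_el "('o \<times> ('o, 'm, 'e) pos \<times> 'e) list"

text \<open>Transport of a bifunctor along an injective renaming of elements.\<close>

definition relabel :: "('x \<Rightarrow> 'y) \<Rightarrow> ('r, 'o, 'm, 'x) bifun \<Rightarrow> ('r, 'o, 'm, 'y) bifun"
  where "relabel h F = \<lparr>
     val = (\<lambda>X Y. \<lparr>
       carrier = h ` carrier (val F X Y),
       mult = (\<lambda>_ _. undefined), one = undefined,
       zero = h \<zero>\<^bsub>val F X Y\<^esub>,
       add = (\<lambda>u v. h (the_inv h u \<oplus>\<^bsub>val F X Y\<^esub> the_inv h v)),
       smult = (\<lambda>r u. h (r \<odot>\<^bsub>val F X Y\<^esub> the_inv h u))\<rparr>),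
     act = (\<lambda>c a u. h (act F c a (the_inv h u)))\<rparr>"

fun pos_ext :: "('r, 'z) ring_scheme \<Rightarrow> ('r, 'o, 'm) lincat \<Rightarrow> ('r, 'o, 'm, 'e) bifun \<Rightarrow> nat
    \<Rightarrow> ('r, 'o, 'm, ('o, 'm, 'e) pos) bifun"
  where "pos_ext R K E 0 = relabel Hom_el (hom_bifun K)"
  | "pos_ext R K E (Suc 0) = relabel Ext_el E"
  | "pos_ext R K E (Suc (Suc n)) = relabel Sum_el (coend R K (pos_ext R K E (Suc n)) E)"

text \<open>
  \<open>cup R K E n C A \<delta> Y l\<close> is \<open>\<delta>\<^sup>\<sharp>(l) = l \<union> \<delta> \<in> \<bbbE>\<^bsup>n+1\<^esup>(C, Y)\<close> for \<open>l \<in> \<bbbE>\<^bsup>n\<^esup>(A, Y)\<close> and \<open>\<delta> \<in> E(C, A)\<close>.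
\<close>

fun cup :: "('r, 'z) ring_scheme \<Rightarrow> ('r, 'o, 'm) lincat \<Rightarrow> ('r, 'o, 'm, 'e) bifun \<Rightarrow> nat
    \<Rightarrow> 'o \<Rightarrow> 'o \<Rightarrow> 'e \<Rightarrow> 'o \<Rightarrow> ('o, 'm, 'e) pos \<Rightarrow> ('o, 'm, 'e) pos"
  where "cup R K E 0 C A \<delta> Y l = Ext_el (push K E C (the_inv Hom_el l) \<delta>)"
  | "cup R K E (Suc n) C A \<delta> Y l = Sum_el (coend_class R K (pos_ext R K E (Suc n)) E C Y [(A, l, \<delta>)])"


section \<open>Negative extensions\<close>

text \<open>
  Negative degrees are indexed by natural numbers: index \<open>n\<close> stands for degree \<open>-n\<close>.
\<close>

definition neg_ext :: "('r, 'z) ring_scheme \<Rightarrow> ('r, 'o, 'm) lincat \<Rightarrow> ('r, 'o, 'm, 'e) bifun \<Rightarrow> nat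
    \<Rightarrow> ('r, 'o, 'm, 'o \<Rightarrow> ('o, 'm, 'e) pos \<Rightarrow> 'm) bifun"
  where "neg_ext R K E n = \<lparr>
     val = (\<lambda>C A. \<lparr>
       carrier = nat_trans R K (cov K (pos_ext R K E n) A) (cov K (hom_bifun K) C),
       mult = (\<lambda>_ _. undefined), one = undefined,
       zero = (\<lambda>Y \<in> Ob K. \<lambda>l \<in> carrier (val (pos_ext R K E n) A Y). \<zero>\<^bsub>Hom K C Y\<^esub>),
       add = (\<lambda>\<eta> \<zeta>. \<lambda>Y \<in> Ob K. \<lambda>l \<in> carrier (val (pos_ext R K E n) A Y).
         \<eta> Y l \<oplus>\<^bsub>Hom K C Y\<^esub> \<zeta> Y l),
       smult = (\<lambda>r \<eta>. \<lambda>Y \<in> Ob K. \<lambda>l \<in> carrier (val (pos_ext R K E n) A Y).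
         r \<odot>\<^bsub>Hom K C Y\<^esub> \<eta> Y l)\<rparr>),
     act = (\<lambda>c a \<eta>. \<lambda>Y \<in> Ob K. \<lambda>l \<in> carrier (val (pos_ext R K E n) (cod K a) Y).
       \<eta> Y (pull K (pos_ext R K E n) Y a l) \<cdot>\<^bsub>K\<^esub> c)\<rparr>"

text \<open>
  For \<open>\<delta> \<in> E(C, A)\<close>, \<open>neg_conn R K E n C A \<delta>\<close> is \<open>\<delta>\<^sub>\<sharp>\<close> from degree \<open>-(n+1)\<close> at \<open>(-, C)\<close> to degree
  \<open>-n\<close> at \<open>(-, A)\<close>.
\<close>

definition neg_conn :: "('r, 'z) ring_scheme \<Rightarrow> ('r, 'o, 'm) lincat \<Rightarrow> ('r, 'o, 'm, 'e) bifun \<Rightarrow> nat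
    \<Rightarrow> 'o \<Rightarrow> 'o \<Rightarrow> 'e \<Rightarrow> 'o \<Rightarrow> ('o \<Rightarrow> ('o, 'm, 'e) pos \<Rightarrow> 'm) \<Rightarrow> 'o \<Rightarrow> ('o, 'm, 'e) pos \<Rightarrow> 'm"
  where "neg_conn R K E n C A \<delta> =
     (\<lambda>X \<in> Ob K. \<lambda>\<eta> \<in> carrier (val (neg_ext R K E (Suc n)) X C).
       \<lambda>Y \<in> Ob K. \<lambda>l \<in> carrier (val (pos_ext R K E n) A Y). \<eta> Y (cup R K E n C A \<delta> Y l))"

text \<open>The Yoneda identification of the degree zero term with \<open>Hom\<close>.\<close>

definition yoneda :: "('r, 'z) ring_scheme \<Rightarrow> ('r, 'o, 'm) lincat \<Rightarrow> ('r, 'o, 'm, 'e) bifun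
    \<Rightarrow> 'o \<Rightarrow> 'o \<Rightarrow> ('o \<Rightarrow> ('o, 'm, 'e) pos \<Rightarrow> 'm) \<Rightarrow> 'm"
  where "yoneda R K E = (\<lambda>C \<in> Ob K. \<lambda>A \<in> Ob K. \<lambda>\<eta> \<in> carrier (val (neg_ext R K E 0) C A).
     \<eta> A (Hom_el (ident K A)))"


section \<open>Covariant partial delta-functors\<close>

definition exact_at ::
    "('r, 'x) module \<Rightarrow> ('x \<Rightarrow> 'y) \<Rightarrow> ('r, 'y) module \<Rightarrow> ('y \<Rightarrow> 'w) \<Rightarrow> ('r, 'w) module \<Rightarrow> bool"
  where "exact_at L f M g N \<longleftrightarrow> f ` carrier L = {u \<in> carrier M. g u = \<zero>\<^bsub>N\<^esub>}"

text \<open>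
  \<open>G n\<close> is \<open>G\<^bsup>-n\<^esup>\<close> and \<open>conn n C A \<delta>\<close> is the connecting morphism
  \<open>\<delta>\<^sub>\<sharp> : G\<^bsup>-(n+1)\<^esup>(-, C) \<rightarrow> G\<^bsup>-n\<^esup>(-, A)\<close>. Exactness in \<open>Mod K\<close> is exactness at each object \<open>X\<close>; it is
  not required at \<open>G\<^bsup>0\<^esup>(-, C)\<close>.
\<close>

locale partial_delta_functor =
  fixes R :: "('r, 'z) ring_scheme" and K :: "('r, 'o, 'm) lincat"
    and E :: "('r, 'o, 'm, 'e) bifun" and s :: "('o, 'm, 'e) realization"
    and G :: "nat \<Rightarrow> ('r, 'o, 'm, 'g) bifun"
    and conn :: "nat \<Rightarrow> 'o \<Rightarrow> 'o \<Rightarrow> 'e \<Rightarrow> 'o \<Rightarrow> 'g \<Rightarrow> 'g"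
  assumes terms: "bilinear_functor R K (G n)"
    and conn_morphism: "\<lbrakk>C \<in> Ob K; A \<in> Ob K; \<delta> \<in> carrier (val E C A)\<rbrakk>
      \<Longrightarrow> conn n C A \<delta> \<in> nat_trans R (opp K) (contra K (G (Suc n)) C) (contra K (G n) A)"
    and conn_natural: "\<lbrakk>C \<in> Ob K; A \<in> Ob K; C' \<in> Ob K; A' \<in> Ob K;
        \<delta> \<in> carrier (val E C A); \<delta>' \<in> carrier (val E C' A'); ext_morphism K E C A \<delta> C' A' \<delta>' a c;
        X \<in> Ob K; u \<in> carrier (val (G (Suc n)) X C)\<rbrakk>
      \<Longrightarrow> push K (G n) X a (conn n C A \<delta> X u) = conn n C' A' \<delta>' X (push K (G (Suc n)) X c u)"
    and exact: "\<lbrakk>C \<in> Ob K; A \<in> Ob K; \<delta> \<in> carrier (val E C A); (x, B, y) \<in> s C A \<delta>; X \<in> Ob K\<rbrakk>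
      \<Longrightarrow> exact_at (val (G (Suc n)) X C) (conn n C A \<delta> X) (val (G n) X A) (push K (G n) X x) (val (G n) X B)
        \<and> exact_at (val (G n) X A) (push K (G n) X x) (val (G n) X B) (push K (G n) X y) (val (G n) X C)
        \<and> exact_at (val (G (Suc n)) X B) (push K (G (Suc n)) X y) (val (G (Suc n)) X C)
            (conn n C A \<delta> X) (val (G n) X A)"

text \<open>
  A partial delta-functor whose degree zero term is \<open>Hom\<close>: since the terms \<open>G n\<close> share one element
  type, the identification of \<open>G\<^bsup>0\<^esup>\<close> with \<open>Hom\<close> is recorded as a natural isomorphism \<open>\<theta>\<close>.
\<close>

definition delta_functor_on_hom :: "('r, 'z) ring_scheme \<Rightarrow> ('r, 'o, 'm) lincat
    \<Rightarrow> ('r, 'o, 'm, 'e) bifun \<Rightarrow> ('o, 'm, 'e) realization \<Rightarrow> (nat \<Rightarrow> ('r, 'o, 'm, 'g) bifun)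
    \<Rightarrow> (nat \<Rightarrow> 'o \<Rightarrow> 'o \<Rightarrow> 'e \<Rightarrow> 'o \<Rightarrow> 'g \<Rightarrow> 'g) \<Rightarrow> ('o \<Rightarrow> 'o \<Rightarrow> 'g \<Rightarrow> 'm) \<Rightarrow> bool"
  where "delta_functor_on_hom R K E s G conn \<theta> \<longleftrightarrow>
     partial_delta_functor R K E s G conn \<and> \<theta> \<in> bifun_iso R K (G 0) (hom_bifun K)"

text \<open>
  Morphisms of such: families of natural transformations which are the identity of \<open>Hom\<close> in degree
  zero (under the identifications \<open>\<theta>\<close>, \<open>\<theta>'\<close>) and commute with the connecting morphisms.
\<close>

definition delta_morphism :: "('r, 'z) ring_scheme \<Rightarrow> ('r, 'o, 'm) lincat
    \<Rightarrow> ('r, 'o, 'm, 'e) bifun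
    \<Rightarrow> (nat \<Rightarrow> ('r, 'o, 'm, 'g) bifun) \<Rightarrow> (nat \<Rightarrow> 'o \<Rightarrow> 'o \<Rightarrow> 'e \<Rightarrow> 'o \<Rightarrow> 'g \<Rightarrow> 'g) \<Rightarrow> ('o \<Rightarrow> 'o \<Rightarrow> 'g \<Rightarrow> 'm)
    \<Rightarrow> (nat \<Rightarrow> ('r, 'o, 'm, 'h) bifun) \<Rightarrow> (nat \<Rightarrow> 'o \<Rightarrow> 'o \<Rightarrow> 'e \<Rightarrow> 'o \<Rightarrow> 'h \<Rightarrow> 'h) \<Rightarrow> ('o \<Rightarrow> 'o \<Rightarrow> 'h \<Rightarrow> 'm)
    \<Rightarrow> (nat \<Rightarrow> 'o \<Rightarrow> 'o \<Rightarrow> 'g \<Rightarrow> 'h) \<Rightarrow> bool"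
  where "delta_morphism R K E G conn \<theta> H conn' \<theta>' \<phi> \<longleftrightarrow>
     (\<forall>n. \<phi> n \<in> bifun_trans R K (G n) (H n)) \<and>
     (\<forall>X \<in> Ob K. \<forall>Y \<in> Ob K. \<forall>u \<in> carrier (val (G 0) X Y). \<theta>' X Y (\<phi> 0 X Y u) = \<theta> X Y u) \<and>
     (\<forall>n. \<forall>C \<in> Ob K. \<forall>A \<in> Ob K. \<forall>\<delta> \<in> carrier (val E C A). \<forall>X \<in> Ob K.
        \<forall>u \<in> carrier (val (G (Suc n)) X C).
          \<phi> n X A (conn n C A \<delta> X u) = conn' n C A \<delta> X (\<phi> (Suc n) X C u))"

end

theory Submission
  imports Defs
begin

text \<open>
  The proof follows the principle that an effaceable \<open>\<delta>\<close>-functor is universal, in a setting where only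
  projective morphisms are available. Fix an object \<open>C\<close> and a conflation \<open>N \<rightarrow> P \<rightarrow> C\<close>, realizing \<open>\<kappa>\<close>, whose
  deflation is a projective morphism. Every extension of \<open>C\<close> vanishes on \<open>P\<close> and hence is a pushout
  \<open>a\<^sub>* \<kappa>\<close>. By the dinaturality of the coend, \<open>l \<mapsto> l \<union> \<kappa>\<close> therefore maps \<open>\<bbbE>\<^bsup>n\<^esup>(N, -)\<close> onto \<open>\<bbbE>\<^bsup>n+1\<^esup>(C, -)\<close>, with
  kernel the image of \<open>\<bbbE>\<^bsup>n\<^esup>(P, -)\<close> (\<open>cup_surj\<close>, \<open>cup_factor\<close>). Applying \<open>Hom(-, \<C>(X, -))\<close>, which is left
  exact, shows that \<open>\<kappa>\<^sub>\<sharp>\<close> identifies \<open>\<bbbE>\<^sub>I\<close> of \<open>(X, C)\<close> in degree \<open>-(n+1)\<close> with the kernel of \<open>k\<^sub>*\<close> between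
  its values at \<open>(X, N)\<close> and \<open>(X, P)\<close> in degree \<open>-n\<close> (\<open>neg_conn_inj\<close>, \<open>neg_conn_surj\<close>). A connected sequence with
  this property is called effaceable below, and both claims of the theorem hold for all effaceable
  sequences whose term in degree zero is \<open>Hom\<close>.

  Universality (\<open>comparison_ex1\<close>, \<open>universal\<close>): a morphism into an effaceable sequence is constructed
  degree by degree. Its value at \<open>u\<close> has to be the unique \<open>v\<close> with \<open>\<kappa>\<^sub>\<sharp> v = \<phi> (\<kappa>\<^sub>\<sharp> u)\<close>. Compatibility with any
  other \<open>\<delta>\<close> follows from \<open>\<delta> = a\<^sub>* \<kappa>\<close>, and linearity and naturality follow from uniqueness.

  Exactness (\<open>effaceable_sequence.partial_delta_functor\<close>): let \<open>A \<rightarrow> B \<rightarrow> C\<close> realize \<open>\<delta> = b\<^sub>* \<kappa>\<close>. The axiom (ET4)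
  supplies, up to an isomorphism of \<open>B\<close>, a conflation \<open>N \<rightarrow> P \<oplus> A \<rightarrow> B\<close> with components \<open>k\<close>, \<open>-b\<close> and with \<open>A \<rightarrow> B\<close>
  as second component of the deflation, which realizes the pullback of \<open>\<kappa>\<close> to \<open>B\<close> (\<open>homotopy_pushout\<close>). This one
  conflation drives an induction that starts with the exactness of \<open>\<C>(X, A) \<rightarrow> \<C>(X, B) \<rightarrow> \<C>(X, C)\<close>:
  exactness at \<open>B\<close> in some degree implies exactness at \<open>A\<close> in the same degree, this implies exactness at the
  preceding term at \<open>C\<close>, and this implies exactness at \<open>B\<close> in the next lower degree. In the last step
  the component \<open>P \<rightarrow> B\<close> must be neutralized, and to this end \<open>P \<rightarrow> C\<close> is replaced by a composite of
  two projective deflations.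
\<close>


section \<open>Linear maps, linear categories and bilinear functors\<close>

lemma lin_maps_closed: "\<lbrakk>f \<in> lin_maps R M N; u \<in> carrier M\<rbrakk> \<Longrightarrow> f u \<in> carrier N"
  and lin_maps_add: "\<lbrakk>f \<in> lin_maps R M N; u \<in> carrier M; v \<in> carrier M\<rbrakk>
    \<Longrightarrow> f (u \<oplus>\<^bsub>M\<^esub> v) = f u \<oplus>\<^bsub>N\<^esub> f v"
  and lin_maps_smult: "\<lbrakk>f \<in> lin_maps R M N; r \<in> carrier R; u \<in> carrier M\<rbrakk>
    \<Longrightarrow> f (r \<odot>\<^bsub>M\<^esub> u) = r \<odot>\<^bsub>N\<^esub> f u"
  and lin_maps_extensional: "f \<in> lin_maps R M N \<Longrightarrow> f \<in> extensional (carrier M)"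
  by (auto simp: lin_maps_def PiE_def)

lemma lin_maps_zero:
  assumes "module R M" "module R N" "f \<in> lin_maps R M N"
  shows "f \<zero>\<^bsub>M\<^esub> = \<zero>\<^bsub>N\<^esub>"
proof -
  interpret M: module R M by fact
  interpret N: module R N by fact
  have "f \<zero>\<^bsub>M\<^esub> \<oplus>\<^bsub>N\<^esub> f \<zero>\<^bsub>M\<^esub> = f \<zero>\<^bsub>M\<^esub>"
    using lin_maps_add[OF assms(3), of "\<zero>\<^bsub>M\<^esub>" "\<zero>\<^bsub>M\<^esub>"] by simp
  then show ?thesis
    using lin_maps_closed[OF assms(3)] by (metis M.zero_closed N.add.r_cancel_one')
qed

lemma lin_maps_minus:
  assumes "module R M" "module R N" "f \<in> lin_maps R M N" "u \<in> carrier M"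
  shows "f (\<ominus>\<^bsub>M\<^esub> u) = \<ominus>\<^bsub>N\<^esub> f u"
proof -
  interpret M: module R M by fact
  interpret N: module R N by fact
  have "f (\<ominus>\<^bsub>M\<^esub> u) \<oplus>\<^bsub>N\<^esub> f u = \<zero>\<^bsub>N\<^esub>"
    using lin_maps_add[OF assms(3), of "\<ominus>\<^bsub>M\<^esub> u" u] lin_maps_zero[OF assms(1-3)] assms(4)
    by (simp add: M.l_neg)
  then show ?thesis
    using lin_maps_closed[OF assms(3)] assms(4) by (simp add: N.minus_equality)
qed

lemma restrict_in_lin_maps:
  assumes "module R M"
    and "\<And>u. u \<in> carrier M \<Longrightarrow> h u \<in> carrier N"
    and "\<And>u v. \<lbrakk>u \<in> carrier M; v \<in> carrier M\<rbrakk> \<Longrightarrow> h (u \<oplus>\<^bsub>M\<^esub> v) = h u \<oplus>\<^bsub>N\<^esub> h v"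
    and "\<And>r u. \<lbrakk>r \<in> carrier R; u \<in> carrier M\<rbrakk> \<Longrightarrow> h (r \<odot>\<^bsub>M\<^esub> u) = r \<odot>\<^bsub>N\<^esub> h u"
  shows "(\<lambda>u \<in> carrier M. h u) \<in> lin_maps R M N"
proof -
  interpret M: module R M by fact
  show ?thesis using assms(2-) by (auto simp: lin_maps_def)
qed

lemma restrict_lin_maps_closed:
    "\<lbrakk>(\<lambda>u \<in> carrier M. h u) \<in> lin_maps R M N; u \<in> carrier M\<rbrakk> \<Longrightarrow> h u \<in> carrier N"
  and restrict_lin_maps_add: "\<lbrakk>(\<lambda>u \<in> carrier M. h u) \<in> lin_maps R M N; module R M;
      u \<in> carrier M; v \<in> carrier M\<rbrakk> \<Longrightarrow> h (u \<oplus>\<^bsub>M\<^esub> v) = h u \<oplus>\<^bsub>N\<^esub> h v"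
  and restrict_lin_maps_smult: "\<lbrakk>(\<lambda>u \<in> carrier M. h u) \<in> lin_maps R M N; module R M;
      r \<in> carrier R; u \<in> carrier M\<rbrakk> \<Longrightarrow> h (r \<odot>\<^bsub>M\<^esub> u) = r \<odot>\<^bsub>N\<^esub> h u"
proof -
  show "\<lbrakk>(\<lambda>u \<in> carrier M. h u) \<in> lin_maps R M N; u \<in> carrier M\<rbrakk> \<Longrightarrow> h u \<in> carrier N"
    using lin_maps_closed by fastforce
next
  assume h: "(\<lambda>u \<in> carrier M. h u) \<in> lin_maps R M N" and M: "module R M"
    and u: "u \<in> carrier M" and v: "v \<in> carrier M"
  interpret M: module R M by fact
  show "h (u \<oplus>\<^bsub>M\<^esub> v) = h u \<oplus>\<^bsub>N\<^esub> h v"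
    using lin_maps_add[OF h u v] u v by simp
next
  assume h: "(\<lambda>u \<in> carrier M. h u) \<in> lin_maps R M N" and M: "module R M"
    and r: "r \<in> carrier R" and u: "u \<in> carrier M"
  interpret M: module R M by fact
  show "h (r \<odot>\<^bsub>M\<^esub> u) = r \<odot>\<^bsub>N\<^esub> h u"
    using lin_maps_smult[OF h r u] r u by simp
qed

lemma restrict_lin_maps_zero:
  assumes "(\<lambda>u \<in> carrier M. h u) \<in> lin_maps R M N" "module R M" "module R N"
  shows "h \<zero>\<^bsub>M\<^esub> = \<zero>\<^bsub>N\<^esub>"
proof -
  interpret M: module R M by fact
  show ?thesis using lin_maps_zero[OF assms(2,3,1)] by simp
qed

lemma restrict_lin_maps_minus:
  assumes "(\<lambda>u \<in> carrier M. h u) \<in> lin_maps R M N" "module R M" "module R N" "u \<in> carrier M"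
  shows "h (\<ominus>\<^bsub>M\<^esub> u) = \<ominus>\<^bsub>N\<^esub> h u"
proof -
  interpret M: module R M by fact
  show ?thesis using lin_maps_minus[OF assms(2,3,1,4)] assms(4) by simp
qed

context linear_category
begin

abbreviation cmp_K (infixl \<open>\<star>\<close> 70) where "g \<star> f \<equiv> g \<cdot>\<^bsub>K\<^esub> f"

lemma hom_group: "\<lbrakk>X \<in> Ob K; Y \<in> Ob K\<rbrakk> \<Longrightarrow> abelian_group (Hom K X Y)"
  using hom_module module.axioms(2) by blast

lemma zero_arr [simp]: "\<lbrakk>X \<in> Ob K; Y \<in> Ob K\<rbrakk> \<Longrightarrow> \<zero>\<^bsub>Hom K X Y\<^esub> \<in> arr K X Y"
  using hom_group abelian_group.a_group abelian_monoid.zero_closed abelian_group.axioms by blast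

lemma add_arr [simp]: "\<lbrakk>X \<in> Ob K; Y \<in> Ob K; f \<in> arr K X Y; g \<in> arr K X Y\<rbrakk>
    \<Longrightarrow> f \<oplus>\<^bsub>Hom K X Y\<^esub> g \<in> arr K X Y"
  using hom_group abelian_group.axioms abelian_monoid.a_closed by metis

lemma minus_arr [simp]: "\<lbrakk>X \<in> Ob K; Y \<in> Ob K; f \<in> arr K X Y\<rbrakk>
    \<Longrightarrow> \<ominus>\<^bsub>Hom K X Y\<^esub> f \<in> arr K X Y"
  using hom_group abelian_group.a_inv_closed by metis

lemma smult_arr [simp]: "\<lbrakk>X \<in> Ob K; Y \<in> Ob K; r \<in> carrier R; f \<in> arr K X Y\<rbrakk>
    \<Longrightarrow> r \<odot>\<^bsub>Hom K X Y\<^esub> f \<in> arr K X Y"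
  using hom_module module.smult_closed by metis

lemmas ident_arr [simp] = ident_in

lemma cmp_arr [simp]: "\<lbrakk>f \<in> arr K X Y; g \<in> arr K Y Z; X \<in> Ob K; Y \<in> Ob K; Z \<in> Ob K\<rbrakk>
    \<Longrightarrow> g \<star> f \<in> arr K X Z"
  by (rule cmp_in)

lemma cmp_ident_right [simp]: "\<lbrakk>f \<in> arr K X Y; X \<in> Ob K; Y \<in> Ob K\<rbrakk> \<Longrightarrow> f \<star> ident K X = f"
  and cmp_ident_left [simp]: "\<lbrakk>f \<in> arr K X Y; X \<in> Ob K; Y \<in> Ob K\<rbrakk> \<Longrightarrow> ident K Y \<star> f = f"
  using cmp_ident by blast+

lemma ident_cmp_ident [simp]: "X \<in> Ob K \<Longrightarrow> ident K X \<star> ident K X = ident K X"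
  using cmp_ident ident_in by blast

lemma assoc: "\<lbrakk>f \<in> arr K W X; g \<in> arr K X Y; h \<in> arr K Y Z; W \<in> Ob K; X \<in> Ob K; Y \<in> Ob K; Z \<in> Ob K\<rbrakk>
    \<Longrightarrow> (h \<star> g) \<star> f = h \<star> (g \<star> f)"
  by (simp add: cmp_assoc)

lemma hom_l_zero: "\<lbrakk>X \<in> Ob K; Y \<in> Ob K; f \<in> arr K X Y\<rbrakk> \<Longrightarrow> \<zero>\<^bsub>Hom K X Y\<^esub> \<oplus>\<^bsub>Hom K X Y\<^esub> f = f"
  and hom_r_zero: "\<lbrakk>X \<in> Ob K; Y \<in> Ob K; f \<in> arr K X Y\<rbrakk> \<Longrightarrow> f \<oplus>\<^bsub>Hom K X Y\<^esub> \<zero>\<^bsub>Hom K X Y\<^esub> = f"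
  using hom_group by (metis abelian_group.axioms(1) abelian_monoid.l_zero abelian_monoid.r_zero)+

lemma cmp_add: "\<lbrakk>g \<in> arr K Y Z; f \<in> arr K X Y; f' \<in> arr K X Y; X \<in> Ob K; Y \<in> Ob K; Z \<in> Ob K\<rbrakk>
    \<Longrightarrow> g \<star> (f \<oplus>\<^bsub>Hom K X Y\<^esub> f') = g \<star> f \<oplus>\<^bsub>Hom K X Z\<^esub> g \<star> f'"
  by (rule restrict_lin_maps_add[OF cmp_linear_right hom_module])

lemma add_cmp: "\<lbrakk>f \<in> arr K X Y; g \<in> arr K Y Z; g' \<in> arr K Y Z; X \<in> Ob K; Y \<in> Ob K; Z \<in> Ob K\<rbrakk>
    \<Longrightarrow> (g \<oplus>\<^bsub>Hom K Y Z\<^esub> g') \<star> f = g \<star> f \<oplus>\<^bsub>Hom K X Z\<^esub> g' \<star> f"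
  by (rule restrict_lin_maps_add[OF cmp_linear_left hom_module])

lemma cmp_smult: "\<lbrakk>g \<in> arr K Y Z; r \<in> carrier R; f \<in> arr K X Y; X \<in> Ob K; Y \<in> Ob K; Z \<in> Ob K\<rbrakk>
    \<Longrightarrow> g \<star> (r \<odot>\<^bsub>Hom K X Y\<^esub> f) = r \<odot>\<^bsub>Hom K X Z\<^esub> (g \<star> f)"
  by (rule restrict_lin_maps_smult[OF cmp_linear_right hom_module])

lemma smult_cmp: "\<lbrakk>f \<in> arr K X Y; r \<in> carrier R; g \<in> arr K Y Z; X \<in> Ob K; Y \<in> Ob K; Z \<in> Ob K\<rbrakk>
    \<Longrightarrow> (r \<odot>\<^bsub>Hom K Y Z\<^esub> g) \<star> f = r \<odot>\<^bsub>Hom K X Z\<^esub> (g \<star> f)"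
  by (rule restrict_lin_maps_smult[OF cmp_linear_left hom_module])

lemma cmp_zero: "\<lbrakk>g \<in> arr K Y Z; X \<in> Ob K; Y \<in> Ob K; Z \<in> Ob K\<rbrakk>
    \<Longrightarrow> g \<star> \<zero>\<^bsub>Hom K X Y\<^esub> = \<zero>\<^bsub>Hom K X Z\<^esub>"
  by (rule restrict_lin_maps_zero[OF cmp_linear_right hom_module hom_module])

lemma zero_cmp: "\<lbrakk>f \<in> arr K X Y; X \<in> Ob K; Y \<in> Ob K; Z \<in> Ob K\<rbrakk>
    \<Longrightarrow> \<zero>\<^bsub>Hom K Y Z\<^esub> \<star> f = \<zero>\<^bsub>Hom K X Z\<^esub>"
  by (rule restrict_lin_maps_zero[OF cmp_linear_left hom_module hom_module])

lemma minus_cmp: "\<lbrakk>f \<in> arr K X Y; g \<in> arr K Y Z; X \<in> Ob K; Y \<in> Ob K; Z \<in> Ob K\<rbrakk>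
    \<Longrightarrow> (\<ominus>\<^bsub>Hom K Y Z\<^esub> g) \<star> f = \<ominus>\<^bsub>Hom K X Z\<^esub> (g \<star> f)"
  by (rule restrict_lin_maps_minus[OF cmp_linear_left hom_module hom_module])

lemma cmp_minus: "\<lbrakk>g \<in> arr K Y Z; f \<in> arr K X Y; X \<in> Ob K; Y \<in> Ob K; Z \<in> Ob K\<rbrakk>
    \<Longrightarrow> g \<star> (\<ominus>\<^bsub>Hom K X Y\<^esub> f) = \<ominus>\<^bsub>Hom K X Z\<^esub> (g \<star> f)"
  by (rule restrict_lin_maps_minus[OF cmp_linear_right hom_module hom_module])

end

context bilinear_functor
begin

lemma val_group: "\<lbrakk>C \<in> Ob K; A \<in> Ob K\<rbrakk> \<Longrightarrow> abelian_group (val F C A)"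
  using val_module module.axioms(2) by blast

lemma val_zero [simp]: "\<lbrakk>C \<in> Ob K; A \<in> Ob K\<rbrakk> \<Longrightarrow> \<zero>\<^bsub>val F C A\<^esub> \<in> carrier (val F C A)"
  using val_group abelian_group.axioms abelian_monoid.zero_closed by metis

lemma val_add [simp]: "\<lbrakk>u \<in> carrier (val F C A); v \<in> carrier (val F C A); C \<in> Ob K; A \<in> Ob K\<rbrakk>
    \<Longrightarrow> u \<oplus>\<^bsub>val F C A\<^esub> v \<in> carrier (val F C A)"
  using val_group abelian_group.axioms abelian_monoid.a_closed by metis

lemma val_minus [simp]: "\<lbrakk>u \<in> carrier (val F C A); C \<in> Ob K; A \<in> Ob K\<rbrakk>
    \<Longrightarrow> \<ominus>\<^bsub>val F C A\<^esub> u \<in> carrier (val F C A)"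
  using val_group abelian_group.a_inv_closed by metis

lemma val_smult [simp]: "\<lbrakk>r \<in> carrier R; u \<in> carrier (val F C A); C \<in> Ob K; A \<in> Ob K\<rbrakk>
    \<Longrightarrow> r \<odot>\<^bsub>val F C A\<^esub> u \<in> carrier (val F C A)"
  using val_module module.smult_closed by metis

lemma act_closed: "\<lbrakk>u \<in> carrier (val F C A); c \<in> arr K C' C; a \<in> arr K A A';
      C \<in> Ob K; A \<in> Ob K; C' \<in> Ob K; A' \<in> Ob K\<rbrakk> \<Longrightarrow> act F c a u \<in> carrier (val F C' A')"
  by (rule restrict_lin_maps_closed[OF act_linear])

lemma act_add: "\<lbrakk>u \<in> carrier (val F C A); v \<in> carrier (val F C A); c \<in> arr K C' C; a \<in> arr K A A';
      C \<in> Ob K; A \<in> Ob K; C' \<in> Ob K; A' \<in> Ob K\<rbrakk>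
    \<Longrightarrow> act F c a (u \<oplus>\<^bsub>val F C A\<^esub> v) = act F c a u \<oplus>\<^bsub>val F C' A'\<^esub> act F c a v"
  by (rule restrict_lin_maps_add[OF act_linear val_module])

lemma act_smult: "\<lbrakk>u \<in> carrier (val F C A); r \<in> carrier R; c \<in> arr K C' C; a \<in> arr K A A';
      C \<in> Ob K; A \<in> Ob K; C' \<in> Ob K; A' \<in> Ob K\<rbrakk>
    \<Longrightarrow> act F c a (r \<odot>\<^bsub>val F C A\<^esub> u) = r \<odot>\<^bsub>val F C' A'\<^esub> act F c a u"
  by (rule restrict_lin_maps_smult[OF act_linear val_module])

lemma act_add_contra: "\<lbrakk>u \<in> carrier (val F C A); c \<in> arr K C' C; c' \<in> arr K C' C; a \<in> arr K A A';
      C \<in> Ob K; A \<in> Ob K; C' \<in> Ob K; A' \<in> Ob K\<rbrakk>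
    \<Longrightarrow> act F (c \<oplus>\<^bsub>Hom K C' C\<^esub> c') a u = act F c a u \<oplus>\<^bsub>val F C' A'\<^esub> act F c' a u"
  by (rule restrict_lin_maps_add[OF act_linear_contra hom_module])

lemma act_smult_contra: "\<lbrakk>u \<in> carrier (val F C A); r \<in> carrier R; c \<in> arr K C' C; a \<in> arr K A A';
      C \<in> Ob K; A \<in> Ob K; C' \<in> Ob K; A' \<in> Ob K\<rbrakk>
    \<Longrightarrow> act F (r \<odot>\<^bsub>Hom K C' C\<^esub> c) a u = r \<odot>\<^bsub>val F C' A'\<^esub> act F c a u"
  by (rule restrict_lin_maps_smult[OF act_linear_contra hom_module])

lemma act_add_cov: "\<lbrakk>u \<in> carrier (val F C A); c \<in> arr K C' C; a \<in> arr K A A'; a' \<in> arr K A A';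
      C \<in> Ob K; A \<in> Ob K; C' \<in> Ob K; A' \<in> Ob K\<rbrakk>
    \<Longrightarrow> act F c (a \<oplus>\<^bsub>Hom K A A'\<^esub> a') u = act F c a u \<oplus>\<^bsub>val F C' A'\<^esub> act F c a' u"
  by (rule restrict_lin_maps_add[OF act_linear_cov hom_module])

lemma act_smult_cov: "\<lbrakk>u \<in> carrier (val F C A); r \<in> carrier R; c \<in> arr K C' C; a \<in> arr K A A';
      C \<in> Ob K; A \<in> Ob K; C' \<in> Ob K; A' \<in> Ob K\<rbrakk>
    \<Longrightarrow> act F c (r \<odot>\<^bsub>Hom K A A'\<^esub> a) u = r \<odot>\<^bsub>val F C' A'\<^esub> act F c a u"
  by (rule restrict_lin_maps_smult[OF act_linear_cov hom_module])

lemma push_closed [simp]: "\<lbrakk>u \<in> carrier (val F C A); a \<in> arr K A A'; C \<in> Ob K; A \<in> Ob K; A' \<in> Ob K\<rbrakk>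
    \<Longrightarrow> push K F C a u \<in> carrier (val F C A')"
  by (simp add: push_def act_closed)

lemma pull_closed [simp]: "\<lbrakk>u \<in> carrier (val F C A); c \<in> arr K C' C; C \<in> Ob K; C' \<in> Ob K; A \<in> Ob K\<rbrakk>
    \<Longrightarrow> pull K F A c u \<in> carrier (val F C' A)"
  by (simp add: pull_def act_closed)

lemma push_ident [simp]: "\<lbrakk>u \<in> carrier (val F C A); C \<in> Ob K; A \<in> Ob K\<rbrakk>
    \<Longrightarrow> push K F C (ident K A) u = u"
  by (simp add: push_def act_ident)

lemma pull_ident [simp]: "\<lbrakk>u \<in> carrier (val F C A); C \<in> Ob K; A \<in> Ob K\<rbrakk>
    \<Longrightarrow> pull K F A (ident K C) u = u"
  by (simp add: pull_def act_ident)

lemma push_cmp: "\<lbrakk>u \<in> carrier (val F C A); a \<in> arr K A A'; a' \<in> arr K A' A'';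
      C \<in> Ob K; A \<in> Ob K; A' \<in> Ob K; A'' \<in> Ob K\<rbrakk>
    \<Longrightarrow> push K F C (a' \<star> a) u = push K F C a' (push K F C a u)"
  using act_cmp[of C A C A' C A'' "ident K C" a "ident K C" a' u] by (simp add: push_def)

lemma pull_cmp: "\<lbrakk>u \<in> carrier (val F C A); c \<in> arr K C' C; c' \<in> arr K C'' C';
      C \<in> Ob K; A \<in> Ob K; C' \<in> Ob K; C'' \<in> Ob K\<rbrakk>
    \<Longrightarrow> pull K F A (c \<star> c') u = pull K F A c' (pull K F A c u)"
  using act_cmp[of C A C' A C'' A c "ident K A" c' "ident K A" u] by (simp add: pull_def)

lemma act_push_pull: "\<lbrakk>u \<in> carrier (val F C A); c \<in> arr K C' C; a \<in> arr K A A';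
      C \<in> Ob K; A \<in> Ob K; C' \<in> Ob K; A' \<in> Ob K\<rbrakk>
    \<Longrightarrow> act F c a u = push K F C' a (pull K F A c u)"
  using act_cmp[of C A C' A C' A' c "ident K A" "ident K C'" a u] by (simp add: push_def pull_def)

lemma act_pull_push: "\<lbrakk>u \<in> carrier (val F C A); c \<in> arr K C' C; a \<in> arr K A A';
      C \<in> Ob K; A \<in> Ob K; C' \<in> Ob K; A' \<in> Ob K\<rbrakk>
    \<Longrightarrow> act F c a u = pull K F A' c (push K F C a u)"
  using act_cmp[of C A C A' C' A' "ident K C" a c "ident K A'" u] by (simp add: push_def pull_def)

lemma pull_push: "\<lbrakk>u \<in> carrier (val F C A); c \<in> arr K C' C; a \<in> arr K A A';
      C \<in> Ob K; A \<in> Ob K; C' \<in> Ob K; A' \<in> Ob K\<rbrakk>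
    \<Longrightarrow> pull K F A' c (push K F C a u) = push K F C' a (pull K F A c u)"
  using act_pull_push act_push_pull by metis

lemma push_linear: "\<lbrakk>a \<in> arr K A A'; C \<in> Ob K; A \<in> Ob K; A' \<in> Ob K\<rbrakk>
    \<Longrightarrow> (\<lambda>u \<in> carrier (val F C A). push K F C a u) \<in> lin_maps R (val F C A) (val F C A')"
  unfolding push_def by (rule act_linear) simp_all

lemma pull_linear: "\<lbrakk>c \<in> arr K C' C; C \<in> Ob K; C' \<in> Ob K; A \<in> Ob K\<rbrakk>
    \<Longrightarrow> (\<lambda>u \<in> carrier (val F C A). pull K F A c u) \<in> lin_maps R (val F C A) (val F C' A)"
  unfolding pull_def by (rule act_linear) simp_all

lemma push_add: "\<lbrakk>a \<in> arr K A A'; u \<in> carrier (val F C A); v \<in> carrier (val F C A); C \<in> Ob K; A \<in> Ob K; A' \<in> Ob K\<rbrakk>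
    \<Longrightarrow> push K F C a (u \<oplus>\<^bsub>val F C A\<^esub> v) = push K F C a u \<oplus>\<^bsub>val F C A'\<^esub> push K F C a v"
  by (rule restrict_lin_maps_add[OF push_linear val_module])

lemma push_smult: "\<lbrakk>a \<in> arr K A A'; r \<in> carrier R; u \<in> carrier (val F C A); C \<in> Ob K; A \<in> Ob K; A' \<in> Ob K\<rbrakk>
    \<Longrightarrow> push K F C a (r \<odot>\<^bsub>val F C A\<^esub> u) = r \<odot>\<^bsub>val F C A'\<^esub> push K F C a u"
  by (rule restrict_lin_maps_smult[OF push_linear val_module])

lemma push_zero: "\<lbrakk>a \<in> arr K A A'; C \<in> Ob K; A \<in> Ob K; A' \<in> Ob K\<rbrakk>
    \<Longrightarrow> push K F C a \<zero>\<^bsub>val F C A\<^esub> = \<zero>\<^bsub>val F C A'\<^esub>"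
  by (rule restrict_lin_maps_zero[OF push_linear val_module val_module])

lemma pull_add: "\<lbrakk>c \<in> arr K C' C; u \<in> carrier (val F C A); v \<in> carrier (val F C A); C \<in> Ob K; C' \<in> Ob K; A \<in> Ob K\<rbrakk>
    \<Longrightarrow> pull K F A c (u \<oplus>\<^bsub>val F C A\<^esub> v) = pull K F A c u \<oplus>\<^bsub>val F C' A\<^esub> pull K F A c v"
  by (rule restrict_lin_maps_add[OF pull_linear val_module])

lemma pull_smult: "\<lbrakk>c \<in> arr K C' C; r \<in> carrier R; u \<in> carrier (val F C A); C \<in> Ob K; C' \<in> Ob K; A \<in> Ob K\<rbrakk>
    \<Longrightarrow> pull K F A c (r \<odot>\<^bsub>val F C A\<^esub> u) = r \<odot>\<^bsub>val F C' A\<^esub> pull K F A c u"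
  by (rule restrict_lin_maps_smult[OF pull_linear val_module])

lemma pull_zero: "\<lbrakk>c \<in> arr K C' C; C \<in> Ob K; C' \<in> Ob K; A \<in> Ob K\<rbrakk>
    \<Longrightarrow> pull K F A c \<zero>\<^bsub>val F C A\<^esub> = \<zero>\<^bsub>val F C' A\<^esub>"
  by (rule restrict_lin_maps_zero[OF pull_linear val_module val_module])

lemma push_linear_mor: "\<lbrakk>u \<in> carrier (val F C A); C \<in> Ob K; A \<in> Ob K; A' \<in> Ob K\<rbrakk>
    \<Longrightarrow> (\<lambda>a \<in> arr K A A'. push K F C a u) \<in> lin_maps R (Hom K A A') (val F C A')"
  unfolding push_def by (rule act_linear_cov) simp_all

lemma pull_linear_mor: "\<lbrakk>u \<in> carrier (val F C A); C \<in> Ob K; C' \<in> Ob K; A \<in> Ob K\<rbrakk>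
    \<Longrightarrow> (\<lambda>c \<in> arr K C' C. pull K F A c u) \<in> lin_maps R (Hom K C' C) (val F C' A)"
  unfolding pull_def by (rule act_linear_contra) simp_all

lemma push_add_mor: "\<lbrakk>u \<in> carrier (val F C A); a \<in> arr K A A'; a' \<in> arr K A A'; C \<in> Ob K; A \<in> Ob K; A' \<in> Ob K\<rbrakk>
    \<Longrightarrow> push K F C (a \<oplus>\<^bsub>Hom K A A'\<^esub> a') u = push K F C a u \<oplus>\<^bsub>val F C A'\<^esub> push K F C a' u"
  by (rule restrict_lin_maps_add[OF push_linear_mor hom_module])

lemma push_smult_mor: "\<lbrakk>u \<in> carrier (val F C A); r \<in> carrier R; a \<in> arr K A A'; C \<in> Ob K; A \<in> Ob K; A' \<in> Ob K\<rbrakk>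
    \<Longrightarrow> push K F C (r \<odot>\<^bsub>Hom K A A'\<^esub> a) u = r \<odot>\<^bsub>val F C A'\<^esub> push K F C a u"
  by (rule restrict_lin_maps_smult[OF push_linear_mor hom_module])

lemma push_zero_mor: "\<lbrakk>u \<in> carrier (val F C A); C \<in> Ob K; A \<in> Ob K; A' \<in> Ob K\<rbrakk>
    \<Longrightarrow> push K F C \<zero>\<^bsub>Hom K A A'\<^esub> u = \<zero>\<^bsub>val F C A'\<^esub>"
  by (rule restrict_lin_maps_zero[OF push_linear_mor hom_module val_module])

lemma push_minus_mor: "\<lbrakk>u \<in> carrier (val F C A); a \<in> arr K A A'; C \<in> Ob K; A \<in> Ob K; A' \<in> Ob K\<rbrakk>
    \<Longrightarrow> push K F C (\<ominus>\<^bsub>Hom K A A'\<^esub> a) u = \<ominus>\<^bsub>val F C A'\<^esub> push K F C a u"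
  by (rule restrict_lin_maps_minus[OF push_linear_mor hom_module val_module])

lemma pull_add_mor: "\<lbrakk>u \<in> carrier (val F C A); c \<in> arr K C' C; c' \<in> arr K C' C; C \<in> Ob K; C' \<in> Ob K; A \<in> Ob K\<rbrakk>
    \<Longrightarrow> pull K F A (c \<oplus>\<^bsub>Hom K C' C\<^esub> c') u = pull K F A c u \<oplus>\<^bsub>val F C' A\<^esub> pull K F A c' u"
  by (rule restrict_lin_maps_add[OF pull_linear_mor hom_module])

lemma pull_smult_mor: "\<lbrakk>u \<in> carrier (val F C A); r \<in> carrier R; c \<in> arr K C' C; C \<in> Ob K; C' \<in> Ob K; A \<in> Ob K\<rbrakk>
    \<Longrightarrow> pull K F A (r \<odot>\<^bsub>Hom K C' C\<^esub> c) u = r \<odot>\<^bsub>val F C' A\<^esub> pull K F A c u"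
  by (rule restrict_lin_maps_smult[OF pull_linear_mor hom_module])

lemma pull_zero_mor: "\<lbrakk>u \<in> carrier (val F C A); C \<in> Ob K; C' \<in> Ob K; A \<in> Ob K\<rbrakk>
    \<Longrightarrow> pull K F A \<zero>\<^bsub>Hom K C' C\<^esub> u = \<zero>\<^bsub>val F C' A\<^esub>"
  by (rule restrict_lin_maps_zero[OF pull_linear_mor hom_module val_module])

end

lemma (in linear_category) bilinear_functorI:
  assumes mod: "\<And>C A. \<lbrakk>C \<in> Ob K; A \<in> Ob K\<rbrakk> \<Longrightarrow> module R (val F C A)"
    and lin: "\<And>C A C' A' c a. \<lbrakk>C \<in> Ob K; A \<in> Ob K; C' \<in> Ob K; A' \<in> Ob K; c \<in> arr K C' C; a \<in> arr K A A'\<rbrakk>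
      \<Longrightarrow> (\<lambda>u \<in> carrier (val F C A). act F c a u) \<in> lin_maps R (val F C A) (val F C' A')"
    and "\<And>C A u. \<lbrakk>C \<in> Ob K; A \<in> Ob K; u \<in> carrier (val F C A)\<rbrakk>
      \<Longrightarrow> act F (ident K C) (ident K A) u = u"
    and "\<And>C A C' A' C'' A'' c a c' a' u. \<lbrakk>C \<in> Ob K; A \<in> Ob K; C' \<in> Ob K; A' \<in> Ob K; C'' \<in> Ob K; A'' \<in> Ob K;
        c \<in> arr K C' C; a \<in> arr K A A'; c' \<in> arr K C'' C'; a' \<in> arr K A' A'';
        u \<in> carrier (val F C A)\<rbrakk>
      \<Longrightarrow> act F (c \<star> c') (a' \<star> a) u = act F c' a' (act F c a u)"
    and "\<And>C A C' A' c c' a u. \<lbrakk>C \<in> Ob K; A \<in> Ob K; C' \<in> Ob K; A' \<in> Ob K; c \<in> arr K C' C; c' \<in> arr K C' C;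
        a \<in> arr K A A'; u \<in> carrier (val F C A)\<rbrakk>
      \<Longrightarrow> act F (c \<oplus>\<^bsub>Hom K C' C\<^esub> c') a u = act F c a u \<oplus>\<^bsub>val F C' A'\<^esub> act F c' a u"
    and "\<And>C A C' A' r c a u. \<lbrakk>C \<in> Ob K; A \<in> Ob K; C' \<in> Ob K; A' \<in> Ob K; r \<in> carrier R; c \<in> arr K C' C;
        a \<in> arr K A A'; u \<in> carrier (val F C A)\<rbrakk>
      \<Longrightarrow> act F (r \<odot>\<^bsub>Hom K C' C\<^esub> c) a u = r \<odot>\<^bsub>val F C' A'\<^esub> act F c a u"
    and "\<And>C A C' A' c a a' u. \<lbrakk>C \<in> Ob K; A \<in> Ob K; C' \<in> Ob K; A' \<in> Ob K; c \<in> arr K C' C;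
        a \<in> arr K A A'; a' \<in> arr K A A'; u \<in> carrier (val F C A)\<rbrakk>
      \<Longrightarrow> act F c (a \<oplus>\<^bsub>Hom K A A'\<^esub> a') u = act F c a u \<oplus>\<^bsub>val F C' A'\<^esub> act F c a' u"
    and "\<And>C A C' A' r c a u. \<lbrakk>C \<in> Ob K; A \<in> Ob K; C' \<in> Ob K; A' \<in> Ob K; r \<in> carrier R; c \<in> arr K C' C;
        a \<in> arr K A A'; u \<in> carrier (val F C A)\<rbrakk>
      \<Longrightarrow> act F c (r \<odot>\<^bsub>Hom K A A'\<^esub> a) u = r \<odot>\<^bsub>val F C' A'\<^esub> act F c a u"
  shows "bilinear_functor R K F"
proof -
  have closed: "act F c a u \<in> carrier (val F C' A')"
    if "C \<in> Ob K" "A \<in> Ob K" "C' \<in> Ob K" "A' \<in> Ob K" "c \<in> arr K C' C" "a \<in> arr K A A'"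
      "u \<in> carrier (val F C A)" for C A C' A' c a u
    by (rule restrict_lin_maps_closed[OF lin]) (fact that)+
  show ?thesis
  proof (intro bilinear_functor.intro bilinear_functor_axioms.intro linear_category_axioms)
    fix C A C' A' a u
    assume *: "C \<in> Ob K" "A \<in> Ob K" "C' \<in> Ob K" "A' \<in> Ob K" "a \<in> arr K A A'" "u \<in> carrier (val F C A)"
    show "(\<lambda>c \<in> arr K C' C. act F c a u) \<in> lin_maps R (Hom K C' C) (val F C' A')"
      using * by (intro restrict_in_lin_maps hom_module closed assms)
  next
    fix C A C' A' c u
    assume *: "C \<in> Ob K" "A \<in> Ob K" "C' \<in> Ob K" "A' \<in> Ob K" "c \<in> arr K C' C" "u \<in> carrier (val F C A)"
    show "(\<lambda>a \<in> arr K A A'. act F c a u) \<in> lin_maps R (Hom K A A') (val F C' A')"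
      using * by (intro restrict_in_lin_maps hom_module closed assms)
  qed (fact assms)+
qed

lemma (in linear_category) hom_bifun_bilinear: "bilinear_functor R K (hom_bifun K)"
proof (rule bilinear_functorI)
  fix C A C' A' c a
  assume *: "C \<in> Ob K" "A \<in> Ob K" "C' \<in> Ob K" "A' \<in> Ob K" "c \<in> arr K C' C" "a \<in> arr K A A'"
  show "(\<lambda>u \<in> carrier (val (hom_bifun K) C A). act (hom_bifun K) c a u)
      \<in> lin_maps R (val (hom_bifun K) C A) (val (hom_bifun K) C' A')"
    unfolding hom_bifun_def bifun.simps using * 
    by (intro restrict_in_lin_maps hom_module)
      (auto simp: cmp_add[of a A A'] add_cmp[of c C' C] cmp_smult[of a A A'] smult_cmp[of c C' C] intro!: cmp_arr)
next
  fix C A C' A' C'' A'' c a c' a' u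
  assume *: "C \<in> Ob K" "A \<in> Ob K" "C' \<in> Ob K" "A' \<in> Ob K" "C'' \<in> Ob K" "A'' \<in> Ob K"
        "c \<in> arr K C' C" "a \<in> arr K A A'" "c' \<in> arr K C'' C'" "a' \<in> arr K A' A''"
        "u \<in> carrier (val (hom_bifun K) C A)"
  then have u: "u \<in> arr K C A" by (simp add: hom_bifun_def)
  have "(a' \<star> a \<star> u) \<star> (c \<star> c') = a' \<star> (a \<star> u \<star> c) \<star> c'"
    using *(1-10) u by (smt (verit) assoc cmp_in)
  then show "act (hom_bifun K) (c \<star> c') (a' \<star> a) u
      = act (hom_bifun K) c' a' (act (hom_bifun K) c a u)"
    by (simp add: hom_bifun_def)
qed (auto simp: hom_bifun_def hom_module cmp_add add_cmp cmp_smult smult_cmp intro!: cmp_arr)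

lemma val_hom_bifun [simp]: "val (hom_bifun K) = Hom K"
  by (simp add: hom_bifun_def)

lemma (in linear_category) push_hom [simp]:
  "\<lbrakk>f \<in> arr K C A; a \<in> arr K A A'; C \<in> Ob K; A \<in> Ob K; A' \<in> Ob K\<rbrakk>
    \<Longrightarrow> push K (hom_bifun K) C a f = a \<star> f"
  using cmp_ident_right[of "a \<star> f" C A'] by (auto simp add: push_def hom_bifun_def)

lemma (in linear_category) pull_hom [simp]:
  "\<lbrakk>f \<in> arr K C A; c \<in> arr K C' C; C \<in> Ob K; C' \<in> Ob K; A \<in> Ob K\<rbrakk>
    \<Longrightarrow> pull K (hom_bifun K) A c f = f \<star> c"
  by (simp add: pull_def hom_bifun_def)

section \<open>Extriangulated categories\<close>

context extriangulated_category
begin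

abbreviation Ext :: "'o \<Rightarrow> 'o \<Rightarrow> 'e set" where "Ext C A \<equiv> carrier (val E C A)"

lemma real_seq:
  assumes "(x, B, y) \<in> s C A \<delta>" "C \<in> Ob K" "A \<in> Ob K" "\<delta> \<in> Ext C A"
  shows "B \<in> Ob K" "x \<in> arr K A B" "y \<in> arr K B C"
proof -
  have "s C A \<delta> \<subseteq> seqs K A C"
    using real_class[OF assms(2-4)] by (auto simp: quotient_def seq_equiv_def)
  then show "B \<in> Ob K" "x \<in> arr K A B" "y \<in> arr K B C"
    using assms(1) by (auto simp: seqs_def)
qed

lemma real_exists:
  assumes "C \<in> Ob K" "A \<in> Ob K" "\<delta> \<in> Ext C A"
  obtains x B y where "(x, B, y) \<in> s C A \<delta>"
proof -
  obtain x B y where t: "(x, B, y) \<in> seqs K A C" and s: "s C A \<delta> = seq_equiv K A C `` {(x, B, y)}"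
    using real_class[OF assms] by (auto simp: quotient_def)
  have "is_iso K B B (ident K B)"
    using t by (auto simp: is_iso_def seqs_def)
  then have "((x, B, y), (x, B, y)) \<in> seq_equiv K A C"
    using t assms by (auto simp: seq_equiv_def seqs_def)
  then show thesis using s that by blast
qed

lemma real_unique:
  assumes "(x, B, y) \<in> s C A \<delta>" "(x', B', y') \<in> s C A \<delta>" "C \<in> Ob K" "A \<in> Ob K" "\<delta> \<in> Ext C A"
  obtains u v where "u \<in> arr K B B'" "v \<in> arr K B' B" "v \<star> u = ident K B"
    "u \<star> v = ident K B'" "u \<star> x = x'" "y' \<star> u = y" "v \<star> x' = x" "y \<star> v = y'"
proof -
  note ob = assms(3,4) real_seq[OF assms(1,3-5)] real_seq[OF assms(2,3-5)]
  obtain z D w where s: "s C A \<delta> = seq_equiv K A C `` {(z, D, w)}" and t: "(z, D, w) \<in> seqs K A C"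
    using real_class[OF assms(3-5)] by (auto simp: quotient_def)
  then have D: "D \<in> Ob K" "z \<in> arr K A D" "w \<in> arr K D C"
    by (auto simp: seqs_def)
  obtain b b' where b: "b \<in> arr K D B" "b' \<in> arr K B D" "b' \<star> b = ident K D" "b \<star> b' = ident K B"
      "b \<star> z = x" "y \<star> b = w"
    using assms(1) s by (auto simp: seq_equiv_def is_iso_def)
  obtain c c' where c: "c \<in> arr K D B'" "c' \<in> arr K B' D" "c' \<star> c = ident K D" "c \<star> c' = ident K B'"
      "c \<star> z = x'" "y' \<star> c = w"
    using assms(2) s by (auto simp: seq_equiv_def is_iso_def)
  have z: "z = b' \<star> x" "z = c' \<star> x'" "y = w \<star> b'" "y' = w \<star> c'"
    using b c ob D by (metis assoc cmp_ident_left cmp_ident_right)+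
  show thesis
  proof (rule that[of "c \<star> b'" "b \<star> c'"])
    have "c' \<star> (c \<star> b') = b'" "b' \<star> (b \<star> c') = c'"
      using b c ob D assoc[of b' B D c B' c' D] assoc[of c' B' D b B b' D] by simp_all
    then show "b \<star> c' \<star> (c \<star> b') = ident K B"
      and "c \<star> b' \<star> (b \<star> c') = ident K B'"
      using b c ob D assoc[of "c \<star> b'" B B' c' D b B] assoc[of "b \<star> c'" B' B b' D c B']
      by (simp_all add: cmp_arr[of _ B D] cmp_arr[of _ B' D])
    show "c \<star> b' \<star> x = x'"
      using b c ob D z by (metis assoc)
    show "b \<star> c' \<star> x' = x"
      using b c ob D z by (metis assoc)
    show "y' \<star> (c \<star> b') = y"
      using b c ob D z by (metis assoc)
    show "y \<star> (b \<star> c') = y'"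
      using b c ob D z by (metis assoc)
  qed (use b c ob D in \<open>auto intro: cmp_in\<close>)
qed

definition zero_ob :: 'o where "zero_ob = (SOME Z. zero_object K Z)"

lemma zero_ob: "zero_object K zero_ob"
  unfolding zero_ob_def using has_zero_object by (rule someI_ex)

lemma zero_ob_Ob [simp]: "zero_ob \<in> Ob K"
  using zero_ob by (simp add: zero_object_def)

lemma ident_zero_ob: "ident K zero_ob = \<zero>\<^bsub>Hom K zero_ob zero_ob\<^esub>"
  using zero_ob ident_arr zero_arr zero_ob_Ob unfolding zero_object_def by metis

text \<open>
  The biproducts \<open>A \<oplus> 0\<close> and \<open>0 \<oplus> A\<close>, with \<open>A\<close> itself as their object. The realization of zero extensions
  on them gives the conflations \<open>A \<rightarrow> A \<rightarrow> 0\<close> and \<open>0 \<rightarrow> A \<rightarrow> A\<close>. Comparing these with a given conflation,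
  by lifting morphisms of extensions or by (ET3) and its dual, yields the exactness properties of
  a single conflation \<open>A \<rightarrow> B \<rightarrow> C\<close> that follow.
\<close>

definition biprod_zero_right :: "'o \<Rightarrow> ('o, 'm) biprod"
  where "biprod_zero_right A = \<lparr>bip = A, in1 = ident K A, in2 = \<zero>\<^bsub>Hom K zero_ob A\<^esub>,
     pr1 = ident K A, pr2 = \<zero>\<^bsub>Hom K A zero_ob\<^esub>\<rparr>"

definition biprod_zero_left :: "'o \<Rightarrow> ('o, 'm) biprod"
  where "biprod_zero_left A = \<lparr>bip = A, in1 = \<zero>\<^bsub>Hom K zero_ob A\<^esub>, in2 = ident K A,
     pr1 = \<zero>\<^bsub>Hom K A zero_ob\<^esub>, pr2 = ident K A\<rparr>"

lemma biprod_zero_right: "A \<in> Ob K \<Longrightarrow> is_biproduct K A zero_ob (biprod_zero_right A)"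
  unfolding is_biproduct_def biprod_zero_right_def biprod.simps
  by (intro conjI)
    (auto simp: ident_zero_ob hom_r_zero cmp_zero[of _ A] zero_cmp[of _ A] cmp_zero[of _ zero_ob])

lemma biprod_zero_left: "A \<in> Ob K \<Longrightarrow> is_biproduct K zero_ob A (biprod_zero_left A)"
  unfolding is_biproduct_def biprod_zero_left_def biprod.simps
  by (intro conjI)
    (auto simp: ident_zero_ob hom_l_zero cmp_zero[of _ A] zero_cmp[of _ A] cmp_zero[of _ zero_ob])

lemma real_ident_zero: "A \<in> Ob K \<Longrightarrow> (ident K A, A, \<zero>\<^bsub>Hom K A zero_ob\<^esub>) \<in> s zero_ob A \<zero>\<^bsub>val E zero_ob A\<^esub>"
  using real_zero[OF _ _ biprod_zero_right] by (simp add: biprod_zero_right_def)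

lemma real_zero_ident: "A \<in> Ob K \<Longrightarrow> (\<zero>\<^bsub>Hom K zero_ob A\<^esub>, A, ident K A) \<in> s A zero_ob \<zero>\<^bsub>val E A zero_ob\<^esub>"
  using real_zero[OF _ _ biprod_zero_left] by (simp add: biprod_zero_left_def)

lemma ET3_rule:
  assumes "(x, B, y) \<in> s C A \<delta>" "(x', B', y') \<in> s C' A' \<delta>'"
    and "a \<in> arr K A A'" "b \<in> arr K B B'" "b \<star> x = x' \<star> a"
    and "\<delta> \<in> Ext C A" "\<delta>' \<in> Ext C' A'" "C \<in> Ob K" "A \<in> Ob K" "C' \<in> Ob K" "A' \<in> Ob K"
  obtains c where "c \<in> arr K C C'" "c \<star> y = y' \<star> b" "push K E C a \<delta> = pull K E A' c \<delta>'"
  using ET3[unfolded ET3_def, rule_format, OF assms(9,8,11,10,6,7), of x B y x' B' y' a b] assms(1-5) by blast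

lemma ET3_op_rule:
  assumes "(x, B, y) \<in> s C A \<delta>" "(x', B', y') \<in> s C' A' \<delta>'"
    and "b \<in> arr K B B'" "c \<in> arr K C C'" "c \<star> y = y' \<star> b"
    and "\<delta> \<in> Ext C A" "\<delta>' \<in> Ext C' A'" "C \<in> Ob K" "A \<in> Ob K" "C' \<in> Ob K" "A' \<in> Ob K"
  obtains a where "a \<in> arr K A A'" "x' \<star> a = b \<star> x" "push K E C a \<delta> = pull K E A' c \<delta>'"
proof -
  have "(y', B', x') \<in> opp_real s A' C' \<delta>'" "(y, B, x) \<in> opp_real s A C \<delta>"
    using assms by (auto simp: opp_real_def)
  moreover have "A' \<in> Ob (opp K)" "C' \<in> Ob (opp K)" "A \<in> Ob (opp K)" "C \<in> Ob (opp K)"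
    "\<delta> \<in> carrier (val (opp_bifun E) A C)" "\<delta>' \<in> carrier (val (opp_bifun E) A' C')"
    "c \<in> arr (opp K) C' C" "b \<in> arr (opp K) B' B" "b \<cdot>\<^bsub>opp K\<^esub> y' = y \<cdot>\<^bsub>opp K\<^esub> c"
    using assms by (simp_all add: opp_def opp_bifun_def)
  ultimately obtain a where "a \<in> arr (opp K) A' A" "a \<cdot>\<^bsub>opp K\<^esub> x' = x \<cdot>\<^bsub>opp K\<^esub> b"
      "push (opp K) (opp_bifun E) A' c \<delta>' = pull (opp K) (opp_bifun E) C a \<delta>"
    using ET3_op[unfolded ET3_def, rule_format, of C' A' C A \<delta>' \<delta> y' B' x' y B x c b] by blast
  then show thesis
    using that by (simp add: opp_def opp_bifun_def push_def pull_def)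
qed

context
  fixes x B y C A \<delta>
  assumes tri: "(x, B, y) \<in> s C A \<delta>" and C [simp]: "C \<in> Ob K" and A [simp]: "A \<in> Ob K"
    and \<delta> [simp]: "\<delta> \<in> Ext C A"
begin

lemmas tri_arr = real_seq[OF tri C A \<delta>]

lemma conflation_cmp_zero: "y \<star> x = \<zero>\<^bsub>Hom K A C\<^esub>"
proof -
  note [simp] = tri_arr
  have "ext_morphism K E zero_ob A \<zero>\<^bsub>val E zero_ob A\<^esub> C A \<delta> (ident K A) \<zero>\<^bsub>Hom K zero_ob C\<^esub>"
    by (simp add: ext_morphism_def pull_zero_mor)
  from real_lift[OF _ _ _ _ _ _ this real_ident_zero tri]
  obtain b where b: "b \<in> arr K A B" "b \<star> ident K A = x \<star> ident K A"
      "y \<star> b = \<zero>\<^bsub>Hom K zero_ob C\<^esub> \<star> \<zero>\<^bsub>Hom K A zero_ob\<^esub>"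
    by auto
  then have "b = x" by (simp add: cmp_ident_right[of _ A B])
  with b show ?thesis by (simp add: zero_cmp[of _ A])
qed

lemma push_inflation_zero: "push K E C x \<delta> = \<zero>\<^bsub>val E C B\<^esub>"
proof -
  note [simp] = tri_arr
  obtain c where "c \<in> arr K C zero_ob" "push K E C x \<delta> = pull K E B c \<zero>\<^bsub>val E zero_ob B\<^esub>"
    by (rule ET3_rule[OF tri real_ident_zero, of B x "ident K B"]) auto
  then show ?thesis by (simp add: pull_zero)
qed

lemma pull_deflation_zero: "pull K E A y \<delta> = \<zero>\<^bsub>val E B A\<^esub>"
proof -
  note [simp] = tri_arr
  obtain a where "a \<in> arr K zero_ob A" "push K E B a \<zero>\<^bsub>val E B zero_ob\<^esub> = pull K E A y \<delta>"
    by (rule ET3_op_rule[OF real_zero_ident tri, of B "ident K B" y]) auto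
  then show ?thesis by (simp add: push_zero)
qed

lemma factor_through_inflation:
  assumes "u \<in> arr K X B" "y \<star> u = \<zero>\<^bsub>Hom K X C\<^esub>" "X \<in> Ob K"
  obtains t where "t \<in> arr K X A" "x \<star> t = u"
proof -
  note [simp] = tri_arr
  obtain a where "a \<in> arr K X A" "x \<star> a = u \<star> ident K X"
    by (rule ET3_op_rule[OF real_ident_zero tri, of X u "\<zero>\<^bsub>Hom K zero_ob C\<^esub>"])
      (use assms in \<open>auto simp: zero_cmp[of _ X]\<close>)
  then show thesis using assms that by auto
qed

lemma extend_along_inflation:
  assumes "f \<in> arr K A Y" "push K E C f \<delta> = \<zero>\<^bsub>val E C Y\<^esub>" "Y \<in> Ob K"
  obtains t where "t \<in> arr K B Y" "t \<star> x = f"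
proof -
  note [simp] = tri_arr
  have "ext_morphism K E C A \<delta> zero_ob Y \<zero>\<^bsub>val E zero_ob Y\<^esub> f \<zero>\<^bsub>Hom K C zero_ob\<^esub>"
    using assms by (simp add: ext_morphism_def pull_zero[of _ C])
  from real_lift[OF _ _ _ _ _ _ this tri real_ident_zero]
  obtain b where "b \<in> arr K B Y" "b \<star> x = ident K Y \<star> f"
    using assms by auto
  then show thesis using assms that by auto
qed

lemma lift_along_deflation:
  assumes "g \<in> arr K X C" "pull K E A g \<delta> = \<zero>\<^bsub>val E X A\<^esub>" "X \<in> Ob K"
  obtains b where "b \<in> arr K X B" "y \<star> b = g"
proof -
  note [simp] = tri_arr
  have "ext_morphism K E X zero_ob \<zero>\<^bsub>val E X zero_ob\<^esub> C A \<delta> \<zero>\<^bsub>Hom K zero_ob A\<^esub> g"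
    using assms by (simp add: ext_morphism_def push_zero)
  from real_lift[OF _ _ _ _ _ _ this real_zero_ident tri]
  obtain b where "b \<in> arr K X B" "y \<star> b = g \<star> ident K X"
    using assms by auto
  then show thesis using assms that by auto
qed

end

text \<open>
  As \<open>y\<^sup>* \<delta>' = 0\<close>, the deflation \<open>y\<close> lifts along the deflation of \<open>\<delta>'\<close>. The morphism that the lift induces
  between the fibres exhibits \<open>\<delta>'\<close> as a pushout of \<open>\<delta>\<close>.
\<close>

lemma ext_is_pushout:
  assumes tri: "(x, B, y) \<in> s C A \<delta>" and C: "C \<in> Ob K" "A \<in> Ob K" "\<delta> \<in> Ext C A"
    and \<delta>': "\<delta>' \<in> Ext C Y" "Y \<in> Ob K" "pull K E Y y \<delta>' = \<zero>\<^bsub>val E B Y\<^esub>"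
  obtains a where "a \<in> arr K A Y" "push K E C a \<delta> = \<delta>'"
proof -
  note t = real_seq[OF tri C]
  obtain x' B' y' where tri': "(x', B', y') \<in> s C Y \<delta>'"
    using real_exists C \<delta>' by metis
  obtain b where b: "b \<in> arr K B B'" "y' \<star> b = y"
    using lift_along_deflation[OF tri' C(1) \<delta>'(2,1) _ \<delta>'(3)] t by blast
  obtain a where "a \<in> arr K A Y" "push K E C a \<delta> = pull K E Y (ident K C) \<delta>'"
    by (rule ET3_op_rule[OF tri tri' b(1), of "ident K C"]) (use b C \<delta>' t in auto)
  then show thesis using that C \<delta>' by auto
qed

text \<open>This is part of the dual of (ET4): the deflation of \<open>\<delta>''\<close> there is the composite of the given ones.\<close>

lemma deflation_cmp:
  assumes "deflation K E s Q P q" "deflation K E s P C g" "P \<in> Ob K" "C \<in> Ob K"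
  shows "deflation K E s Q C (g \<star> q)"
proof -
  obtain N \<kappa> k where N: "N \<in> Ob K" "\<kappa> \<in> Ext C N" "(k, P, g) \<in> s C N \<kappa>"
    using assms by (auto simp: deflation_def)
  obtain N' \<kappa>' k' where N': "N' \<in> Ob K" "\<kappa>' \<in> Ext P N'" "(k', Q, q) \<in> s P N' \<kappa>'"
    using assms by (auto simp: deflation_def)
  have "Q \<in> Ob K" using real_seq[OF N'(3) assms(3) N'(1,2)] by simp
  then have *: "C \<in> Ob (opp K)" "P \<in> Ob (opp K)" "Q \<in> Ob (opp K)" "N \<in> Ob (opp K)" "N' \<in> Ob (opp K)"
      "\<kappa> \<in> carrier (val (opp_bifun E) N C)" "\<kappa>' \<in> carrier (val (opp_bifun E) N' P)"
      "(g, P, k) \<in> opp_real s N C \<kappa>" "(q, Q, k') \<in> opp_real s N' P \<kappa>'"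
    using N N' assms by (simp_all add: opp_def opp_bifun_def opp_real_def)
  obtain L \<delta>'' h' where "L \<in> Ob (opp K)" "\<delta>'' \<in> carrier (val (opp_bifun E) L C)"
      "(q \<cdot>\<^bsub>opp K\<^esub> g, Q, h') \<in> opp_real s L C \<delta>''"
    using ET4_op[unfolded ET4_def, rule_format, OF *(1-7) conjI[OF *(8,9)]] by blast
  then show ?thesis
    by (auto simp: deflation_def opp_def opp_bifun_def opp_real_def)
qed

end

subsection \<open>Homotopy pushouts\<close>

lemma (in linear_category) is_biproductD:
  assumes "is_biproduct K X Y S"
  shows "bip S \<in> Ob K" "in1 S \<in> arr K X (bip S)" "in2 S \<in> arr K Y (bip S)"
    "pr1 S \<in> arr K (bip S) X" "pr2 S \<in> arr K (bip S) Y"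
    "pr1 S \<star> in1 S = ident K X" "pr2 S \<star> in2 S = ident K Y"
    "pr1 S \<star> in2 S = \<zero>\<^bsub>Hom K Y X\<^esub>" "pr2 S \<star> in1 S = \<zero>\<^bsub>Hom K X Y\<^esub>"
    "in1 S \<star> pr1 S \<oplus>\<^bsub>Hom K (bip S) (bip S)\<^esub> in2 S \<star> pr2 S = ident K (bip S)"
  using assms by (simp_all add: is_biproduct_def)

context extriangulated_category
begin

text \<open>
  The direct sum of a conflation of \<open>\<kappa>\<close> and of \<open>A \<rightarrow> A \<rightarrow> 0\<close>. As \<open>C \<oplus> 0\<close> is taken to be \<open>C\<close> itself, the
  sum of the extensions \<open>\<kappa>\<close> and \<open>0\<close> is the pushout of \<open>\<kappa>\<close> along \<open>N \<rightarrow> N \<oplus> A\<close>.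
\<close>

lemma real_dsum_ident:
  assumes tri: "(k, P, g) \<in> s C N \<kappa>" "C \<in> Ob K" "N \<in> Ob K" "\<kappa> \<in> Ext C N" "A \<in> Ob K"
    and S: "is_biproduct K N A S" and T: "is_biproduct K P A T"
  shows "(mor_dsum K S T k (ident K A), bip T, g \<star> pr1 T) \<in> s C (bip S) (push K E C (in1 S) \<kappa>)"
proof -
  note t = real_seq[OF tri(1-4)]
  note S' = is_biproductD[OF S] and T' = is_biproductD[OF T]
  let ?Z = "biprod_zero_right C" and ?\<theta> = "push K E C (in1 S) \<kappa>"
  have \<theta>: "?\<theta> \<in> Ext C (bip S)"
    using S' tri by simp
  have 0: "pull K E (bip S) \<zero>\<^bsub>Hom K zero_ob C\<^esub> ?\<theta> = \<zero>\<^bsub>val E zero_ob (bip S)\<^esub>"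
    using \<theta> S' tri by (simp add: pull_zero_mor)
  have Z1: "act E (in1 ?Z) p u = push K E C p u" for p u
    by (simp add: biprod_zero_right_def push_def)
  have Z2: "act E (in2 ?Z) p ?\<theta> = \<zero>\<^bsub>val E zero_ob Y\<^esub>" if "p \<in> arr K (bip S) Y" "Y \<in> Ob K" for p Y
    using act_push_pull[OF \<theta>, of "\<zero>\<^bsub>Hom K zero_ob C\<^esub>" zero_ob p Y] S' tri that 0
    by (simp add: biprod_zero_right_def push_zero)
  have "is_ext_dsum E C N zero_ob A ?Z S \<kappa> \<zero>\<^bsub>val E zero_ob A\<^esub> ?\<theta>"
    unfolding is_ext_dsum_def
  proof (intro conjI)
    show "act E (in1 ?Z) (pr1 S) ?\<theta> = \<kappa>"
      using S' tri assms(5) \<theta>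
      by (simp add: Z1 push_cmp[symmetric, of _ C N])
    show "act E (in1 ?Z) (pr2 S) ?\<theta> = \<zero>\<^bsub>val E C A\<^esub>"
      using S' tri assms(5) \<theta>
      by (simp add: Z1 push_cmp[symmetric, of _ C N] push_zero_mor)
    show "act E (in2 ?Z) (pr2 S) ?\<theta> = \<zero>\<^bsub>val E zero_ob A\<^esub>"
      using S' tri assms(5) by (intro Z2)
    show "act E (in2 ?Z) (pr1 S) ?\<theta> = \<zero>\<^bsub>val E zero_ob N\<^esub>"
      using S' tri assms(5) by (intro Z2)
  qed (use \<theta> in \<open>simp add: biprod_zero_right_def\<close>)
  from real_dsum[OF tri(2,3) _ assms(5) tri(4) _ tri(1) real_ident_zero S T biprod_zero_right this]
  have "(mor_dsum K S T k (ident K A), bip T, mor_dsum K T ?Z g \<zero>\<^bsub>Hom K A zero_ob\<^esub>) \<in> s C (bip S) ?\<theta>"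
    using assms by (simp add: biprod_zero_right_def)
  moreover have "mor_dsum K T ?Z g \<zero>\<^bsub>Hom K A zero_ob\<^esub> = g \<star> pr1 T"
    using t T' assms(2,5)
    by (simp add: mor_dsum_def biprod_zero_right_def zero_cmp[of _ "bip T" A] cmp_zero[of _ zero_ob C]
        cmp_ident_left[of _ "bip T" C] hom_r_zero cmp_arr[of _ "bip T" P])
  ultimately show ?thesis by simp
qed

text \<open>
  The graph of \<open>-a\<close> is an inflation \<open>N \<rightarrow> N \<oplus> A\<close> of the zero extension: it is the first injection of
  another biproduct structure on \<open>N \<oplus> A\<close>, obtained by a shear.
\<close>

lemma real_split_graph:
  assumes S: "is_biproduct K N A S" and "N \<in> Ob K" "A \<in> Ob K" "a \<in> arr K N A"
  shows "(in1 S \<oplus>\<^bsub>Hom K N (bip S)\<^esub> in2 S \<star> (\<ominus>\<^bsub>Hom K N A\<^esub> a), bip S,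
      pr2 S \<oplus>\<^bsub>Hom K (bip S) A\<^esub> a \<star> pr1 S) \<in> s A N \<zero>\<^bsub>val E A N\<^esub>"
proof -
  note S' = is_biproductD[OF S]
  let ?i = "in1 S" and ?j = "in2 S" and ?p = "pr1 S" and ?q = "pr2 S" and ?D = "bip S"
  define b where "b = \<ominus>\<^bsub>Hom K N A\<^esub> a"
  have b: "b \<in> arr K N A" using assms by (simp add: b_def)
  let ?f = "?i \<oplus>\<^bsub>Hom K N ?D\<^esub> ?j \<star> b"
  let ?f' = "?q \<oplus>\<^bsub>Hom K ?D A\<^esub> a \<star> ?p"
  note ty = S' assms(2-4) b
  have jb: "?j \<star> b \<in> arr K N ?D" and ap: "a \<star> ?p \<in> arr K ?D A"
    using ty by (auto intro: cmp_in)
  have f: "?f \<in> arr K N ?D" and f': "?f' \<in> arr K ?D A"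
    using ty jb ap by auto
  interpret NA: abelian_group "Hom K N A" using assms by (intro hom_group)
  interpret NN: abelian_group "Hom K N N" using assms by (intro hom_group)
  interpret AA: abelian_group "Hom K A A" using assms by (intro hom_group)
  interpret AN: abelian_group "Hom K A N" using assms by (intro hom_group)
  interpret DD: abelian_group "Hom K ?D ?D" using assms S' by (intro hom_group)
  have pjb: "?p \<star> (?j \<star> b) = \<zero>\<^bsub>Hom K N N\<^esub>"
    using ty assoc[of b N A ?j ?D ?p N] by (simp add: zero_cmp)
  have qjb: "?q \<star> (?j \<star> b) = b"
    using ty assoc[of b N A ?j ?D ?q A] by simp
  have apf: "a \<star> ?p \<star> ?i = a" "a \<star> ?p \<star> (?j \<star> b) = \<zero>\<^bsub>Hom K N A\<^esub>"
      "a \<star> ?p \<star> ?j = \<zero>\<^bsub>Hom K A A\<^esub>"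
    using ty jb pjb assoc[of ?i N ?D ?p N a A] assoc[of "?j \<star> b" N ?D ?p N a A] assoc[of ?j A ?D ?p N a A]
    by (simp_all add: cmp_zero)
  have 1: "?p \<star> ?f = ident K N"
    using ty jb pjb by (simp add: cmp_add[of _ ?D])
  have 2: "?f' \<star> ?j = ident K A"
    using ty ap apf by (simp add: add_cmp[of _ A ?D])
  have 3: "?f' \<star> ?f = \<zero>\<^bsub>Hom K N A\<^esub>"
    using ty jb ap f apf qjb by (simp add: add_cmp[of _ N ?D] cmp_add[of _ ?D A] b_def NA.r_neg)
  have jap: "?j \<star> (a \<star> ?p) = ?j \<star> a \<star> ?p" "?j \<star> b \<star> ?p = \<ominus>\<^bsub>Hom K ?D ?D\<^esub> (?j \<star> a \<star> ?p)"
    using ty by (simp_all add: b_def cmp_minus[of ?j A] minus_cmp[of ?p ?D N] assoc[of ?p ?D N a A ?j] cmp_arr[of a N A])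
  have c: "?i \<star> ?p \<in> arr K ?D ?D" "?j \<star> ?q \<in> arr K ?D ?D" "?j \<star> a \<star> ?p \<in> arr K ?D ?D"
    using ty by (meson cmp_in)+
  have 4: "?f \<star> ?p \<oplus>\<^bsub>Hom K ?D ?D\<^esub> ?j \<star> ?f' = ident K ?D"
  proof -
    have "?f \<star> ?p \<oplus>\<^bsub>Hom K ?D ?D\<^esub> ?j \<star> ?f' =
        (?i \<star> ?p \<oplus>\<^bsub>Hom K ?D ?D\<^esub> \<ominus>\<^bsub>Hom K ?D ?D\<^esub> (?j \<star> a \<star> ?p))
        \<oplus>\<^bsub>Hom K ?D ?D\<^esub> (?j \<star> ?q \<oplus>\<^bsub>Hom K ?D ?D\<^esub> ?j \<star> a \<star> ?p)"
      using ty jb ap by (simp add: add_cmp[of _ ?D N] cmp_add[of _ A ?D] jap)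
    also have "\<dots> = ?i \<star> ?p \<oplus>\<^bsub>Hom K ?D ?D\<^esub> ?j \<star> ?q"
      using c by (simp add: DD.a_ac DD.r_neg DD.r_neg1 DD.r_neg2)
    finally show ?thesis using ty by simp
  qed
  have "is_biproduct K N A \<lparr>bip = ?D, in1 = ?f, in2 = ?j, pr1 = ?p, pr2 = ?f'\<rparr>"
    unfolding is_biproduct_def using ty f f' 1 2 3 4 by simp
  from real_zero[OF _ _ this] show ?thesis
    using assms by (simp add: b_def)
qed

text \<open>
  The homotopy pushout of \<open>\<kappa>\<close> along \<open>b : N \<rightarrow> A\<close>: a conflation of \<open>b\<^sub>* \<kappa>\<close> can be chosen such that
  its middle term \<open>L\<close> is the end of a conflation \<open>N \<rightarrow> P \<oplus> A \<rightarrow> L\<close> realizing \<open>e\<^sup>* \<kappa>\<close>. The inflation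
  with components \<open>k\<close> and \<open>-b\<close> is the composite of the split inflation \<open>N \<rightarrow> N \<oplus> A\<close> with components
  \<open>1\<close> and \<open>-b\<close> and of \<open>k \<oplus> 1 : N \<oplus> A \<rightarrow> P \<oplus> A\<close>, so the octahedral axiom (ET4) supplies everything.
\<close>

lemma homotopy_pushout:
  assumes tri: "(k, P, g) \<in> s C N \<kappa>" "C \<in> Ob K" "N \<in> Ob K" "\<kappa> \<in> Ext C N"
    and b: "b \<in> arr K N A" "A \<in> Ob K"
  obtains T L d e m h where "is_biproduct K P A T" "L \<in> Ob K" "h \<in> arr K (bip T) L"
    "(d, L, e) \<in> s C A (push K E C b \<kappa>)"
    "(m, bip T, h) \<in> s L N (pull K E N e \<kappa>)"
    "pr1 T \<star> m = k" "pr2 T \<star> m = \<ominus>\<^bsub>Hom K N A\<^esub> b"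
    "h \<star> in2 T = d" "e \<star> (h \<star> in1 T) = g"
proof -
  note t = real_seq[OF tri(1-4)]
  obtain S where S: "is_biproduct K N A S" using has_biproducts tri b by blast
  obtain T where T: "is_biproduct K P A T" using has_biproducts t b by blast
  note S' = is_biproductD[OF S] and T' = is_biproductD[OF T]
  define a where "a = \<ominus>\<^bsub>Hom K N A\<^esub> b"
  define f where "f = in1 S \<oplus>\<^bsub>Hom K N (bip S)\<^esub> in2 S \<star> a"
  define f' where "f' = pr2 S \<oplus>\<^bsub>Hom K (bip S) A\<^esub> b \<star> pr1 S"
  define n where "n = mor_dsum K S T k (ident K A)"
  note ty = S' T' t tri b
  have a: "a \<in> arr K N A" using ty by (simp add: a_def)
  have ja: "in2 S \<star> a \<in> arr K N (bip S)" and bp: "b \<star> pr1 S \<in> arr K (bip S) A"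
    using ty a by (auto intro: cmp_in)
  have split: "(f, bip S, f') \<in> s A N \<zero>\<^bsub>val E A N\<^esub>"
    unfolding f_def f'_def a_def by (rule real_split_graph[OF S]) (use ty in auto)
  have f: "f \<in> arr K N (bip S)" "f' \<in> arr K (bip S) A"
    using real_seq[OF split] ty by auto
  have nr: "(n, bip T, g \<star> pr1 T) \<in> s C (bip S) (push K E C (in1 S) \<kappa>)"
    unfolding n_def by (rule real_dsum_ident[OF tri b(2) S T])
  have \<theta>: "push K E C (in1 S) \<kappa> \<in> Ext C (bip S)" using ty by simp
  have n: "n \<in> arr K (bip S) (bip T)"
    using real_seq[OF nr] ty \<theta> by blast
  \<comment> \<open>(ET4) for the graph of \<open>-b\<close>, followed by \<open>k \<oplus> 1\<close>\<close>
  obtain L d e h \<delta> where L: "L \<in> Ob K" "d \<in> arr K A L" "e \<in> arr K L C" "h \<in> arr K (bip T) L"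
      "\<delta> \<in> Ext L N" "h \<star> n = d \<star> f'" "e \<star> h = g \<star> pr1 T"
      "(n \<star> f, bip T, h) \<in> s L N \<delta>"
      "(d, L, e) \<in> s C A (push K E C f' (push K E C (in1 S) \<kappa>))"
      "push K E L f \<delta> = pull K E (bip S) e (push K E C (in1 S) \<kappa>)"
    using ET4[unfolded ET4_def, rule_format, OF tri(3) S'(1) T'(1) b(2) tri(2) _ \<theta> conjI[OF split nr]]
      ty by (metis val_zero)
  note ty = ty L(1-5) f n
  interpret NN: abelian_group "Hom K N N" using ty by (intro hom_group)
  interpret NA: abelian_group "Hom K N A" using ty by (intro hom_group)
  interpret NP: abelian_group "Hom K N P" using ty by (intro hom_group)
  interpret AA: abelian_group "Hom K A A" using ty by (intro hom_group)
  have n_eq: "n = in1 T \<star> (k \<star> pr1 S) \<oplus>\<^bsub>Hom K (bip S) (bip T)\<^esub> in2 T \<star> pr2 S"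
    using ty by (simp add: n_def mor_dsum_def)
  have ikp: "k \<star> pr1 S \<in> arr K (bip S) P" "in1 T \<star> (k \<star> pr1 S) \<in> arr K (bip S) (bip T)" 
    "in2 T \<star> pr2 S \<in> arr K (bip S) (bip T)"
    using ty by (meson cmp_in)+
  have pr1n: "pr1 T \<star> n = k \<star> pr1 S"
  proof -
    have "pr1 T \<star> n = pr1 T \<star> (in1 T \<star> (k \<star> pr1 S)) \<oplus>\<^bsub>Hom K (bip S) P\<^esub> pr1 T \<star> (in2 T \<star> pr2 S)"
      unfolding n_eq by (rule cmp_add) (use ty ikp in auto)
    also have "\<dots> = k \<star> pr1 S \<oplus>\<^bsub>Hom K (bip S) P\<^esub> \<zero>\<^bsub>Hom K (bip S) P\<^esub>"
      using ty ikp assoc[of "k \<star> pr1 S" "bip S" P "in1 T" "bip T" "pr1 T" P]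
        assoc[of "pr2 S" "bip S" A "in2 T" "bip T" "pr1 T" P]
        cmp_ident_left[OF ikp(1)] by (simp add: zero_cmp)
    finally show ?thesis using ty ikp by (simp add: hom_r_zero)
  qed
  have pr2n: "pr2 T \<star> n = pr2 S"
  proof -
    have "pr2 T \<star> n = pr2 T \<star> (in1 T \<star> (k \<star> pr1 S)) \<oplus>\<^bsub>Hom K (bip S) A\<^esub> pr2 T \<star> (in2 T \<star> pr2 S)"
      unfolding n_eq by (rule cmp_add) (use ty ikp in auto)
    also have "\<dots> = \<zero>\<^bsub>Hom K (bip S) A\<^esub> \<oplus>\<^bsub>Hom K (bip S) A\<^esub> pr2 S"
      using ty ikp assoc[of "k \<star> pr1 S" "bip S" P "in1 T" "bip T" "pr2 T" A]
        assoc[of "pr2 S" "bip S" A "in2 T" "bip T" "pr2 T" A] zero_cmp[OF ikp(1)] by simp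
    finally show ?thesis using ty ikp by (simp add: hom_l_zero)
  qed
  have nj: "n \<star> in2 S = in2 T"
  proof -
    have "n \<star> in2 S = in1 T \<star> (k \<star> pr1 S) \<star> in2 S \<oplus>\<^bsub>Hom K A (bip T)\<^esub> in2 T \<star> pr2 S \<star> in2 S"
      unfolding n_eq by (rule add_cmp) (use ty ikp in auto)
    also have "\<dots> = \<zero>\<^bsub>Hom K A (bip T)\<^esub> \<oplus>\<^bsub>Hom K A (bip T)\<^esub> in2 T"
      using ty ikp assoc[of "in2 S" A "bip S" "k \<star> pr1 S" P "in1 T" "bip T"]
        assoc[of "in2 S" A "bip S" "pr1 S" N k P] assoc[of "in2 S" A "bip S" "pr2 S" A "in2 T" "bip T"]
      by (simp add: cmp_zero[of k N P] cmp_zero[of "in1 T" P "bip T"])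
    finally show ?thesis using ty ikp by (simp add: hom_l_zero)
  qed
  have pf: "pr1 S \<star> f = ident K N" "pr2 S \<star> f = a"
    using ty a ja assoc[of a N A "in2 S" "bip S" "pr1 S" N, symmetric]
      assoc[of a N A "in2 S" "bip S" "pr2 S" A, symmetric]
    by (simp_all add: f_def cmp_add[of _ "bip S"] zero_cmp hom_l_zero hom_r_zero)
  have f'i: "f' \<star> in1 S = b" "f' \<star> in2 S = ident K A"
    using ty bp assoc[of "in1 S" N "bip S" "pr1 S" N b A] assoc[of "in2 S" A "bip S" "pr1 S" N b A]
    by (simp_all add: f'_def add_cmp[of _ _ "bip S"] cmp_zero hom_l_zero hom_r_zero)
  have nf: "n \<star> f \<in> arr K N (bip T)" using ty by (meson cmp_in)
  \<comment> \<open>\<open>pr1\<close> is a retraction of the graph, so that \<open>f\<^sub>* \<delta> = e\<^sup>* in1\<^sub>* \<kappa>\<close> determines \<open>\<delta>\<close>\<close>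
  have \<delta>_eq: "\<delta> = pull K E N e \<kappa>"
  proof -
    have "\<delta> = push K E L (pr1 S) (push K E L f \<delta>)"
      using ty pf by (simp add: push_cmp[symmetric, of \<delta> L N])
    also have "\<dots> = push K E L (pr1 S \<star> in1 S) (pull K E N e \<kappa>)"
      using ty L(10) by (simp add: pull_push[of \<kappa> C N e L] push_cmp[symmetric, of "pull K E N e \<kappa>" L N])
    finally show ?thesis using ty by simp
  qed
  show thesis
  proof (rule that[OF T L(1,4)])
    show "(d, L, e) \<in> s C A (push K E C b \<kappa>)"
      using L(9) ty f'i by (simp add: push_cmp[symmetric, of \<kappa> C N])
    show "(n \<star> f, bip T, h) \<in> s L N (pull K E N e \<kappa>)"
      using L(8) \<delta>_eq by simp
    show "pr1 T \<star> (n \<star> f) = k"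
      using ty pr1n pf assoc[of f N "bip S" n "bip T" "pr1 T" P] assoc[of f N "bip S" "pr1 S" N k P] by simp
    show "pr2 T \<star> (n \<star> f) = \<ominus>\<^bsub>Hom K N A\<^esub> b"
      using ty pr2n pf assoc[of f N "bip S" n "bip T" "pr2 T" A] by (simp add: a_def)
    have "h \<star> in2 T = d \<star> f' \<star> in2 S"
      using ty nj L(6) assoc[of "in2 S" A "bip S" n "bip T" h L] by simp
    also have "\<dots> = d"
      using ty f'i assoc[of "in2 S" A "bip S" f' A d L] by simp
    finally show "h \<star> in2 T = d" .
    show "e \<star> (h \<star> in1 T) = g"
      using ty L(7) assoc[of "in1 T" P "bip T" h L e C] assoc[of "in1 T" P "bip T" "pr1 T" P g C] by simp
  qed
qed

end

section \<open>Exactness of effaceable connected sequences\<close>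

lemma (in bilinear_functor) biproduct_decomposition:
  assumes "is_biproduct K A B T" "u \<in> carrier (val F X (bip T))" "X \<in> Ob K" "A \<in> Ob K" "B \<in> Ob K"
  shows "u = push K F X (in1 T) (push K F X (pr1 T) u)
    \<oplus>\<^bsub>val F X (bip T)\<^esub> push K F X (in2 T) (push K F X (pr2 T) u)"
proof -
  note T = is_biproductD[OF assms(1)]
  have ip: "in1 T \<star> pr1 T \<in> arr K (bip T) (bip T)" "in2 T \<star> pr2 T \<in> arr K (bip T) (bip T)"
    using T assms by (meson cmp_in)+
  have "u = push K F X (in1 T \<star> pr1 T \<oplus>\<^bsub>Hom K (bip T) (bip T)\<^esub> in2 T \<star> pr2 T) u"
    using T assms by simp
  also have "\<dots> = push K F X (in1 T \<star> pr1 T) u \<oplus>\<^bsub>val F X (bip T)\<^esub> push K F X (in2 T \<star> pr2 T) u"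
    using ip T(1) assms by (intro push_add_mor)
  finally show ?thesis
    using T(1-5) assms by (simp add: push_cmp[of u X "bip T"])
qed

locale connected_sequence = extriangulated_category R K E s
  for R :: "('r, 'z) ring_scheme" and K :: "('r, 'o, 'm) lincat"
    and E :: "('r, 'o, 'm, 'e) bifun" and s :: "('o, 'm, 'e) realization" +
  fixes G :: "nat \<Rightarrow> ('r, 'o, 'm, 'g) bifun"
    and conn :: "nat \<Rightarrow> 'o \<Rightarrow> 'o \<Rightarrow> 'e \<Rightarrow> 'o \<Rightarrow> 'g \<Rightarrow> 'g"
  assumes terms: "bilinear_functor R K (G n)"
    and conn_morphism: "\<lbrakk>C \<in> Ob K; A \<in> Ob K; \<delta> \<in> carrier (val E C A)\<rbrakk>
      \<Longrightarrow> conn n C A \<delta> \<in> nat_trans R (opp K) (contra K (G (Suc n)) C) (contra K (G n) A)"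
    and conn_natural: "\<lbrakk>C \<in> Ob K; A \<in> Ob K; C' \<in> Ob K; A' \<in> Ob K;
        \<delta> \<in> carrier (val E C A); \<delta>' \<in> carrier (val E C' A'); ext_morphism K E C A \<delta> C' A' \<delta>' a c;
        X \<in> Ob K; u \<in> carrier (val (G (Suc n)) X C)\<rbrakk>
      \<Longrightarrow> push K (G n) X a (conn n C A \<delta> X u) = conn n C' A' \<delta>' X (push K (G (Suc n)) X c u)"
begin

sublocale G: bilinear_functor R K "G n" for n
  by (rule terms)

abbreviation val_G :: "nat \<Rightarrow> 'o \<Rightarrow> 'o \<Rightarrow> 'g set"
  where "val_G n X A \<equiv> carrier (val (G n) X A)"

lemma conn_linear: "\<lbrakk>\<delta> \<in> Ext C A; C \<in> Ob K; A \<in> Ob K; X \<in> Ob K\<rbrakk>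
    \<Longrightarrow> conn n C A \<delta> X \<in> lin_maps R (val (G (Suc n)) X C) (val (G n) X A)"
  using conn_morphism[of C A \<delta> n] by (auto simp: nat_trans_def contra_def opp_def)

lemma conn_closed [simp]: "\<lbrakk>u \<in> val_G (Suc n) X C; \<delta> \<in> Ext C A; C \<in> Ob K; A \<in> Ob K; X \<in> Ob K\<rbrakk>
    \<Longrightarrow> conn n C A \<delta> X u \<in> val_G n X A"
  using conn_linear lin_maps_closed by metis

lemma conn_add: "\<lbrakk>u \<in> val_G (Suc n) X C; v \<in> val_G (Suc n) X C; \<delta> \<in> Ext C A; C \<in> Ob K; A \<in> Ob K; X \<in> Ob K\<rbrakk>
    \<Longrightarrow> conn n C A \<delta> X (u \<oplus>\<^bsub>val (G (Suc n)) X C\<^esub> v) = conn n C A \<delta> X u \<oplus>\<^bsub>val (G n) X A\<^esub> conn n C A \<delta> X v"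
  by (rule lin_maps_add[OF conn_linear])

lemma conn_smult: "\<lbrakk>u \<in> val_G (Suc n) X C; r \<in> carrier R; \<delta> \<in> Ext C A; C \<in> Ob K; A \<in> Ob K; X \<in> Ob K\<rbrakk>
    \<Longrightarrow> conn n C A \<delta> X (r \<odot>\<^bsub>val (G (Suc n)) X C\<^esub> u) = r \<odot>\<^bsub>val (G n) X A\<^esub> conn n C A \<delta> X u"
  by (rule lin_maps_smult[OF conn_linear])

lemma conn_zero: "\<lbrakk>\<delta> \<in> Ext C A; C \<in> Ob K; A \<in> Ob K; X \<in> Ob K\<rbrakk>
    \<Longrightarrow> conn n C A \<delta> X \<zero>\<^bsub>val (G (Suc n)) X C\<^esub> = \<zero>\<^bsub>val (G n) X A\<^esub>"
  by (rule lin_maps_zero[OF G.val_module G.val_module conn_linear])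

lemma conn_minus: "\<lbrakk>u \<in> val_G (Suc n) X C; \<delta> \<in> Ext C A; C \<in> Ob K; A \<in> Ob K; X \<in> Ob K\<rbrakk>
    \<Longrightarrow> conn n C A \<delta> X (\<ominus>\<^bsub>val (G (Suc n)) X C\<^esub> u) = \<ominus>\<^bsub>val (G n) X A\<^esub> conn n C A \<delta> X u"
  by (rule lin_maps_minus[OF G.val_module G.val_module conn_linear])

lemma conn_pull_arg: "\<lbrakk>u \<in> val_G (Suc n) X C; f \<in> arr K X' X; \<delta> \<in> Ext C A; C \<in> Ob K; A \<in> Ob K; X \<in> Ob K; X' \<in> Ob K\<rbrakk>
    \<Longrightarrow> conn n C A \<delta> X' (pull K (G (Suc n)) C f u) = pull K (G n) A f (conn n C A \<delta> X u)"
  using conn_morphism[of C A \<delta> n] by (auto simp: nat_trans_def contra_def opp_def)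

lemma conn_push: "\<lbrakk>u \<in> val_G (Suc n) X C; a \<in> arr K A A'; \<delta> \<in> Ext C A; C \<in> Ob K; A \<in> Ob K; A' \<in> Ob K; X \<in> Ob K\<rbrakk>
    \<Longrightarrow> conn n C A' (push K E C a \<delta>) X u = push K (G n) X a (conn n C A \<delta> X u)"
  using conn_natural[of C A C A' \<delta> "push K E C a \<delta>" a "ident K C" X u n] by (simp add: ext_morphism_def)

lemma conn_pull: "\<lbrakk>u \<in> val_G (Suc n) X C'; c \<in> arr K C' C; \<delta> \<in> Ext C A; C \<in> Ob K; C' \<in> Ob K; A \<in> Ob K; X \<in> Ob K\<rbrakk>
    \<Longrightarrow> conn n C' A (pull K E A c \<delta>) X u = conn n C A \<delta> X (push K (G (Suc n)) X c u)"
  using conn_natural[of C' A C A "pull K E A c \<delta>" \<delta> "ident K A" c X u n] by (simp add: ext_morphism_def)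

lemma conn_zero_ext: 
  assumes "u \<in> val_G (Suc n) X C" "C \<in> Ob K" "A \<in> Ob K" "X \<in> Ob K"
  shows "conn n C A \<zero>\<^bsub>val E C A\<^esub> X u = \<zero>\<^bsub>val (G n) X A\<^esub>"
  using conn_push[of u n X C "\<zero>\<^bsub>Hom K A A\<^esub>" A A "\<zero>\<^bsub>val E C A\<^esub>"] assms
  by (simp add: push_zero_mor G.push_zero_mor)

lemma push_push_conflation:
  assumes "(x, B, y) \<in> s C A \<delta>" "C \<in> Ob K" "A \<in> Ob K" "\<delta> \<in> Ext C A" "X \<in> Ob K" "u \<in> val_G n X A"
  shows "push K (G n) X y (push K (G n) X x u) = \<zero>\<^bsub>val (G n) X C\<^esub>"
  using assms real_seq[OF assms(1-4)] conflation_cmp_zero[OF assms(1-4)]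
  by (simp add: G.push_cmp[symmetric, of u n X A] G.push_zero_mor)

lemma push_conn:
  assumes "(x, B, y) \<in> s C A \<delta>" "C \<in> Ob K" "A \<in> Ob K" "\<delta> \<in> Ext C A" "X \<in> Ob K" "u \<in> val_G (Suc n) X C"
  shows "push K (G n) X x (conn n C A \<delta> X u) = \<zero>\<^bsub>val (G n) X B\<^esub>"
  using assms real_seq[OF assms(1-4)] push_inflation_zero[OF assms(1-4)]
  by (simp add: conn_push[symmetric, of u n X C] conn_zero_ext)

lemma conn_push_deflation:
  assumes "(x, B, y) \<in> s C A \<delta>" "C \<in> Ob K" "A \<in> Ob K" "\<delta> \<in> Ext C A" "X \<in> Ob K" "u \<in> val_G (Suc n) X B"
  shows "conn n C A \<delta> X (push K (G (Suc n)) X y u) = \<zero>\<^bsub>val (G n) X A\<^esub>"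
  using assms real_seq[OF assms(1-4)] pull_deflation_zero[OF assms(1-4)]
  by (simp add: conn_pull[symmetric, of u n X B y C] conn_zero_ext)

end

text \<open>
  The conditions \<open>conn_inj\<close> and \<open>conn_surj\<close> say that for a projective deflation \<open>P \<rightarrow> C\<close> with fibre \<open>N\<close>
  the connecting map identifies the next term at \<open>C\<close> with the kernel of the map from \<open>N\<close> to \<open>P\<close>. With
  projective objects this is the usual description of a left satellite.
\<close>

locale effaceable_sequence = connected_sequence R K E s G conn
  for R :: "('r, 'z) ring_scheme" and K :: "('r, 'o, 'm) lincat"
    and E :: "('r, 'o, 'm, 'e) bifun" and s :: "('o, 'm, 'e) realization"
    and G :: "nat \<Rightarrow> ('r, 'o, 'm, 'g) bifun"
    and conn :: "nat \<Rightarrow> 'o \<Rightarrow> 'o \<Rightarrow> 'e \<Rightarrow> 'o \<Rightarrow> 'g \<Rightarrow> 'g" +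
  assumes enough_projectives: "enough_projective_morphisms K E s"
    and conn_inj: "\<lbrakk>(k, P, g) \<in> s C N \<kappa>; projective_morphism K E P C g;
        C \<in> Ob K; N \<in> Ob K; \<kappa> \<in> Ext C N; X \<in> Ob K\<rbrakk> \<Longrightarrow> inj_on (conn n C N \<kappa> X) (val_G (Suc n) X C)"
    and conn_surj: "\<lbrakk>(k, P, g) \<in> s C N \<kappa>; projective_morphism K E P C g;
        C \<in> Ob K; N \<in> Ob K; \<kappa> \<in> Ext C N; X \<in> Ob K; v \<in> val_G n X N;
        push K (G n) X k v = \<zero>\<^bsub>val (G n) X P\<^esub>\<rbrakk> \<Longrightarrow> v \<in> conn n C N \<kappa> X ` val_G (Suc n) X C"
    and middle_exact_0: "\<lbrakk>(x, B, y) \<in> s C A \<delta>; C \<in> Ob K; A \<in> Ob K; \<delta> \<in> Ext C A; X \<in> Ob K;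
        v \<in> val_G 0 X B; push K (G 0) X y v = \<zero>\<^bsub>val (G 0) X C\<^esub>\<rbrakk> \<Longrightarrow> v \<in> push K (G 0) X x ` val_G 0 X A"
begin

lemma projective_conflation:
  assumes "C \<in> Ob K"
  obtains k P g N \<kappa> where "(k, P, g) \<in> s C N \<kappa>" "projective_morphism K E P C g" "N \<in> Ob K" "\<kappa> \<in> Ext C N"
  using enough_projectives assms unfolding enough_projective_morphisms_def deflation_def by blast

text \<open>
  If \<open>\<kappa>\<close> has a projective deflation onto \<open>P\<close>, then the composite of \<open>q\<^sub>*\<close> with the injective map \<open>\<kappa>\<^sub>\<sharp>\<close> is \<open>(q\<^sup>* \<kappa>)\<^sub>\<sharp>\<close>, and \<open>q\<^sup>* \<kappa> = 0\<close>.
\<close>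

lemma push_projective_zero:
  assumes "projective_morphism K E Q P q" "Q \<in> Ob K" "P \<in> Ob K" "X \<in> Ob K" "u \<in> val_G (Suc n) X Q"
  shows "push K (G (Suc n)) X q u = \<zero>\<^bsub>val (G (Suc n)) X P\<^esub>"
proof -
  obtain k P' g N \<kappa> where t: "(k, P', g) \<in> s P N \<kappa>" "projective_morphism K E P' P g" "N \<in> Ob K" "\<kappa> \<in> Ext P N"
    using projective_conflation assms(3) by blast
  have q: "q \<in> arr K Q P" "pull K E N q \<kappa> = \<zero>\<^bsub>val E Q N\<^esub>"
    using assms t by (auto simp: projective_morphism_def)
  have "conn n P N \<kappa> X (push K (G (Suc n)) X q u) = \<zero>\<^bsub>val (G n) X N\<^esub>"
    using q t assms by (simp add: conn_pull[symmetric, of u n X Q q P] conn_zero_ext)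
  also have "\<dots> = conn n P N \<kappa> X \<zero>\<^bsub>val (G (Suc n)) X P\<^esub>"
    using t assms by (simp add: conn_zero)
  finally show ?thesis
    using conn_inj[OF t(1,2) assms(3) t(3,4) assms(4), of n] q assms
    by (auto simp: inj_on_def)
qed

text \<open>
  Comparison of an arbitrary conflation \<open>A \<rightarrow> B \<rightarrow> C\<close> with one whose deflation \<open>g : P \<rightarrow> C\<close> is
  projective. The homotopy pushout and the uniqueness of conflations yield a conflation
  \<open>N \<rightarrow> P \<oplus> A \<rightarrow> L\<close> with \<open>L \<cong> B\<close>; all exactness statements below come from it.
\<close>

lemma projective_comparison:
  assumes proj: "(k, P, g) \<in> s C N \<kappa>" "projective_morphism K E P C g" "N \<in> Ob K" "\<kappa> \<in> Ext C N"
    and tri: "(x, B, y) \<in> s C A \<delta>" "C \<in> Ob K" "A \<in> Ob K" "\<delta> \<in> Ext C A"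
  obtains b T L e m h \<phi> \<psi> where "b \<in> arr K N A" "push K E C b \<kappa> = \<delta>"
    "is_biproduct K P A T" "L \<in> Ob K" "e \<in> arr K L C" "m \<in> arr K N (bip T)" "h \<in> arr K (bip T) L"
    "(m, bip T, h) \<in> s L N (pull K E N e \<kappa>)"
    "pr1 T \<star> m = k" "pr2 T \<star> m = \<ominus>\<^bsub>Hom K N A\<^esub> b"
    "\<phi> \<in> arr K B L" "\<psi> \<in> arr K L B" "\<psi> \<star> \<phi> = ident K B"
    "\<phi> \<star> x = h \<star> in2 T" "\<psi> \<star> (h \<star> in2 T) = x" "e \<star> \<phi> = y" "y \<star> \<psi> = e"
    "e \<star> (h \<star> in1 T) = g"
proof -
  have P: "P \<in> Ob K" using real_seq[OF proj(1) tri(2) proj(3,4)] by simp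
  have "pull K E A g \<delta> = \<zero>\<^bsub>val E P A\<^esub>"
    using proj(2) tri by (auto simp: projective_morphism_def)
  then obtain b where b: "b \<in> arr K N A" "push K E C b \<kappa> = \<delta>"
    using ext_is_pushout[OF proj(1) tri(2) proj(3,4) tri(4,3)] by blast
  obtain T L d e m h where h: "is_biproduct K P A T" "L \<in> Ob K" "h \<in> arr K (bip T) L"
    "(d, L, e) \<in> s C A \<delta>" "(m, bip T, h) \<in> s L N (pull K E N e \<kappa>)"
    "pr1 T \<star> m = k" "pr2 T \<star> m = \<ominus>\<^bsub>Hom K N A\<^esub> b"
    "h \<star> in2 T = d" "e \<star> (h \<star> in1 T) = g"
    using homotopy_pushout[OF proj(1) tri(2) proj(3,4) b(1) tri(3)] b(2) by metis
  have e: "e \<in> arr K L C" using real_seq[OF h(4) tri(2-4)] by simp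
  have m: "m \<in> arr K N (bip T)"
    using real_seq[OF h(5,2) proj(3)] e h(2) tri proj by simp
  obtain u v where "u \<in> arr K B L" "v \<in> arr K L B" "v \<star> u = ident K B"
    "u \<star> x = d" "e \<star> u = y" "v \<star> d = x" "y \<star> v = e"
    by (rule real_unique[OF tri(1) h(4) tri(2-4)])
  with b h e m show thesis by (intro that) simp_all
qed

definition exact_left :: "nat \<Rightarrow> bool" where
  "exact_left n \<longleftrightarrow> (\<forall>C \<in> Ob K. \<forall>A \<in> Ob K. \<forall>\<delta> \<in> Ext C A. \<forall>x B y. (x, B, y) \<in> s C A \<delta> \<longrightarrow>
     (\<forall>X \<in> Ob K. \<forall>v \<in> val_G n X A. push K (G n) X x v = \<zero>\<^bsub>val (G n) X B\<^esub> \<longrightarrow>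
        v \<in> conn n C A \<delta> X ` val_G (Suc n) X C))"

definition exact_middle :: "nat \<Rightarrow> bool" where
  "exact_middle n \<longleftrightarrow> (\<forall>C \<in> Ob K. \<forall>A \<in> Ob K. \<forall>\<delta> \<in> Ext C A. \<forall>x B y. (x, B, y) \<in> s C A \<delta> \<longrightarrow>
     (\<forall>X \<in> Ob K. \<forall>v \<in> val_G n X B. push K (G n) X y v = \<zero>\<^bsub>val (G n) X C\<^esub> \<longrightarrow>
        v \<in> push K (G n) X x ` val_G n X A))"

definition exact_right :: "nat \<Rightarrow> bool" where
  "exact_right n \<longleftrightarrow> (\<forall>C \<in> Ob K. \<forall>A \<in> Ob K. \<forall>\<delta> \<in> Ext C A. \<forall>x B y. (x, B, y) \<in> s C A \<delta> \<longrightarrow>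
     (\<forall>X \<in> Ob K. \<forall>v \<in> val_G (Suc n) X C. conn n C A \<delta> X v = \<zero>\<^bsub>val (G n) X A\<^esub> \<longrightarrow>
        v \<in> push K (G (Suc n)) X y ` val_G (Suc n) X B))"

text \<open>
  If \<open>v\<close> at \<open>A\<close> dies at \<open>B\<close>, then \<open>(0, v)\<close> at \<open>P \<oplus> A\<close> dies at \<open>L\<close>, so it comes from some \<open>z\<close> at \<open>N\<close> with
  \<open>k\<^sub>* z = 0\<close> and \<open>b\<^sub>* z = -v\<close>. By effaceability \<open>z = \<kappa>\<^sub>\<sharp> u\<close>, and \<open>\<delta>\<^sub>\<sharp> u = b\<^sub>* \<kappa>\<^sub>\<sharp> u = -v\<close>.
\<close>

lemma exact_left_if_middle:
  assumes "exact_middle n"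
  shows "exact_left n"
  unfolding exact_left_def
proof (intro ballI allI impI)
  fix C A \<delta> x B y X v
  assume ob: "C \<in> Ob K" "A \<in> Ob K" "\<delta> \<in> Ext C A" and tri: "(x, B, y) \<in> s C A \<delta>"
    and X: "X \<in> Ob K" and v: "v \<in> val_G n X A" and v0: "push K (G n) X x v = \<zero>\<^bsub>val (G n) X B\<^esub>"
  obtain k P g N \<kappa> where proj: "(k, P, g) \<in> s C N \<kappa>" "projective_morphism K E P C g" "N \<in> Ob K" "\<kappa> \<in> Ext C N"
    using projective_conflation ob by blast
  obtain b T L e m h \<phi> \<psi> where c: "b \<in> arr K N A" "push K E C b \<kappa> = \<delta>"
    "is_biproduct K P A T" "L \<in> Ob K" "e \<in> arr K L C" "m \<in> arr K N (bip T)" "h \<in> arr K (bip T) L"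
    and tri': "(m, bip T, h) \<in> s L N (pull K E N e \<kappa>)"
    and c': "pr1 T \<star> m = k" "pr2 T \<star> m = \<ominus>\<^bsub>Hom K N A\<^esub> b" "\<phi> \<in> arr K B L" "\<phi> \<star> x = h \<star> in2 T"
    by (rule projective_comparison[OF proj tri ob])
  note t = real_seq[OF tri ob] and p = real_seq[OF proj(1) ob(1) proj(3,4)] and T = is_biproductD[OF c(3)]
  define w where "w = push K (G n) X (in2 T) v"
  have w: "w \<in> val_G n X (bip T)" using v X ob T by (simp add: w_def)
  have "push K (G n) X h w = push K (G n) X \<phi> (push K (G n) X x v)"
    using v X ob T t c c' by (simp add: w_def G.push_cmp[symmetric, of _ n X A])
  also have "\<dots> = \<zero>\<^bsub>val (G n) X L\<^esub>"
    using v0 X t c c' by (simp add: G.push_zero)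
  finally have "w \<in> push K (G n) X m ` val_G n X N"
    using assms tri' X w c proj ob unfolding exact_middle_def by (metis pull_closed)
  then obtain z where z: "z \<in> val_G n X N" "push K (G n) X m z = w" by blast
  have "push K (G n) X k z = push K (G n) X (pr1 T) w"
    using z X T c c' proj p G.push_cmp[of z n X N m "bip T" "pr1 T" P] by simp
  also have "\<dots> = \<zero>\<^bsub>val (G n) X P\<^esub>"
    using v X ob T p by (simp add: w_def G.push_cmp[symmetric, of _ n X A] G.push_zero_mor)
  finally obtain u where u: "u \<in> val_G (Suc n) X C" "conn n C N \<kappa> X u = z"
    using conn_surj[OF proj(1,2) ob(1) proj(3,4) X z(1)] by blast
  have "\<ominus>\<^bsub>val (G n) X A\<^esub> push K (G n) X b z = push K (G n) X (pr2 T) w"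
    using z X T c c' proj ob G.push_cmp[of z n X N m "bip T" "pr2 T" A]
    by (simp add: G.push_minus_mor[symmetric])
  also have "\<dots> = v"
    using v X ob T by (simp add: w_def G.push_cmp[symmetric, of _ n X A])
  finally have "conn n C A \<delta> X (\<ominus>\<^bsub>val (G (Suc n)) X C\<^esub> u) = v"
    using u X ob proj c conn_push[of u n X C b N A \<kappa>] by (simp add: conn_minus)
  then show "v \<in> conn n C A \<delta> X ` val_G (Suc n) X C"
    using u X ob by (metis G.val_minus imageI)
qed

text \<open>
  If \<open>\<delta>\<^sub>\<sharp> u = 0\<close>, then the image of \<open>\<kappa>\<^sub>\<sharp> u\<close> at \<open>P \<oplus> A\<close> has both components zero, so \<open>\<kappa>\<^sub>\<sharp> u\<close> is \<open>(e\<^sup>* \<kappa>)\<^sub>\<sharp> \<beta> = \<kappa>\<^sub>\<sharp> (e\<^sub>* \<beta>)\<close> for some \<open>\<beta>\<close>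
  at \<open>L\<close>, and injectivity of \<open>\<kappa>\<^sub>\<sharp>\<close> gives \<open>u = e\<^sub>* \<beta>\<close>.
\<close>

lemma exact_right_if_left:
  assumes "exact_left n"
  shows "exact_right n"
  unfolding exact_right_def
proof (intro ballI allI impI)
  fix C A \<delta> x B y X u
  assume ob: "C \<in> Ob K" "A \<in> Ob K" "\<delta> \<in> Ext C A" and tri: "(x, B, y) \<in> s C A \<delta>"
    and X: "X \<in> Ob K" and u: "u \<in> val_G (Suc n) X C" and u0: "conn n C A \<delta> X u = \<zero>\<^bsub>val (G n) X A\<^esub>"
  obtain k P g N \<kappa> where proj: "(k, P, g) \<in> s C N \<kappa>" "projective_morphism K E P C g" "N \<in> Ob K" "\<kappa> \<in> Ext C N"
    using projective_conflation ob by blast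
  obtain b T L e m h \<phi> \<psi> where c: "b \<in> arr K N A" "push K E C b \<kappa> = \<delta>"
    "is_biproduct K P A T" "L \<in> Ob K" "e \<in> arr K L C" "m \<in> arr K N (bip T)" "h \<in> arr K (bip T) L"
    and tri': "(m, bip T, h) \<in> s L N (pull K E N e \<kappa>)"
    and c': "pr1 T \<star> m = k" "pr2 T \<star> m = \<ominus>\<^bsub>Hom K N A\<^esub> b" "\<psi> \<in> arr K L B" "y \<star> \<psi> = e"
    by (rule projective_comparison[OF proj tri ob])
  note t = real_seq[OF tri ob] and p = real_seq[OF proj(1) ob(1) proj(3,4)] and T = is_biproductD[OF c(3)]
  define z where "z = conn n C N \<kappa> X u"
  have z: "z \<in> val_G n X N" using u X ob proj by (simp add: z_def)
  have zk: "push K (G n) X k z = \<zero>\<^bsub>val (G n) X P\<^esub>"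
    unfolding z_def by (rule push_conn[OF proj(1) ob(1) proj(3,4) X u])
  have zb: "push K (G n) X b z = \<zero>\<^bsub>val (G n) X A\<^esub>"
    using u0 u X ob proj c conn_push[of u n X C b N A \<kappa>] by (simp add: z_def)
  define w where "w = push K (G n) X m z"
  have w: "w \<in> val_G n X (bip T)" using z X proj T c by (simp add: w_def)
  have w1: "push K (G n) X (pr1 T) w = \<zero>\<^bsub>val (G n) X P\<^esub>"
    using z X T c c' proj p zk by (simp add: w_def G.push_cmp[symmetric, of _ n X N])
  have w2: "push K (G n) X (pr2 T) w = \<zero>\<^bsub>val (G n) X A\<^esub>"
  proof -
    interpret XA: abelian_group "val (G n) X A" using X ob by (intro G.val_group)
    show ?thesis
      using z X T c c' proj ob zb
      by (simp add: w_def G.push_cmp[symmetric, of _ n X N] G.push_minus_mor)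
  qed
  have "w = \<zero>\<^bsub>val (G n) X (bip T)\<^esub>"
  proof -
    interpret XT: abelian_group "val (G n) X (bip T)" using X T by (intro G.val_group)
    show ?thesis
      using G.biproduct_decomposition[OF c(3) w X p(1) ob(2)] X T p ob by (simp add: w1 w2 G.push_zero)
  qed
  then have "z \<in> conn n L N (pull K E N e \<kappa>) X ` val_G (Suc n) X L"
    using assms tri' X z c proj ob unfolding exact_left_def w_def by (metis pull_closed)
  then obtain \<beta> where \<beta>: "\<beta> \<in> val_G (Suc n) X L" "conn n L N (pull K E N e \<kappa>) X \<beta> = z" by blast
  then have "conn n C N \<kappa> X (push K (G (Suc n)) X e \<beta>) = conn n C N \<kappa> X u"
    using X c ob proj by (simp add: conn_pull[of \<beta> n X L e C] z_def)
  then have "push K (G (Suc n)) X e \<beta> = u"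
    using conn_inj[OF proj(1,2) ob(1) proj(3,4) X, of n] \<beta> u X c ob by (auto simp: inj_on_def)
  then have "push K (G (Suc n)) X y (push K (G (Suc n)) X \<psi> \<beta>) = u"
    using \<beta> X c c' ob t by (simp add: G.push_cmp[symmetric, of _ "Suc n" X L])
  then show "u \<in> push K (G (Suc n)) X y ` val_G (Suc n) X B"
    using \<beta> X c c' t by (metis G.push_closed imageI)
qed

text \<open>
  Let \<open>\<beta>\<close> at \<open>B\<close> die at \<open>C\<close>. Then \<open>(e\<^sup>* \<kappa>)\<^sub>\<sharp>\<close> kills it as well, so \<open>\<beta>\<close> comes from \<open>Q \<oplus> A\<close>, and the contribution
  of \<open>Q\<close> has to be moved to \<open>A\<close>. For this the comparison is made with the composite of two projective
  deflations \<open>q : Q \<rightarrow> P\<close> and \<open>g : P \<rightarrow> C\<close>. The component \<open>p : Q \<rightarrow> B\<close> is a lift of \<open>g q\<close>, and so is \<open>p' q\<close> for a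
  lift \<open>p'\<close> of \<open>g\<close>. Their difference factors through \<open>A\<close>, while \<open>q\<^sub>*\<close> is zero by projectivity.
\<close>

lemma exact_middle_Suc_if_right:
  assumes "exact_right n"
  shows "exact_middle (Suc n)"
  unfolding exact_middle_def
proof (intro ballI allI impI)
  fix C A \<delta> x B y X \<beta>
  assume ob: "C \<in> Ob K" "A \<in> Ob K" "\<delta> \<in> Ext C A" and tri: "(x, B, y) \<in> s C A \<delta>" and X: "X \<in> Ob K"
    and \<beta>: "\<beta> \<in> val_G (Suc n) X B" and \<beta>0: "push K (G (Suc n)) X y \<beta> = \<zero>\<^bsub>val (G (Suc n)) X C\<^esub>"
  obtain P g where P: "P \<in> Ob K" "deflation K E s P C g" "projective_morphism K E P C g"
    using enough_projectives ob unfolding enough_projective_morphisms_def by blast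
  obtain Q q where Q: "Q \<in> Ob K" "deflation K E s Q P q" "projective_morphism K E Q P q"
    using enough_projectives P unfolding enough_projective_morphisms_def by blast
  note t = real_seq[OF tri ob]
  have g: "g \<in> arr K P C" "pull K E M g \<epsilon> = \<zero>\<^bsub>val E P M\<^esub>" if "M \<in> Ob K" "\<epsilon> \<in> Ext C M" for M \<epsilon>
    using P that by (auto simp: projective_morphism_def)
  have q: "q \<in> arr K Q P" using Q by (auto simp: projective_morphism_def)
  have gq: "projective_morphism K E Q C (g \<star> q)"
    unfolding projective_morphism_def using g[OF ob(2,3)] q P Q ob
    by (auto simp: g pull_cmp[of _ C _ g P] pull_zero[of q Q P])
  obtain N \<kappa> k where proj: "(k, Q, g \<star> q) \<in> s C N \<kappa>" and N: "N \<in> Ob K" "\<kappa> \<in> Ext C N"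
    using deflation_cmp[OF Q(2) P(2,1) ob(1)] by (auto simp: deflation_def)
  obtain b T L e m h \<phi> \<psi> where c: "b \<in> arr K N A" "push K E C b \<kappa> = \<delta>"
    "is_biproduct K Q A T" "L \<in> Ob K" "e \<in> arr K L C" "m \<in> arr K N (bip T)" "h \<in> arr K (bip T) L"
    and tri': "(m, bip T, h) \<in> s L N (pull K E N e \<kappa>)"
    and c': "\<phi> \<in> arr K B L" "\<psi> \<in> arr K L B" "\<psi> \<star> \<phi> = ident K B"
      "\<psi> \<star> (h \<star> in2 T) = x" "e \<star> \<phi> = y" "y \<star> \<psi> = e" "e \<star> (h \<star> in1 T) = g \<star> q"
    by (rule projective_comparison[OF proj gq N tri ob])
  note T = is_biproductD[OF c(3)]
  have hi: "h \<star> in1 T \<in> arr K Q L" "h \<star> in2 T \<in> arr K A L"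
    using T Q ob c by (meson cmp_in)+
  define p where "p = \<psi> \<star> (h \<star> in1 T)"
  have p: "p \<in> arr K Q B" using hi c c' Q t by (simp add: p_def cmp_arr[of _ Q L])
  have yp: "y \<star> p = g \<star> q"
    using assoc[OF hi(1) c'(2) t(3)] Q c c' t ob by (simp add: p_def)
  obtain p' where p': "p' \<in> arr K P B" "y \<star> p' = g"
    using lift_along_deflation[OF tri ob g[OF ob(2,3)] P(1)] by blast
  have p'q: "p' \<star> q \<in> arr K Q B" using p' q P Q t by (meson cmp_in)
  interpret QB: abelian_group "Hom K Q B" using Q t by (intro hom_group)
  interpret QC: abelian_group "Hom K Q C" using Q ob by (intro hom_group)
  have "y \<star> (p \<oplus>\<^bsub>Hom K Q B\<^esub> \<ominus>\<^bsub>Hom K Q B\<^esub> (p' \<star> q)) = \<zero>\<^bsub>Hom K Q C\<^esub>"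
    using p p' p'q yp t ob Q P q g[OF ob(2,3)] assoc[of q Q P p' B y C, symmetric] QC.r_neg[of "g \<star> q"]
    by (simp add: cmp_add[of y B] cmp_minus[of y B])
  then obtain r where r: "r \<in> arr K Q A" "x \<star> r = p \<oplus>\<^bsub>Hom K Q B\<^esub> \<ominus>\<^bsub>Hom K Q B\<^esub> (p' \<star> q)"
    using factor_through_inflation[OF tri ob, of _ Q] p p'q Q t by (metis add_arr minus_arr)
  have p_eq: "p = x \<star> r \<oplus>\<^bsub>Hom K Q B\<^esub> p' \<star> q"
    using r p p'q by (simp add: QB.a_assoc QB.l_neg)
  define \<gamma>0 where "\<gamma>0 = push K (G (Suc n)) X \<phi> \<beta>"
  have \<gamma>0: "\<gamma>0 \<in> val_G (Suc n) X L" using \<beta> X c c' t by (simp add: \<gamma>0_def)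
  have "conn n L N (pull K E N e \<kappa>) X \<gamma>0 = conn n C N \<kappa> X (push K (G (Suc n)) X y \<beta>)"
    using \<beta> \<gamma>0 X c c' t N ob by (simp add: conn_pull[of _ n X L e C] \<gamma>0_def G.push_cmp[symmetric, of _ "Suc n" X B])
  also have "\<dots> = \<zero>\<^bsub>val (G n) X N\<^esub>"
    using \<beta>0 X N ob by (simp add: conn_zero)
  finally have "\<gamma>0 \<in> push K (G (Suc n)) X h ` val_G (Suc n) X (bip T)"
    using assms tri' X \<gamma>0 c N ob unfolding exact_right_def by (metis pull_closed)
  then obtain \<gamma> where \<gamma>: "\<gamma> \<in> val_G (Suc n) X (bip T)" "push K (G (Suc n)) X h \<gamma> = \<gamma>0" by blast
  define \<gamma>1 where "\<gamma>1 = push K (G (Suc n)) X (pr1 T) \<gamma>"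
  define \<gamma>2 where "\<gamma>2 = push K (G (Suc n)) X (pr2 T) \<gamma>"
  have \<gamma>12: "\<gamma>1 \<in> val_G (Suc n) X Q" "\<gamma>2 \<in> val_G (Suc n) X A"
    using \<gamma> X T Q ob by (simp_all add: \<gamma>1_def \<gamma>2_def)
  have "push K (G (Suc n)) X h \<gamma> = push K (G (Suc n)) X h (push K (G (Suc n)) X (in1 T) \<gamma>1)
      \<oplus>\<^bsub>val (G (Suc n)) X L\<^esub> push K (G (Suc n)) X h (push K (G (Suc n)) X (in2 T) \<gamma>2)"
    by (subst G.biproduct_decomposition[OF c(3) \<gamma>(1) X Q(1) ob(2)])
      (use \<gamma>12 X T(1-5) Q c(4,7) ob in \<open>simp add: G.push_add[of h "bip T"] flip: \<gamma>1_def \<gamma>2_def\<close>)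
  also have "\<dots> = push K (G (Suc n)) X (h \<star> in1 T) \<gamma>1 \<oplus>\<^bsub>val (G (Suc n)) X L\<^esub> push K (G (Suc n)) X (h \<star> in2 T) \<gamma>2"
    using \<gamma>12 X T(1-5) Q(1) c(4,7) ob
    by (simp add: G.push_cmp[of \<gamma>1 "Suc n" X Q "in1 T" "bip T" h L] G.push_cmp[of \<gamma>2 "Suc n" X A "in2 T" "bip T" h L])
  finally have h\<gamma>: "push K (G (Suc n)) X h \<gamma> = push K (G (Suc n)) X (h \<star> in1 T) \<gamma>1
      \<oplus>\<^bsub>val (G (Suc n)) X L\<^esub> push K (G (Suc n)) X (h \<star> in2 T) \<gamma>2" .
  have "\<beta> = push K (G (Suc n)) X \<psi> (push K (G (Suc n)) X h \<gamma>)"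
    using \<gamma>(2) \<beta> X c c' t by (simp add: \<gamma>0_def G.push_cmp[symmetric, of _ "Suc n" X B])
  also have "\<dots> = push K (G (Suc n)) X p \<gamma>1 \<oplus>\<^bsub>val (G (Suc n)) X B\<^esub> push K (G (Suc n)) X x \<gamma>2"
    unfolding h\<gamma> p_def c'(4)[symmetric] using \<gamma>12 X Q(1) c(4) c'(2) ob t hi
    by (simp add: G.push_add[of \<psi> L] G.push_cmp[OF \<gamma>12(1) hi(1) c'(2)] G.push_cmp[OF \<gamma>12(2) hi(2) c'(2)])
  also have "push K (G (Suc n)) X p \<gamma>1 = push K (G (Suc n)) X x (push K (G (Suc n)) X r \<gamma>1)
      \<oplus>\<^bsub>val (G (Suc n)) X B\<^esub> push K (G (Suc n)) X p' (push K (G (Suc n)) X q \<gamma>1)"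
    unfolding p_eq using \<gamma>12(1) X Q(1) P(1) ob(2) t(1,2) r(1) p'(1) q p'q
    by (simp add: G.push_add_mor[of _ "Suc n" X Q] G.push_cmp[of _ "Suc n" X Q] cmp_arr[of r Q A])
  also have "push K (G (Suc n)) X q \<gamma>1 = \<zero>\<^bsub>val (G (Suc n)) X P\<^esub>"
    by (rule push_projective_zero[OF Q(3,1) P(1) X \<gamma>12(1)])
  finally have "\<beta> = push K (G (Suc n)) X x (push K (G (Suc n)) X r \<gamma>1 \<oplus>\<^bsub>val (G (Suc n)) X A\<^esub> \<gamma>2)"
  proof -
    interpret XB: abelian_group "val (G (Suc n)) X B" using X t by (intro G.val_group)
    assume "\<beta> = push K (G (Suc n)) X x (push K (G (Suc n)) X r \<gamma>1)
      \<oplus>\<^bsub>val (G (Suc n)) X B\<^esub> push K (G (Suc n)) X p' \<zero>\<^bsub>val (G (Suc n)) X P\<^esub>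
      \<oplus>\<^bsub>val (G (Suc n)) X B\<^esub> push K (G (Suc n)) X x \<gamma>2"
    moreover have r\<gamma>: "push K (G (Suc n)) X r \<gamma>1 \<in> val_G (Suc n) X A"
      using \<gamma>12 X Q ob r by simp
    moreover have "push K (G (Suc n)) X x (push K (G (Suc n)) X r \<gamma>1) \<in> val_G (Suc n) X B"
      by (rule G.push_closed[OF r\<gamma> t(2) X ob(2) t(1)])
    ultimately show ?thesis
      using \<gamma>12 X P ob t p' by (simp add: G.push_zero[of p' P] G.push_add[of x A])
  qed
  then show "\<beta> \<in> push K (G (Suc n)) X x ` val_G (Suc n) X A"
    using \<gamma>12 X Q ob r by (metis G.push_closed G.val_add imageI)
qed

lemma exact_middle: "exact_middle n"
proof (induction n)
  case 0
  show ?case unfolding exact_middle_def using middle_exact_0 by blast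
next
  case (Suc n)
  then show ?case by (intro exact_middle_Suc_if_right exact_right_if_left exact_left_if_middle)
qed

theorem partial_delta_functor: "partial_delta_functor R K E s G conn"
proof (rule partial_delta_functor.intro)
  fix C A \<delta> x B y X
  assume ob: "C \<in> Ob K" "A \<in> Ob K" "\<delta> \<in> Ext C A" and tri: "(x, B, y) \<in> s C A \<delta>" and X: "X \<in> Ob K"
  note t = real_seq[OF tri ob]
  have left: "exact_left n" and middle: "exact_middle n" and right: "exact_right n" for n
    by (intro exact_middle exact_right_if_left exact_left_if_middle)+
  note exact = left[unfolded exact_left_def, rule_format, OF ob tri X]
    middle[unfolded exact_middle_def, rule_format, OF ob tri X]
    right[unfolded exact_right_def, rule_format, OF ob tri X]
  fix n
  have "exact_at (val (G (Suc n)) X C) (conn n C A \<delta> X) (val (G n) X A) (push K (G n) X x) (val (G n) X B)"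
    unfolding exact_at_def using exact(1)[of _ n] push_conn[OF tri ob X, of _ n] X ob by (blast intro: conn_closed)
  moreover have "exact_at (val (G n) X A) (push K (G n) X x) (val (G n) X B) (push K (G n) X y) (val (G n) X C)"
    unfolding exact_at_def using exact(2)[of _ n] push_push_conflation[OF tri ob X, of _ n] X ob t
    by (blast intro: G.push_closed)
  moreover have "exact_at (val (G (Suc n)) X B) (push K (G (Suc n)) X y) (val (G (Suc n)) X C)
      (conn n C A \<delta> X) (val (G n) X A)"
    unfolding exact_at_def using exact(3)[of _ n] conn_push_deflation[OF tri ob X, of _ n] X ob t
    by (blast intro: G.push_closed)
  ultimately show "exact_at (val (G (Suc n)) X C) (conn n C A \<delta> X) (val (G n) X A) (push K (G n) X x) (val (G n) X B)
        \<and> exact_at (val (G n) X A) (push K (G n) X x) (val (G n) X B) (push K (G n) X y) (val (G n) X C)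
        \<and> exact_at (val (G (Suc n)) X B) (push K (G (Suc n)) X y) (val (G (Suc n)) X C)
            (conn n C A \<delta> X) (val (G n) X A)"
    by blast
qed (rule terms, erule (2) conn_morphism, erule (8) conn_natural)

end

section \<open>Universality of effaceable connected sequences\<close>

lemma bifun_trans_linear: "\<lbrakk>\<phi> \<in> bifun_trans R K F G; C \<in> Ob K; A \<in> Ob K\<rbrakk>
    \<Longrightarrow> \<phi> C A \<in> lin_maps R (val F C A) (val G C A)"
  by (auto simp: bifun_trans_def)

lemma bifun_trans_act: "\<lbrakk>\<phi> \<in> bifun_trans R K F G; u \<in> carrier (val F C A); c \<in> arr K C' C; a \<in> arr K A A';
      C \<in> Ob K; A \<in> Ob K; C' \<in> Ob K; A' \<in> Ob K\<rbrakk>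
    \<Longrightarrow> \<phi> C' A' (act F c a u) = act G c a (\<phi> C A u)"
  by (auto simp: bifun_trans_def)

context linear_category
begin

lemma bifun_trans_push: "\<lbrakk>\<phi> \<in> bifun_trans R K F G; u \<in> carrier (val F C A); a \<in> arr K A A';
      C \<in> Ob K; A \<in> Ob K; A' \<in> Ob K\<rbrakk>
    \<Longrightarrow> \<phi> C A' (push K F C a u) = push K G C a (\<phi> C A u)"
  unfolding push_def by (rule bifun_trans_act) simp_all

lemma bifun_trans_pull: "\<lbrakk>\<phi> \<in> bifun_trans R K F G; u \<in> carrier (val F C A); c \<in> arr K C' C;
      C \<in> Ob K; A \<in> Ob K; C' \<in> Ob K\<rbrakk>
    \<Longrightarrow> \<phi> C' A (pull K F A c u) = pull K G A c (\<phi> C A u)"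
  unfolding pull_def by (rule bifun_trans_act) simp_all

lemma bifun_transI:
  assumes F: "bilinear_functor R K F" and G: "bilinear_functor R K G"
    and ext: "\<phi> \<in> extensional (Ob K)" "\<And>C. C \<in> Ob K \<Longrightarrow> \<phi> C \<in> extensional (Ob K)"
    and lin: "\<And>C A. \<lbrakk>C \<in> Ob K; A \<in> Ob K\<rbrakk> \<Longrightarrow> \<phi> C A \<in> lin_maps R (val F C A) (val G C A)"
    and push: "\<And>C A A' a u. \<lbrakk>C \<in> Ob K; A \<in> Ob K; A' \<in> Ob K; a \<in> arr K A A'; u \<in> carrier (val F C A)\<rbrakk>
      \<Longrightarrow> \<phi> C A' (push K F C a u) = push K G C a (\<phi> C A u)"
    and pull: "\<And>C C' A c u. \<lbrakk>C \<in> Ob K; C' \<in> Ob K; A \<in> Ob K; c \<in> arr K C' C; u \<in> carrier (val F C A)\<rbrakk>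
      \<Longrightarrow> \<phi> C' A (pull K F A c u) = pull K G A c (\<phi> C A u)"
  shows "\<phi> \<in> bifun_trans R K F G"
proof -
  interpret F: bilinear_functor R K F by fact
  interpret G: bilinear_functor R K G by fact
  have "\<phi> C' A' (act F c a u) = act G c a (\<phi> C A u)"
    if "C \<in> Ob K" "A \<in> Ob K" "C' \<in> Ob K" "A' \<in> Ob K" "c \<in> arr K C' C" "a \<in> arr K A A'" "u \<in> carrier (val F C A)"
    for C A C' A' c a u
    using that lin_maps_closed[OF lin[OF that(1,2)] that(7)]
    by (simp add: F.act_push_pull[of u C A] G.act_push_pull[of _ C A] push[of C' A] pull[of C C'])
  then show ?thesis
    using ext lin by (auto simp: bifun_trans_def PiE_def)
qed

end

lemma bifun_trans_eqI:
  assumes "\<phi> \<in> bifun_trans R K F G" "\<psi> \<in> bifun_trans R K F G"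
    and "\<And>C A u. \<lbrakk>C \<in> Ob K; A \<in> Ob K; u \<in> carrier (val F C A)\<rbrakk> \<Longrightarrow> \<phi> C A u = \<psi> C A u"
  shows "\<phi> = \<psi>"
proof (intro ext)
  fix C A u
  have PiE: "\<phi> \<in> (\<Pi>\<^sub>E C \<in> Ob K. \<Pi>\<^sub>E A \<in> Ob K. lin_maps R (val F C A) (val G C A))"
    "\<psi> \<in> (\<Pi>\<^sub>E C \<in> Ob K. \<Pi>\<^sub>E A \<in> Ob K. lin_maps R (val F C A) (val G C A))"
    using assms by (auto simp: bifun_trans_def)
  show "\<phi> C A u = \<psi> C A u"
  proof (cases "C \<in> Ob K \<and> A \<in> Ob K")
    case True
    then have "\<phi> C A \<in> extensional (carrier (val F C A))" "\<psi> C A \<in> extensional (carrier (val F C A))"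
      by (auto intro: lin_maps_extensional[OF bifun_trans_linear[OF assms(1)]]
          lin_maps_extensional[OF bifun_trans_linear[OF assms(2)]])
    then show ?thesis
      using True assms(3)[of C A u] by (cases "u \<in> carrier (val F C A)") (auto simp: extensional_def)
  next
    case False
    then show ?thesis
      using PiE by (cases "C \<in> Ob K") (auto simp: PiE_def Pi_def extensional_def)
  qed
qed

context effaceable_sequence
begin

text \<open>
  One step of the comparison with another connected sequence \<open>H\<close>. The value at \<open>u \<in> H (Suc n) X C\<close>
  is required to be compatible with all extensions \<open>\<delta> \<in> E(C, A)\<close>. One extension \<open>\<kappa>\<close> with projective
  deflation determines it, by injectivity of \<open>\<kappa>\<^sub>\<sharp>\<close>; and compatibility with \<open>\<kappa>\<close> implies compatibility
  with all others, since they are pushouts of \<open>\<kappa>\<close>.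
\<close>

lemma comparison_ex1:
  assumes H: "connected_sequence R K E s H conn'" and f: "f \<in> bifun_trans R K (H n) (G n)"
    and X: "X \<in> Ob K" "C \<in> Ob K" and u: "u \<in> carrier (val (H (Suc n)) X C)"
  shows "\<exists>!v. v \<in> val_G (Suc n) X C \<and>
    (\<forall>A \<in> Ob K. \<forall>\<delta> \<in> Ext C A. conn n C A \<delta> X v = f X A (conn' n C A \<delta> X u))"
proof -
  interpret H: connected_sequence R K E s H conn' by fact
  obtain k P g N \<kappa> where proj: "(k, P, g) \<in> s C N \<kappa>" "projective_morphism K E P C g" "N \<in> Ob K" "\<kappa> \<in> Ext C N"
    using projective_conflation X by blast
  note p = real_seq[OF proj(1) X(2) proj(3,4)]
  have f_closed: "w \<in> carrier (val (H n) X A) \<Longrightarrow> f X A w \<in> val_G n X A" if "A \<in> Ob K" for A w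
    using bifun_trans_linear[OF f X(1) that] lin_maps_closed by metis
  have "push K (G n) X k (f X N (conn' n C N \<kappa> X u)) = f X P (push K (H n) X k (conn' n C N \<kappa> X u))"
    using X proj p u by (intro bifun_trans_push[symmetric, OF f]) auto
  also have "\<dots> = f X P \<zero>\<^bsub>val (H n) X P\<^esub>"
    using H.push_conn[OF proj(1) X(2) proj(3,4) X(1) u] by simp
  also have "\<dots> = \<zero>\<^bsub>val (G n) X P\<^esub>"
    by (rule lin_maps_zero[OF H.G.val_module G.val_module bifun_trans_linear[OF f]]) (use X p in auto)
  finally obtain v where v: "v \<in> val_G (Suc n) X C" "conn n C N \<kappa> X v = f X N (conn' n C N \<kappa> X u)"
    using conn_surj[OF proj(1,2) X(2) proj(3,4) X(1), of "f X N (conn' n C N \<kappa> X u)" n] f_closed X proj u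
    by fastforce
  have "conn n C A \<delta> X v = f X A (conn' n C A \<delta> X u)" if A: "A \<in> Ob K" and \<delta>: "\<delta> \<in> Ext C A" for A \<delta>
  proof -
    have "pull K E A g \<delta> = \<zero>\<^bsub>val E P A\<^esub>"
      using proj(2) A \<delta> by (auto simp: projective_morphism_def)
    then obtain a where a: "a \<in> arr K N A" "push K E C a \<kappa> = \<delta>"
      using ext_is_pushout[OF proj(1) X(2) proj(3,4) \<delta> A] by blast
    have "conn n C A \<delta> X v = push K (G n) X a (f X N (conn' n C N \<kappa> X u))"
      using conn_push[OF v(1) a(1) proj(4)] v a proj A X by simp
    also have "\<dots> = f X A (push K (H n) X a (conn' n C N \<kappa> X u))"
      using bifun_trans_push[OF f, of "conn' n C N \<kappa> X u" X N a A] X u proj a A by simp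
    also have "\<dots> = f X A (conn' n C A \<delta> X u)"
      using H.conn_push[OF u a(1) proj(4)] a proj A X by simp
    finally show ?thesis .
  qed
  moreover have "v' = v" if "v' \<in> val_G (Suc n) X C" "conn n C N \<kappa> X v' = f X N (conn' n C N \<kappa> X u)" for v'
    using conn_inj[OF proj(1,2) X(2) proj(3,4) X(1), of n] v that by (auto simp: inj_on_def)
  ultimately show ?thesis
    by (intro ex1I[of _ v]) (use v(1) proj(3,4) in blast)+
qed

definition comparison :: "(nat \<Rightarrow> ('r, 'o, 'm, 'h) bifun)
    \<Rightarrow> (nat \<Rightarrow> 'o \<Rightarrow> 'o \<Rightarrow> 'e \<Rightarrow> 'o \<Rightarrow> 'h \<Rightarrow> 'h) \<Rightarrow> nat
    \<Rightarrow> ('o \<Rightarrow> 'o \<Rightarrow> 'h \<Rightarrow> 'g) \<Rightarrow> 'o \<Rightarrow> 'o \<Rightarrow> 'h \<Rightarrow> 'g"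
  where "comparison H conn' n f = (\<lambda>X \<in> Ob K. \<lambda>C \<in> Ob K. \<lambda>u \<in> carrier (val (H (Suc n)) X C).
     THE v. v \<in> val_G (Suc n) X C \<and>
       (\<forall>A \<in> Ob K. \<forall>\<delta> \<in> Ext C A. conn n C A \<delta> X v = f X A (conn' n C A \<delta> X u)))"

lemma
  assumes H: "connected_sequence R K E s H conn'" and f: "f \<in> bifun_trans R K (H n) (G n)"
    and X: "X \<in> Ob K" "C \<in> Ob K" and u: "u \<in> carrier (val (H (Suc n)) X C)"
  shows comparison_closed: "comparison H conn' n f X C u \<in> val_G (Suc n) X C"
    and conn_comparison: "\<lbrakk>A \<in> Ob K; \<delta> \<in> Ext C A\<rbrakk>
      \<Longrightarrow> conn n C A \<delta> X (comparison H conn' n f X C u) = f X A (conn' n C A \<delta> X u)"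
    and comparison_eqI: "\<lbrakk>v \<in> val_G (Suc n) X C;
        \<And>A \<delta>. \<lbrakk>A \<in> Ob K; \<delta> \<in> Ext C A\<rbrakk> \<Longrightarrow> conn n C A \<delta> X v = f X A (conn' n C A \<delta> X u)\<rbrakk>
      \<Longrightarrow> comparison H conn' n f X C u = v"
proof -
  note ex1 = comparison_ex1[OF H f X u]
  have *: "comparison H conn' n f X C u = (THE v. v \<in> val_G (Suc n) X C \<and>
      (\<forall>A \<in> Ob K. \<forall>\<delta> \<in> Ext C A. conn n C A \<delta> X v = f X A (conn' n C A \<delta> X u)))"
    using X u by (simp add: comparison_def)
  show "comparison H conn' n f X C u \<in> val_G (Suc n) X C"
    using theI'[OF ex1] unfolding * by blast
  show "\<lbrakk>A \<in> Ob K; \<delta> \<in> Ext C A\<rbrakk>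
      \<Longrightarrow> conn n C A \<delta> X (comparison H conn' n f X C u) = f X A (conn' n C A \<delta> X u)"
    using theI'[OF ex1] unfolding * by blast
  show "\<lbrakk>v \<in> val_G (Suc n) X C;
        \<And>A \<delta>. \<lbrakk>A \<in> Ob K; \<delta> \<in> Ext C A\<rbrakk> \<Longrightarrow> conn n C A \<delta> X v = f X A (conn' n C A \<delta> X u)\<rbrakk>
      \<Longrightarrow> comparison H conn' n f X C u = v"
    unfolding * by (rule the1_equality[OF ex1]) blast
qed

text \<open>
  Linearity and naturality follow from uniqueness: applying \<open>\<delta>\<^sub>\<sharp>\<close> to either side of the required equation
  gives the same result, because \<open>f\<close> and both families of connecting maps are linear and natural.
\<close>

lemma comparison_trans:
  assumes H: "connected_sequence R K E s H conn'" and f: "f \<in> bifun_trans R K (H n) (G n)"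
  shows "comparison H conn' n f \<in> bifun_trans R K (H (Suc n)) (G (Suc n))"
proof -
  interpret H: connected_sequence R K E s H conn' by fact
  note closed = comparison_closed[OF H f] and conn_c = conn_comparison[OF H f] and eqI = comparison_eqI[OF H f]
  note f_lin = bifun_trans_linear[OF f]
  show ?thesis
  proof (rule bifun_transI[OF H.terms terms])
    fix X C assume X: "X \<in> Ob K" "C \<in> Ob K"
    have "(\<lambda>u \<in> carrier (val (H (Suc n)) X C). comparison H conn' n f X C u)
        \<in> lin_maps R (val (H (Suc n)) X C) (val (G (Suc n)) X C)"
    proof (rule restrict_in_lin_maps)
      show "module R (val (H (Suc n)) X C)" using X by (rule H.G.val_module)
    next
      fix u v assume uv: "u \<in> H.val_G (Suc n) X C" "v \<in> H.val_G (Suc n) X C"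
      show "comparison H conn' n f X C (u \<oplus>\<^bsub>val (H (Suc n)) X C\<^esub> v)
          = comparison H conn' n f X C u \<oplus>\<^bsub>val (G (Suc n)) X C\<^esub> comparison H conn' n f X C v"
        using X uv
        by (intro eqI)
          (simp_all add: closed conn_add conn_c H.conn_add lin_maps_add[OF f_lin])
    next
      fix r u assume "r \<in> carrier R" and u: "u \<in> H.val_G (Suc n) X C"
      then show "comparison H conn' n f X C (r \<odot>\<^bsub>val (H (Suc n)) X C\<^esub> u)
          = r \<odot>\<^bsub>val (G (Suc n)) X C\<^esub> comparison H conn' n f X C u"
        using X
        by (intro eqI) (simp_all add: closed conn_smult conn_c H.conn_smult lin_maps_smult[OF f_lin])
    qed (use X closed in auto)
    moreover have "(\<lambda>u \<in> carrier (val (H (Suc n)) X C). comparison H conn' n f X C u) = comparison H conn' n f X C"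
      using X by (auto simp: comparison_def)
    ultimately show "comparison H conn' n f X C \<in> lin_maps R (val (H (Suc n)) X C) (val (G (Suc n)) X C)"
      by simp
  next
    fix X C C' c u
    assume *: "X \<in> Ob K" "C \<in> Ob K" "C' \<in> Ob K" "c \<in> arr K C C'" "u \<in> H.val_G (Suc n) X C"
    have "conn n C' A \<delta> X (push K (G (Suc n)) X c (comparison H conn' n f X C u))
        = f X A (conn' n C' A \<delta> X (push K (H (Suc n)) X c u))" if "A \<in> Ob K" "\<delta> \<in> Ext C' A" for A \<delta>
    proof -
      have "conn n C' A \<delta> X (push K (G (Suc n)) X c (comparison H conn' n f X C u))
          = conn n C A (pull K E A c \<delta>) X (comparison H conn' n f X C u)"
        using * that closed[of X C u] by (simp add: conn_pull[of _ n X C c C'])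
      also have "\<dots> = f X A (conn' n C A (pull K E A c \<delta>) X u)"
        using * that by (simp add: conn_c)
      also have "\<dots> = f X A (conn' n C' A \<delta> X (push K (H (Suc n)) X c u))"
        using * that by (simp add: H.conn_pull[of _ n X C c C'])
      finally show ?thesis .
    qed
    then show "comparison H conn' n f X C' (push K (H (Suc n)) X c u)
        = push K (G (Suc n)) X c (comparison H conn' n f X C u)"
      using * closed[of X C u] by (intro eqI) auto
  next
    fix X X' C c u
    assume *: "X \<in> Ob K" "X' \<in> Ob K" "C \<in> Ob K" "c \<in> arr K X' X" "u \<in> H.val_G (Suc n) X C"
    have "conn n C A \<delta> X' (pull K (G (Suc n)) C c (comparison H conn' n f X C u))
        = f X' A (conn' n C A \<delta> X' (pull K (H (Suc n)) C c u))" if "A \<in> Ob K" "\<delta> \<in> Ext C A" for A \<delta>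
      using * that closed[of X C u]
      by (simp add: conn_pull_arg[of _ n X C] H.conn_pull_arg[of _ n X C] conn_c bifun_trans_pull[OF f, of _ X A])
    then show "comparison H conn' n f X' C (pull K (H (Suc n)) C c u)
        = pull K (G (Suc n)) C c (comparison H conn' n f X C u)"
      using * closed[of X C u] by (intro eqI) auto
  qed (auto simp: comparison_def)
qed

theorem universal:
  fixes H :: "nat \<Rightarrow> ('r, 'o, 'm, 'h) bifun"
  assumes H: "connected_sequence R K E s H conn'"
    and \<theta>: "\<theta> \<in> bifun_iso R K (H 0) (hom_bifun K)" and \<theta>': "\<theta>' \<in> bifun_iso R K (G 0) (hom_bifun K)"
  shows "\<exists>!\<phi>. delta_morphism R K E H conn' \<theta> G conn \<theta>' \<phi>"
proof -
  interpret H: connected_sequence R K E s H conn' by fact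
  have \<theta>_tr: "\<theta> \<in> bifun_trans R K (H 0) (hom_bifun K)" "\<theta>' \<in> bifun_trans R K (G 0) (hom_bifun K)"
    and \<theta>'_bij: "\<And>C A. \<lbrakk>C \<in> Ob K; A \<in> Ob K\<rbrakk> \<Longrightarrow> bij_betw (\<theta>' C A) (val_G 0 C A) (arr K C A)"
    using \<theta> \<theta>' by (auto simp: bifun_iso_def)
  have \<theta>_closed: "\<theta> C A u \<in> arr K C A" if "C \<in> Ob K" "A \<in> Ob K" "u \<in> H.val_G 0 C A" for C A u
    using lin_maps_closed[OF bifun_trans_linear[OF \<theta>_tr(1) that(1,2)] that(3)] by simp
  define \<phi>0 where "\<phi>0 = (\<lambda>C \<in> Ob K. \<lambda>A \<in> Ob K. \<lambda>u \<in> H.val_G 0 C A. the_inv_into (val_G 0 C A) (\<theta>' C A) (\<theta> C A u))"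
  have \<phi>0_closed: "\<phi>0 C A u \<in> val_G 0 C A" and \<phi>0: "\<theta>' C A (\<phi>0 C A u) = \<theta> C A u"
    if "C \<in> Ob K" "A \<in> Ob K" "u \<in> H.val_G 0 C A" for C A u
    using \<theta>'_bij[OF that(1,2)] \<theta>_closed[OF that] that unfolding \<phi>0_def
    by (auto simp: f_the_inv_into_f_bij_betw bij_betw_def intro: the_inv_into_into)
  have eqI0: "u = v" if "\<theta>' C A u = \<theta>' C A v" "u \<in> val_G 0 C A" "v \<in> val_G 0 C A" "C \<in> Ob K" "A \<in> Ob K" for C A u v
    using \<theta>'_bij[OF that(4,5)] that by (auto simp: bij_betw_def inj_on_def)
  have \<phi>0_trans: "\<phi>0 \<in> bifun_trans R K (H 0) (G 0)"
  proof (rule bifun_transI[OF H.terms terms])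
    fix C A assume X: "C \<in> Ob K" "A \<in> Ob K"
    have "(\<lambda>u \<in> H.val_G 0 C A. \<phi>0 C A u) \<in> lin_maps R (val (H 0) C A) (val (G 0) C A)"
      by (rule restrict_in_lin_maps)
        (use X in \<open>auto intro!: H.G.val_module eqI0[OF _ _ _ X] simp: \<phi>0_closed \<phi>0 lin_maps_add[OF bifun_trans_linear[OF \<theta>_tr(1)]]
          lin_maps_add[OF bifun_trans_linear[OF \<theta>_tr(2)]] lin_maps_smult[OF bifun_trans_linear[OF \<theta>_tr(1)]]
          lin_maps_smult[OF bifun_trans_linear[OF \<theta>_tr(2)]]\<close>)
    moreover have "(\<lambda>u \<in> H.val_G 0 C A. \<phi>0 C A u) = \<phi>0 C A"
      using X by (auto simp: \<phi>0_def)
    ultimately show "\<phi>0 C A \<in> lin_maps R (val (H 0) C A) (val (G 0) C A)" by simp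
  next
    fix C A A' a u assume "C \<in> Ob K" "A \<in> Ob K" "A' \<in> Ob K" "a \<in> arr K A A'" "u \<in> H.val_G 0 C A"
    then show "\<phi>0 C A' (push K (H 0) C a u) = push K (G 0) C a (\<phi>0 C A u)"
      using \<phi>0_closed[of C A u]
      by (intro eqI0[of C A']) (auto simp: \<phi>0_closed \<phi>0 bifun_trans_push[OF \<theta>_tr(1), of u C A] bifun_trans_push[OF \<theta>_tr(2), of _ C A]
        G.push_closed[of "\<phi>0 C A u" 0 C A])
  next
    fix C C' A c u assume "C \<in> Ob K" "C' \<in> Ob K" "A \<in> Ob K" "c \<in> arr K C' C" "u \<in> H.val_G 0 C A"
    then show "\<phi>0 C' A (pull K (H 0) A c u) = pull K (G 0) A c (\<phi>0 C A u)"
      using \<phi>0_closed[of C A u]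
      by (intro eqI0[of C' A]) (auto simp: \<phi>0_closed \<phi>0 bifun_trans_pull[OF \<theta>_tr(1), of u C A] bifun_trans_pull[OF \<theta>_tr(2), of _ C A]
        G.pull_closed[of "\<phi>0 C A u" 0 C A])
  qed (auto simp: \<phi>0_def)
  define \<phi> where "\<phi> = rec_nat \<phi>0 (\<lambda>n. comparison H conn' n)"
  have \<phi>_trans: "\<phi> n \<in> bifun_trans R K (H n) (G n)" for n
    by (induction n) (auto simp: \<phi>_def \<phi>0_trans intro: comparison_trans[OF H])
  have \<phi>_Suc: "\<phi> (Suc n) = comparison H conn' n (\<phi> n)" for n
    by (simp add: \<phi>_def)
  show ?thesis
  proof (intro ex1I)
    show "delta_morphism R K E H conn' \<theta> G conn \<theta>' \<phi>"
      unfolding delta_morphism_def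
    proof (intro conjI allI ballI)
      show "\<theta>' X Y (\<phi> 0 X Y u) = \<theta> X Y u" if "X \<in> Ob K" "Y \<in> Ob K" "u \<in> H.val_G 0 X Y" for X Y u
        using \<phi>0[OF that] by (simp add: \<phi>_def)
      show "\<phi> n X A (conn' n C A \<delta> X u) = conn n C A \<delta> X (\<phi> (Suc n) X C u)"
        if "C \<in> Ob K" "A \<in> Ob K" "\<delta> \<in> Ext C A" "X \<in> Ob K" "u \<in> H.val_G (Suc n) X C" for n C A \<delta> X u
        unfolding \<phi>_Suc by (rule conn_comparison[OF H \<phi>_trans that(4,1,5,2,3), symmetric])
    qed (rule \<phi>_trans)
  next
    fix \<psi> assume \<psi>: "delta_morphism R K E H conn' \<theta> G conn \<theta>' \<psi>"
    have \<psi>_trans: "\<psi> n \<in> bifun_trans R K (H n) (G n)" for n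
      using \<psi> by (simp add: delta_morphism_def)
    have \<psi>_conn: "\<psi> n X A (conn' n C A \<delta> X u) = conn n C A \<delta> X (\<psi> (Suc n) X C u)"
      if "C \<in> Ob K" "A \<in> Ob K" "\<delta> \<in> Ext C A" "X \<in> Ob K" "u \<in> H.val_G (Suc n) X C" for C A \<delta> X u n
      using \<psi> that unfolding delta_morphism_def by blast
    have \<psi>_closed: "\<psi> n C A u \<in> val_G n C A" if "C \<in> Ob K" "A \<in> Ob K" "u \<in> H.val_G n C A" for n C A u
      by (rule lin_maps_closed[OF bifun_trans_linear[OF \<psi>_trans that(1,2)] that(3)])
    have "\<psi> n = \<phi> n" for n
    proof (induction n)
      case 0
      show ?case
      proof (rule bifun_trans_eqI[OF \<psi>_trans \<phi>_trans])
        fix C A u assume *: "C \<in> Ob K" "A \<in> Ob K" "u \<in> H.val_G 0 C A"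
        have "\<theta>' C A (\<psi> 0 C A u) = \<theta> C A u"
          using \<psi> * by (simp add: delta_morphism_def)
        then show "\<psi> 0 C A u = \<phi> 0 C A u"
          using * \<psi>_closed[of C A u 0] \<phi>0_closed[of C A u] \<phi>0[of C A u]
          by (intro eqI0[of C A]) (simp_all add: \<phi>_def)
      qed
    next
      case (Suc n)
      show ?case
      proof (rule bifun_trans_eqI[OF \<psi>_trans \<phi>_trans])
        fix X C u assume *: "X \<in> Ob K" "C \<in> Ob K" "u \<in> H.val_G (Suc n) X C"
        have "comparison H conn' n (\<phi> n) X C u = \<psi> (Suc n) X C u"
        proof (rule comparison_eqI[OF H \<phi>_trans *])
          show "\<psi> (Suc n) X C u \<in> val_G (Suc n) X C" using * by (rule \<psi>_closed)
          show "conn n C A \<delta> X (\<psi> (Suc n) X C u) = \<phi> n X A (conn' n C A \<delta> X u)"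
            if "A \<in> Ob K" "\<delta> \<in> Ext C A" for A \<delta>
            using \<psi>_conn[of C A \<delta> X u n] * that Suc by simp
        qed
        then show "\<psi> (Suc n) X C u = \<phi> (Suc n) X C u" by (simp add: \<phi>_Suc)
      qed
    qed
    then show "\<psi> = \<phi>" by (rule ext)
  qed
qed

end

section \<open>Coends and positive extensions\<close>

subsection \<open>Relabelling\<close>

context bilinear_functor
begin

lemma relabel_bilinear:
  assumes h: "inj h"
  shows "bilinear_functor R K (relabel h F)"
proof -
  have inv [simp]: "the_inv h (h u) = u" for u
    using h by (rule the_inv_f_f)
  have v [simp]: "carrier (val (relabel h F) X Y) = h ` carrier (val F X Y)"
    "\<zero>\<^bsub>val (relabel h F) X Y\<^esub> = h \<zero>\<^bsub>val F X Y\<^esub>"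
    "h u \<oplus>\<^bsub>val (relabel h F) X Y\<^esub> h w = h (u \<oplus>\<^bsub>val F X Y\<^esub> w)"
    "r \<odot>\<^bsub>val (relabel h F) X Y\<^esub> h u = h (r \<odot>\<^bsub>val F X Y\<^esub> u)"
    "act (relabel h F) c a (h u) = h (act F c a u)" for X Y u w r c a
    by (simp_all add: relabel_def)
  have mod: "module R (val (relabel h F) X Y)" if "X \<in> Ob K" "Y \<in> Ob K" for X Y
  proof -
    interpret M: module R "val F X Y" using that by (rule val_module)
    have inv: "\<exists>v \<in> carrier (val F X Y). h (v \<oplus>\<^bsub>val F X Y\<^esub> u) = h \<zero>\<^bsub>val F X Y\<^esub>" if "u \<in> carrier (val F X Y)" for u
      using that by (intro bexI[of _ "\<ominus>\<^bsub>val F X Y\<^esub> u"]) (auto simp: M.M.l_neg)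
    show ?thesis
      by (intro moduleI abelian_groupI cring_R)
        (auto simp: M.M.a_assoc M.smult_l_distr M.smult_r_distr M.smult_assoc1 inv
          intro!: arg_cong[of _ _ h] M.M.a_comm)
  qed
  show ?thesis
  proof (rule bilinear_functorI[OF mod])
    fix C A C' A' c a
    assume *: "C \<in> Ob K" "A \<in> Ob K" "C' \<in> Ob K" "A' \<in> Ob K" "c \<in> arr K C' C" "a \<in> arr K A A'"
    show "(\<lambda>u \<in> carrier (val (relabel h F) C A). act (relabel h F) c a u)
        \<in> lin_maps R (val (relabel h F) C A) (val (relabel h F) C' A')"
      using * by (intro restrict_in_lin_maps mod)
        (auto simp: act_add[of _ C A] act_smult[of _ C A] intro!: imageI act_closed[of _ C A])
  qed (auto simp: act_ident act_cmp act_add_contra act_smult_contra act_add_cov act_smult_cov)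
qed

end

lemma push_relabel: "inj h \<Longrightarrow> push K (relabel h F) C a (h u) = h (push K F C a u)"
  and pull_relabel: "inj h \<Longrightarrow> pull K (relabel h F) A c (h u) = h (pull K F A c u)"
  by (simp_all add: push_def pull_def relabel_def the_inv_f_f)

lemma carrier_relabel [simp]: "carrier (val (relabel h F) X Y) = h ` carrier (val F X Y)"
  by (simp add: relabel_def)

lemma add_relabel: "inj h \<Longrightarrow> h u \<oplus>\<^bsub>val (relabel h F) X Y\<^esub> h w = h (u \<oplus>\<^bsub>val F X Y\<^esub> w)"
  and smult_relabel: "inj h \<Longrightarrow> r \<odot>\<^bsub>val (relabel h F) X Y\<^esub> h u = h (r \<odot>\<^bsub>val F X Y\<^esub> u)"
  by (simp_all add: relabel_def the_inv_f_f)

subsection \<open>The coend of two bilinear functors\<close>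

locale bilinear_pair = F: bilinear_functor R K F + G: bilinear_functor R K G
  for R :: "('r, 'z) ring_scheme" and K :: "('r, 'o, 'm) lincat"
    and F :: "('r, 'o, 'm, 'x) bifun" and G :: "('r, 'o, 'm, 'y) bifun"
begin

abbreviation FG :: "('r, 'o, 'm, ('o \<times> 'x \<times> 'y) list) bifun"
  where "FG \<equiv> coend R K F G"

abbreviation sums :: "'o \<Rightarrow> 'o \<Rightarrow> ('o \<times> 'x \<times> 'y) list set"
  where "sums \<equiv> coend_sums K F G"

abbreviation sum_eq :: "'o \<Rightarrow> 'o \<Rightarrow> ('o \<times> 'x \<times> 'y) list \<Rightarrow> ('o \<times> 'x \<times> 'y) list \<Rightarrow> bool"
  where "sum_eq \<equiv> coend_eq R K F G"

abbreviation cls :: "'o \<Rightarrow> 'o \<Rightarrow> ('o \<times> 'x \<times> 'y) list \<Rightarrow> ('o \<times> 'x \<times> 'y) list"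
  where "cls \<equiv> coend_class R K F G"

lemma sums_Nil [simp]: "[] \<in> sums X Y"
  and sums_Cons [simp]: "(M, \<rho>, l) # ts \<in> sums X Y \<longleftrightarrow>
    M \<in> Ob K \<and> \<rho> \<in> carrier (val F M Y) \<and> l \<in> carrier (val G X M) \<and> ts \<in> sums X Y"
  and sums_append [simp]: "ts @ us \<in> sums X Y \<longleftrightarrow> ts \<in> sums X Y \<and> us \<in> sums X Y"
  by (auto simp: coend_sums_def)

lemma sumsD: "\<lbrakk>ts \<in> sums X Y; (M, \<rho>, l) \<in> set ts\<rbrakk>
    \<Longrightarrow> M \<in> Ob K \<and> \<rho> \<in> carrier (val F M Y) \<and> l \<in> carrier (val G X M)"
  by (auto simp: coend_sums_def)

lemma sum_eq_sums:
  assumes "sum_eq X Y ts us" "X \<in> Ob K" "Y \<in> Ob K"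
  shows "ts \<in> sums X Y \<and> us \<in> sums X Y"
  using assms by (induction rule: coend_eq.induct) simp_all

lemma cls_eq: "ts \<in> sums X Y \<Longrightarrow> sum_eq X Y ts (cls X Y ts)"
  unfolding coend_class_def by (rule someI[of _ ts]) (rule coend_eq.refl)

lemma cls_cong:
  assumes "sum_eq X Y ts us"
  shows "cls X Y ts = cls X Y us"
proof -
  have "sum_eq X Y ts vs \<longleftrightarrow> sum_eq X Y us vs" for vs
    using coend_eq.trans[OF assms] coend_eq.trans[OF coend_eq.sym[OF assms]] by blast
  then have "sum_eq X Y ts = sum_eq X Y us" by (rule ext)
  then show ?thesis unfolding coend_class_def by simp
qed

lemma sum_eq_if_cls:
  assumes eq: "cls X Y ts = cls X Y us" and ts: "ts \<in> sums X Y" and us: "us \<in> sums X Y"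
  shows "sum_eq X Y ts us"
  by (rule coend_eq.trans[OF cls_eq[OF ts] coend_eq.sym[OF cls_eq[OF us, folded eq]]])

lemma sum_eq_map:
  "(\<And>t. t \<in> set ts \<Longrightarrow> sum_eq X Y [f t] [g t]) \<Longrightarrow> sum_eq X Y (map f ts) (map g ts)"
proof (induction ts)
  case Nil
  show ?case by (simp add: coend_eq.refl)
next
  case (Cons t ts)
  then show ?case
    using coend_eq.append[of R K F G X Y "[f t]" "[g t]" "map f ts" "map g ts"] by simp
qed

lemma sum_eq_map_Nil:
  "(\<And>t. t \<in> set ts \<Longrightarrow> sum_eq X Y [f t] []) \<Longrightarrow> sum_eq X Y (map f ts) []"
proof (induction ts)
  case Nil
  show ?case by (simp add: coend_eq.refl)
next
  case (Cons t ts)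
  then show ?case
    using coend_eq.append[of R K F G X Y "[f t]" "[]" "map f ts" "[]"] by simp
qed

lemma sum_eq_map_append:
  assumes "X \<in> Ob K" "Y \<in> Ob K"
  shows "(\<And>t. t \<in> set ts \<Longrightarrow> sum_eq X Y [f t] [g t, g' t]) \<Longrightarrow> sum_eq X Y (map f ts) (map g ts @ map g' ts)"
proof (induction ts)
  case Nil
  show ?case by (simp add: coend_eq.refl)
next
  case (Cons t ts)
  then have 1: "sum_eq X Y (map f ts) (map g ts @ map g' ts)" and 2: "sum_eq X Y [f t] [g t, g' t]"
    by simp_all
  have S: "map g ts \<in> sums X Y" "map g' ts \<in> sums X Y" "[g t] \<in> sums X Y" "[g' t] \<in> sums X Y"
    using sum_eq_sums[OF 1 assms] sum_eq_sums[OF 2 assms] sums_append[of "[g t]" "[g' t]" X Y] by auto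
  have "sum_eq X Y ([g' t] @ map g ts) (map g ts @ [g' t])"
    using S by (intro coend_eq.commute)
  then have "sum_eq X Y ([g t] @ ([g' t] @ map g ts) @ map g' ts) ([g t] @ (map g ts @ [g' t]) @ map g' ts)"
    by (rule coend_eq.append[OF coend_eq.refl[OF S(3)] coend_eq.append[OF _ coend_eq.refl[OF S(2)]]])
  moreover have "sum_eq X Y ([f t] @ map f ts) ([g t, g' t] @ (map g ts @ map g' ts))"
    by (rule coend_eq.append[OF 2 1])
  ultimately show ?case
    using coend_eq.trans by fastforce
qed

text \<open>
  Two cases are needed: scalar multiplication, where \<open>h\<close> scales and \<open>j\<close> is the identity, and the action of
  morphisms, where \<open>h = a\<^sub>*\<close> and \<open>j = c\<^sup>*\<close>.
\<close>

lemma sum_eq_functorial: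
  assumes "sum_eq X Y ts us" and X: "X \<in> Ob K" "Y \<in> Ob K" "X' \<in> Ob K" "Y' \<in> Ob K"
    and h: "\<And>M. M \<in> Ob K \<Longrightarrow> (\<lambda>\<rho> \<in> carrier (val F M Y). h M \<rho>) \<in> lin_maps R (val F M Y) (val F M Y')"
    and j: "\<And>M. M \<in> Ob K \<Longrightarrow> (\<lambda>l \<in> carrier (val G X M). j M l) \<in> lin_maps R (val G X M) (val G X' M)"
    and h_nat: "\<And>M M' f \<rho>. \<lbrakk>M \<in> Ob K; M' \<in> Ob K; f \<in> arr K M M'; \<rho> \<in> carrier (val F M' Y)\<rbrakk>
      \<Longrightarrow> h M (pull K F Y f \<rho>) = pull K F Y' f (h M' \<rho>)"
    and j_nat: "\<And>M M' f l. \<lbrakk>M \<in> Ob K; M' \<in> Ob K; f \<in> arr K M M'; l \<in> carrier (val G X M)\<rbrakk>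
      \<Longrightarrow> j M' (push K G X f l) = push K G X' f (j M l)"
  shows "sum_eq X' Y' (map (\<lambda>(M, \<rho>, l). (M, h M \<rho>, j M l)) ts) (map (\<lambda>(M, \<rho>, l). (M, h M \<rho>, j M l)) us)"
proof -
  let ?m = "map (\<lambda>(M, \<rho>, l). (M, h M \<rho>, j M l))"
  have h_in: "h M \<rho> \<in> carrier (val F M Y')" if "M \<in> Ob K" "\<rho> \<in> carrier (val F M Y)" for M \<rho>
    by (rule restrict_lin_maps_closed[OF h]) (use that in auto)
  have j_in: "j M l \<in> carrier (val G X' M)" if "M \<in> Ob K" "l \<in> carrier (val G X M)" for M l
    by (rule restrict_lin_maps_closed[OF j]) (use that in auto)
  have m_in: "?m ts \<in> sums X' Y'" if "ts \<in> sums X Y" for ts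
    using that by (induction ts) (auto simp: h_in j_in)
  note hl = restrict_lin_maps_add[OF h F.val_module] restrict_lin_maps_smult[OF h F.val_module]
    restrict_lin_maps_zero[OF h F.val_module F.val_module]
  note jl = restrict_lin_maps_add[OF j G.val_module] restrict_lin_maps_smult[OF j G.val_module]
  show ?thesis
    using assms(1)
  proof (induction rule: coend_eq.induct)
    case (refl ts)
    then show ?case by (intro coend_eq.refl m_in)
  next
    case (sym ts us)
    then show ?case by (rule_tac coend_eq.sym)
  next
    case (trans ts us vs)
    then show ?case by (blast intro: coend_eq.trans)
  next
    case (append ts ts' us us')
    then show ?case by (simp add: coend_eq.append)
  next
    case (commute ts us)
    then show ?case by (simp add: coend_eq.commute m_in)
  next
    case (zero M l)
    then show ?case using X by (simp add: hl coend_eq.zero j_in)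
  next
    case (add_left M \<rho> \<rho>' l)
    then show ?case using X by (simp add: hl coend_eq.add_left h_in j_in)
  next
    case (add_right M \<rho> l l')
    then show ?case using X by (simp add: jl coend_eq.add_right h_in j_in)
  next
    case (balanced M r \<rho> l)
    then show ?case using X by (simp add: hl jl coend_eq.balanced h_in j_in)
  next
    case (dinatural M M' f \<rho> l)
    then show ?case
      using X by (simp add: h_nat[of M M'] j_nat[of M M'] coend_eq.dinatural h_in j_in)
  qed
qed

definition smult_sum :: "'o \<Rightarrow> 'r \<Rightarrow> ('o \<times> 'x \<times> 'y) list \<Rightarrow> ('o \<times> 'x \<times> 'y) list"
  where "smult_sum Y r ts = map (\<lambda>(M, \<rho>, l). (M, r \<odot>\<^bsub>val F M Y\<^esub> \<rho>, l)) ts"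

definition act_sum :: "'m \<Rightarrow> 'm \<Rightarrow> ('o \<times> 'x \<times> 'y) list \<Rightarrow> ('o \<times> 'x \<times> 'y) list"
  where "act_sum c a ts = map (\<lambda>(M, \<rho>, l). (M, push K F M a \<rho>, pull K G M c l)) ts"

lemma smult_sum_append [simp]: "smult_sum Y r (ts @ us) = smult_sum Y r ts @ smult_sum Y r us"
  and act_sum_append [simp]: "act_sum c a (ts @ us) = act_sum c a ts @ act_sum c a us"
  by (simp_all add: smult_sum_def act_sum_def)

lemma smult_sum_eq:
  assumes "sum_eq X Y ts us" "X \<in> Ob K" "Y \<in> Ob K" "r \<in> carrier R"
  shows "sum_eq X Y (smult_sum Y r ts) (smult_sum Y r us)"
  unfolding smult_sum_def
proof (rule sum_eq_functorial[OF assms(1-3,2-3), where h = "\<lambda>M \<rho>. r \<odot>\<^bsub>val F M Y\<^esub> \<rho>" and j = "\<lambda>M l. l"])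
  fix M assume M: "M \<in> Ob K"
  interpret M: module R "val F M Y" using M assms by (intro F.val_module)
  show "(\<lambda>\<rho> \<in> carrier (val F M Y). r \<odot>\<^bsub>val F M Y\<^esub> \<rho>) \<in> lin_maps R (val F M Y) (val F M Y)"
    using assms by (intro restrict_in_lin_maps M.module_axioms)
      (auto simp: M.smult_r_distr M.smult_assoc1[symmetric] M.R.m_comm)
  show "(\<lambda>l \<in> carrier (val G X M). l) \<in> lin_maps R (val G X M) (val G X M)"
    using assms M by (intro restrict_in_lin_maps G.val_module) auto
next
  show "r \<odot>\<^bsub>val F M Y\<^esub> pull K F Y f \<rho> = pull K F Y f (r \<odot>\<^bsub>val F M' Y\<^esub> \<rho>)"
    if "M \<in> Ob K" "M' \<in> Ob K" "f \<in> arr K M M'" "\<rho> \<in> carrier (val F M' Y)" for M M' f \<rho>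
    using that assms by (simp add: F.pull_smult[of f M M'])
qed simp

lemma act_sum_eq:
  assumes "sum_eq C A ts us" "C \<in> Ob K" "A \<in> Ob K" "C' \<in> Ob K" "A' \<in> Ob K" "c \<in> arr K C' C" "a \<in> arr K A A'"
  shows "sum_eq C' A' (act_sum c a ts) (act_sum c a us)"
  unfolding act_sum_def
proof (rule sum_eq_functorial[OF assms(1-5), where h = "\<lambda>M. push K F M a" and j = "\<lambda>M. pull K G M c"])
  show "push K F M a (pull K F A f \<rho>) = pull K F A' f (push K F M' a \<rho>)"
    if "M \<in> Ob K" "M' \<in> Ob K" "f \<in> arr K M M'" "\<rho> \<in> carrier (val F M' A)" for M M' f \<rho>
    using that assms by (simp add: F.pull_push[of \<rho> M' A f M a A'])
  show "pull K G M' c (push K G C f l) = push K G C' f (pull K G M c l)"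
    if "M \<in> Ob K" "M' \<in> Ob K" "f \<in> arr K M M'" "l \<in> carrier (val G C M)" for M M' f l
    using that assms by (simp add: G.pull_push[of l C M c C' f M'])
  show "(\<lambda>\<rho> \<in> carrier (val F M A). push K F M a \<rho>) \<in> lin_maps R (val F M A) (val F M A')" if "M \<in> Ob K" for M
    using that assms by (intro F.push_linear)
  show "(\<lambda>l \<in> carrier (val G C M). pull K G M c l) \<in> lin_maps R (val G C M) (val G C' M)" if "M \<in> Ob K" for M
    using that assms by (intro G.pull_linear)
qed

lemma smult_sum_sums: "\<lbrakk>ts \<in> sums X Y; r \<in> carrier R; X \<in> Ob K; Y \<in> Ob K\<rbrakk> \<Longrightarrow> smult_sum Y r ts \<in> sums X Y"
  by (induction ts) (auto simp: smult_sum_def)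

lemma act_sum_sums: "\<lbrakk>ts \<in> sums C A; c \<in> arr K C' C; a \<in> arr K A A'; C \<in> Ob K; A \<in> Ob K; C' \<in> Ob K; A' \<in> Ob K\<rbrakk>
    \<Longrightarrow> act_sum c a ts \<in> sums C' A'"
  by (induction ts) (auto simp: act_sum_def)

lemma coend_carrier: "carrier (val FG X Y) = cls X Y ` sums X Y"
  and coend_zero: "\<zero>\<^bsub>val FG X Y\<^esub> = cls X Y []"
  by (simp_all add: coend_def)

lemma cls_in_coend: "ts \<in> sums X Y \<Longrightarrow> cls X Y ts \<in> carrier (val FG X Y)"
  by (simp add: coend_carrier)

lemma coend_add: "\<lbrakk>ts \<in> sums X Y; us \<in> sums X Y\<rbrakk>
    \<Longrightarrow> cls X Y ts \<oplus>\<^bsub>val FG X Y\<^esub> cls X Y us = cls X Y (ts @ us)"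
  by (simp add: coend_def) (rule cls_cong[symmetric], intro coend_eq.append cls_eq)

lemma coend_smult: "\<lbrakk>ts \<in> sums X Y; r \<in> carrier R; X \<in> Ob K; Y \<in> Ob K\<rbrakk>
    \<Longrightarrow> r \<odot>\<^bsub>val FG X Y\<^esub> cls X Y ts = cls X Y (smult_sum Y r ts)"
  by (simp add: coend_def flip: smult_sum_def) (rule cls_cong[symmetric], intro smult_sum_eq cls_eq)

lemma coend_act: "\<lbrakk>ts \<in> sums C A; c \<in> arr K C' C; a \<in> arr K A A'; C \<in> Ob K; A \<in> Ob K; C' \<in> Ob K; A' \<in> Ob K\<rbrakk>
    \<Longrightarrow> act FG c a (cls C A ts) = cls C' A' (act_sum c a ts)"
  using F.dom_cod[of C' C c] F.dom_cod[of A A' a]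
  by (simp add: coend_def flip: act_sum_def) (rule cls_cong[symmetric], rule act_sum_eq, auto intro: cls_eq)

lemma coend_module:
  assumes X: "X \<in> Ob K" "Y \<in> Ob K"
  shows "module R (val FG X Y)"
proof -
  let ?V = "val FG X Y"
  have mod: "module R (val F M Y)" if "M \<in> Ob K" for M
    using that X by (intro F.val_module)
  have closed: "u \<oplus>\<^bsub>?V\<^esub> v \<in> carrier ?V" if "u \<in> carrier ?V" "v \<in> carrier ?V" for u v
    using that by (auto simp: coend_carrier coend_add)
  have smult_closed: "r \<odot>\<^bsub>?V\<^esub> u \<in> carrier ?V" if "r \<in> carrier R" "u \<in> carrier ?V" for r u
    using that X by (auto simp: coend_carrier coend_smult smult_sum_sums)
  show ?thesis
  proof (intro moduleI abelian_groupI F.cring_R closed smult_closed)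
    show "\<zero>\<^bsub>?V\<^esub> \<in> carrier ?V" by (simp add: coend_carrier coend_zero)
  next
    fix u v w assume "u \<in> carrier ?V" "v \<in> carrier ?V" "w \<in> carrier ?V"
    then show "u \<oplus>\<^bsub>?V\<^esub> v \<oplus>\<^bsub>?V\<^esub> w = u \<oplus>\<^bsub>?V\<^esub> (v \<oplus>\<^bsub>?V\<^esub> w)"
      by (auto simp: coend_carrier coend_add)
  next
    fix u v assume "u \<in> carrier ?V" "v \<in> carrier ?V"
    then show "u \<oplus>\<^bsub>?V\<^esub> v = v \<oplus>\<^bsub>?V\<^esub> u"
      by (auto simp: coend_carrier coend_add intro!: cls_cong coend_eq.commute)
  next
    fix u assume "u \<in> carrier ?V"
    then show "\<zero>\<^bsub>?V\<^esub> \<oplus>\<^bsub>?V\<^esub> u = u"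
      by (auto simp: coend_carrier coend_zero coend_add)
  next
    fix u assume "u \<in> carrier ?V"
    then obtain ts where ts: "ts \<in> sums X Y" "u = cls X Y ts" by (auto simp: coend_carrier)
    \<comment> \<open>each \<open>0 \<otimes> l\<close> is both zero and the sum of \<open>-\<rho> \<otimes> l\<close> and \<open>\<rho> \<otimes> l\<close>\<close>
    let ?m = "map (\<lambda>(M, \<rho>, l). (M, \<ominus>\<^bsub>val F M Y\<^esub> \<rho>, l)) ts"
    have m: "?m \<in> sums X Y" using ts(1) X by (induction ts) auto
    have 1: "sum_eq X Y (map (\<lambda>(M, \<rho>, l). (M, \<zero>\<^bsub>val F M Y\<^esub>, l)) ts) (?m @ map (\<lambda>t. t) ts)"
    proof (rule sum_eq_map_append[OF X], clarify)
      fix M \<rho> l assume "(M, \<rho>, l) \<in> set ts"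
      then have t: "M \<in> Ob K" "\<rho> \<in> carrier (val F M Y)" "l \<in> carrier (val G X M)"
        using sumsD[OF ts(1)] by auto
      interpret M: module R "val F M Y" using mod t by simp
      show "sum_eq X Y [(M, \<zero>\<^bsub>val F M Y\<^esub>, l)] [(M, \<ominus>\<^bsub>val F M Y\<^esub> \<rho>, l), (M, \<rho>, l)]"
        using coend_eq.add_left[of M K "\<ominus>\<^bsub>val F M Y\<^esub> \<rho>" F Y \<rho> l G X R] t by (simp add: M.M.l_neg)
    qed
    have 2: "sum_eq X Y (map (\<lambda>(M, \<rho>, l). (M, \<zero>\<^bsub>val F M Y\<^esub>, l)) ts) []"
      using sumsD[OF ts(1)] by (intro sum_eq_map_Nil) (auto intro: coend_eq.zero)
    have "cls X Y (?m @ ts) = cls X Y []"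
      using cls_cong[OF coend_eq.trans[OF coend_eq.sym[OF 1] 2]] by simp
    then show "\<exists>v \<in> carrier ?V. v \<oplus>\<^bsub>?V\<^esub> u = \<zero>\<^bsub>?V\<^esub>"
      using m ts by (intro bexI[of _ "cls X Y ?m"]) (auto simp: coend_add coend_zero coend_carrier)
  next
    fix r r' u assume r: "r \<in> carrier R" "r' \<in> carrier R" and "u \<in> carrier ?V"
    then obtain ts where ts: "ts \<in> sums X Y" "u = cls X Y ts" by (auto simp: coend_carrier)
    have R: "r \<oplus>\<^bsub>R\<^esub> r' \<in> carrier R" "r \<otimes>\<^bsub>R\<^esub> r' \<in> carrier R"
      using r F.cring_R by (simp_all add: cring.cring_simprules)
    have "sum_eq X Y (smult_sum Y (r \<oplus>\<^bsub>R\<^esub> r') ts) (smult_sum Y r ts @ smult_sum Y r' ts)"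
      unfolding smult_sum_def
    proof (rule sum_eq_map_append[OF X], clarify)
      fix M \<rho> l assume "(M, \<rho>, l) \<in> set ts"
      then have t: "M \<in> Ob K" "\<rho> \<in> carrier (val F M Y)" "l \<in> carrier (val G X M)"
        using sumsD[OF ts(1)] by auto
      then show "sum_eq X Y [(M, (r \<oplus>\<^bsub>R\<^esub> r') \<odot>\<^bsub>val F M Y\<^esub> \<rho>, l)]
          [(M, r \<odot>\<^bsub>val F M Y\<^esub> \<rho>, l), (M, r' \<odot>\<^bsub>val F M Y\<^esub> \<rho>, l)]"
        using r X by (auto simp: module.smult_l_distr[OF mod] intro: coend_eq.add_left)
    qed
    then show "(r \<oplus>\<^bsub>R\<^esub> r') \<odot>\<^bsub>?V\<^esub> u = r \<odot>\<^bsub>?V\<^esub> u \<oplus>\<^bsub>?V\<^esub> r' \<odot>\<^bsub>?V\<^esub> u"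
      using r R X ts by (simp add: coend_smult coend_add smult_sum_sums cls_cong)
    have "smult_sum Y (r \<otimes>\<^bsub>R\<^esub> r') ts = smult_sum Y r (smult_sum Y r' ts)"
      using sumsD[OF ts(1)] r by (auto simp: smult_sum_def module.smult_assoc1[OF mod])
    then show "(r \<otimes>\<^bsub>R\<^esub> r') \<odot>\<^bsub>?V\<^esub> u = r \<odot>\<^bsub>?V\<^esub> (r' \<odot>\<^bsub>?V\<^esub> u)"
      using r R X ts by (simp add: coend_smult smult_sum_sums)
  next
    fix r u v assume "r \<in> carrier R" "u \<in> carrier ?V" "v \<in> carrier ?V"
    then show "r \<odot>\<^bsub>?V\<^esub> (u \<oplus>\<^bsub>?V\<^esub> v) = r \<odot>\<^bsub>?V\<^esub> u \<oplus>\<^bsub>?V\<^esub> r \<odot>\<^bsub>?V\<^esub> v"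
      using X by (auto simp: coend_carrier coend_smult coend_add smult_sum_sums)
  next
    fix u assume "u \<in> carrier ?V"
    then obtain ts where ts: "ts \<in> sums X Y" "u = cls X Y ts" by (auto simp: coend_carrier)
    have "smult_sum Y \<one>\<^bsub>R\<^esub> ts = ts"
      unfolding smult_sum_def using sumsD[OF ts(1)] by (intro map_idI) (auto simp: module.smult_one[OF mod])
    then show "\<one>\<^bsub>R\<^esub> \<odot>\<^bsub>?V\<^esub> u = u"
      using ts X F.cring_R by (simp add: coend_smult cring.cring_simprules)
  qed
qed

lemma coend_bilinear: "bilinear_functor R K FG"
proof (rule F.bilinear_functorI[OF coend_module])
  fix C A C' A' c a
  assume *: "C \<in> Ob K" "A \<in> Ob K" "C' \<in> Ob K" "A' \<in> Ob K" "c \<in> arr K C' C" "a \<in> arr K A A'"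
  show "(\<lambda>u \<in> carrier (val FG C A). act FG c a u)
      \<in> lin_maps R (val FG C A) (val FG C' A')"
  proof (rule restrict_in_lin_maps[OF coend_module[OF *(1,2)]])
    fix r u assume r: "r \<in> carrier R" and "u \<in> carrier (val FG C A)"
    then obtain ts where ts: "ts \<in> sums C A" "u = cls C A ts" by (auto simp: coend_carrier)
    have "act_sum c a (smult_sum A r ts) = smult_sum A' r (act_sum c a ts)"
      using sumsD[OF ts(1)] r * by (auto simp: act_sum_def smult_sum_def F.push_smult)
    then show "act FG c a (r \<odot>\<^bsub>val FG C A\<^esub> u)
        = r \<odot>\<^bsub>val FG C' A'\<^esub> act FG c a u"
      using r ts * by (simp add: coend_smult coend_act[of _ C A c C' a A'] smult_sum_sums act_sum_sums[of _ C A])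
  qed (use * in \<open>auto simp: coend_carrier coend_act[of _ C A c C' a A'] coend_add act_sum_sums[of _ C A]\<close>)
next
  fix C A u
  assume *: "C \<in> Ob K" "A \<in> Ob K" "u \<in> carrier (val FG C A)"
  then obtain ts where ts: "ts \<in> sums C A" "u = cls C A ts" by (auto simp: coend_carrier)
  have "act_sum (ident K C) (ident K A) ts = ts"
    unfolding act_sum_def using sumsD[OF ts(1)] * by (intro map_idI) auto
  then show "act FG (ident K C) (ident K A) u = u"
    using * ts coend_act[of ts C A "ident K C" C "ident K A" A] by simp
next
  fix C A C' A' C'' A'' c a c' a' u
  assume *: "C \<in> Ob K" "A \<in> Ob K" "C' \<in> Ob K" "A' \<in> Ob K" "C'' \<in> Ob K" "A'' \<in> Ob K"
    "c \<in> arr K C' C" "a \<in> arr K A A'" "c' \<in> arr K C'' C'" "a' \<in> arr K A' A''"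
    "u \<in> carrier (val FG C A)"
  then obtain ts where ts: "ts \<in> sums C A" "u = cls C A ts" by (auto simp: coend_carrier)
  have "act_sum (c \<star> c') (a' \<star> a) ts = act_sum c' a' (act_sum c a ts)"
    using sumsD[OF ts(1)] *(1-10) by (auto simp: act_sum_def F.push_cmp[of _ _ A a A' a' A''] G.pull_cmp[of _ C _ c C' c' C''])
  then show "act FG (c \<star> c') (a' \<star> a) u = act FG c' a' (act FG c a u)"
    using *(1-10) ts
    by (simp add: coend_act[of _ C A c C' a A'] coend_act[of _ C' A' c' C'' a' A'']
        coend_act[of _ C A "c \<star> c'" C'' "a' \<star> a" A''] act_sum_sums[of _ C A]
        F.cmp_arr[of c' C'' C'] F.cmp_arr[of a A A'])
next
  fix C A C' A' c c' a u
  assume *: "C \<in> Ob K" "A \<in> Ob K" "C' \<in> Ob K" "A' \<in> Ob K" "c \<in> arr K C' C" "c' \<in> arr K C' C"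
    "a \<in> arr K A A'" "u \<in> carrier (val FG C A)"
  then obtain ts where ts: "ts \<in> sums C A" "u = cls C A ts" by (auto simp: coend_carrier)
  have "sum_eq C' A' (act_sum (c \<oplus>\<^bsub>Hom K C' C\<^esub> c') a ts) (act_sum c a ts @ act_sum c' a ts)"
    unfolding act_sum_def using sumsD[OF ts(1)] *(1-7)
    by (intro sum_eq_map_append) (auto simp: G.pull_add_mor intro!: coend_eq.add_right F.push_closed[of _ _ A] G.pull_closed[of _ C])
  then show "act FG (c \<oplus>\<^bsub>Hom K C' C\<^esub> c') a u
      = act FG c a u \<oplus>\<^bsub>val FG C' A'\<^esub> act FG c' a u"
    using *(1-7) ts by (simp add: coend_act[of _ C A _ C' a A'] coend_add act_sum_sums[of _ C A] cls_cong)
next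
  fix C A C' A' r c a u
  assume *: "C \<in> Ob K" "A \<in> Ob K" "C' \<in> Ob K" "A' \<in> Ob K" "r \<in> carrier R" "c \<in> arr K C' C"
    "a \<in> arr K A A'" "u \<in> carrier (val FG C A)"
  then obtain ts where ts: "ts \<in> sums C A" "u = cls C A ts" by (auto simp: coend_carrier)
  have "sum_eq C' A' (map (\<lambda>(M, \<rho>, l). (M, r \<odot>\<^bsub>val F M A'\<^esub> push K F M a \<rho>, pull K G M c l)) ts)
      (act_sum (r \<odot>\<^bsub>Hom K C' C\<^esub> c) a ts)"
    unfolding act_sum_def using sumsD[OF ts(1)] *(1-7)
    by (intro sum_eq_map) (auto simp: G.pull_smult_mor intro!: coend_eq.balanced F.push_closed[of _ _ A] G.pull_closed[of _ C])
  moreover have "map (\<lambda>(M, \<rho>, l). (M, r \<odot>\<^bsub>val F M A'\<^esub> push K F M a \<rho>, pull K G M c l)) ts = smult_sum A' r (act_sum c a ts)"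
    by (auto simp: act_sum_def smult_sum_def)
  ultimately show "act FG (r \<odot>\<^bsub>Hom K C' C\<^esub> c) a u
      = r \<odot>\<^bsub>val FG C' A'\<^esub> act FG c a u"
    using *(1-7) ts by (simp add: coend_act[of _ C A _ C' a A'] coend_smult act_sum_sums[of _ C A] cls_cong)
next
  fix C A C' A' c a a' u
  assume *: "C \<in> Ob K" "A \<in> Ob K" "C' \<in> Ob K" "A' \<in> Ob K" "c \<in> arr K C' C"
    "a \<in> arr K A A'" "a' \<in> arr K A A'" "u \<in> carrier (val FG C A)"
  then obtain ts where ts: "ts \<in> sums C A" "u = cls C A ts" by (auto simp: coend_carrier)
  have "sum_eq C' A' (act_sum c (a \<oplus>\<^bsub>Hom K A A'\<^esub> a') ts) (act_sum c a ts @ act_sum c a' ts)"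
    unfolding act_sum_def using sumsD[OF ts(1)] *(1-7)
    by (intro sum_eq_map_append) (auto simp: F.push_add_mor intro!: coend_eq.add_left F.push_closed[of _ _ A] G.pull_closed[of _ C])
  then show "act FG c (a \<oplus>\<^bsub>Hom K A A'\<^esub> a') u
      = act FG c a u \<oplus>\<^bsub>val FG C' A'\<^esub> act FG c a' u"
    using *(1-7) ts by (simp add: coend_act[of _ C A c C' _ A'] coend_add act_sum_sums[of _ C A] cls_cong)
next
  fix C A C' A' r c a u
  assume *: "C \<in> Ob K" "A \<in> Ob K" "C' \<in> Ob K" "A' \<in> Ob K" "r \<in> carrier R" "c \<in> arr K C' C"
    "a \<in> arr K A A'" "u \<in> carrier (val FG C A)"
  then obtain ts where ts: "ts \<in> sums C A" "u = cls C A ts" by (auto simp: coend_carrier)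
  have "act_sum c (r \<odot>\<^bsub>Hom K A A'\<^esub> a) ts = smult_sum A' r (act_sum c a ts)"
    using sumsD[OF ts(1)] *(1-7) by (auto simp: act_sum_def smult_sum_def F.push_smult_mor)
  then show "act FG c (r \<odot>\<^bsub>Hom K A A'\<^esub> a) u
      = r \<odot>\<^bsub>val FG C' A'\<^esub> act FG c a u"
    using *(1-7) ts by (simp add: coend_act[of _ C A c C' _ A'] coend_smult act_sum_sums[of _ C A])
qed

end

subsection \<open>Positive extensions and the cup product\<close>

lemma inj_pos [simp]: "inj Hom_el" "inj Ext_el" "inj Sum_el"
  by (simp_all add: inj_def)

lemma the_inv_Hom_el [simp]: "the_inv Hom_el (Hom_el f) = f"
  by (simp add: the_inv_f_f)

context extriangulated_category
begin

lemma pos_ext_bilinear: "bilinear_functor R K (pos_ext R K E n)"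
proof (induction n)
  case 0
  show ?case
    by (simp add: bilinear_functor.relabel_bilinear[OF hom_bifun_bilinear])
next
  case (Suc n)
  show ?case
  proof (cases n)
    case 0
    then show ?thesis by (simp add: relabel_bilinear)
  next
    case (Suc m)
    interpret P: bilinear_pair R K "pos_ext R K E n" E
      by (intro bilinear_pair.intro Suc.IH bilinear_functor_axioms)
    show ?thesis
      using bilinear_functor.relabel_bilinear[OF P.coend_bilinear, of Sum_el] Suc by simp
  qed
qed

sublocale P: bilinear_functor R K "pos_ext R K E n" for n
  by (rule pos_ext_bilinear)

sublocale pair: bilinear_pair R K "pos_ext R K E (Suc n)" E for n
  by (intro bilinear_pair.intro pos_ext_bilinear bilinear_functor_axioms)

abbreviation Pos :: "nat \<Rightarrow> 'o \<Rightarrow> 'o \<Rightarrow> ('o, 'm, 'e) pos set"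
  where "Pos n X Y \<equiv> carrier (val (pos_ext R K E n) X Y)"

lemma push_pos0: "\<lbrakk>f \<in> arr K A Y; h \<in> arr K Y Y'; A \<in> Ob K; Y \<in> Ob K; Y' \<in> Ob K\<rbrakk>
    \<Longrightarrow> push K (pos_ext R K E 0) A h (Hom_el f) = Hom_el (h \<star> f)"
  by (simp add: push_relabel)

lemma pull_pos0: "\<lbrakk>f \<in> arr K A Y; a \<in> arr K A' A; A \<in> Ob K; A' \<in> Ob K; Y \<in> Ob K\<rbrakk>
    \<Longrightarrow> pull K (pos_ext R K E 0) Y a (Hom_el f) = Hom_el (f \<star> a)"
  by (simp add: pull_relabel)

lemma add_pos0: "Hom_el f \<oplus>\<^bsub>val (pos_ext R K E 0) X Y\<^esub> Hom_el g = Hom_el (f \<oplus>\<^bsub>Hom K X Y\<^esub> g)"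
  and smult_pos0: "r \<odot>\<^bsub>val (pos_ext R K E 0) X Y\<^esub> Hom_el f = Hom_el (r \<odot>\<^bsub>Hom K X Y\<^esub> f)"
  by (simp_all add: add_relabel smult_relabel)

lemma cup_closed [simp]:
  assumes "l \<in> Pos n A Y" "\<delta> \<in> Ext C A" "C \<in> Ob K" "A \<in> Ob K" "Y \<in> Ob K"
  shows "cup R K E n C A \<delta> Y l \<in> Pos (Suc n) C Y"
  using assms by (cases n) (auto simp: pair.cls_in_coend)

lemma cup_add:
  assumes "l \<in> Pos n A Y" "l' \<in> Pos n A Y" "\<delta> \<in> Ext C A" "C \<in> Ob K" "A \<in> Ob K" "Y \<in> Ob K"
  shows "cup R K E n C A \<delta> Y (l \<oplus>\<^bsub>val (pos_ext R K E n) A Y\<^esub> l')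
    = cup R K E n C A \<delta> Y l \<oplus>\<^bsub>val (pos_ext R K E (Suc n)) C Y\<^esub> cup R K E n C A \<delta> Y l'"
proof (cases n)
  case 0
  then show ?thesis
    using assms by (auto simp: add_relabel push_add_mor)
next
  case (Suc m)
  have "pair.cls m C Y [(A, l \<oplus>\<^bsub>val (pos_ext R K E (Suc m)) A Y\<^esub> l', \<delta>)]
      = pair.cls m C Y ([(A, l, \<delta>)] @ [(A, l', \<delta>)])"
    using assms Suc by (intro pair.cls_cong) (auto intro: coend_eq.add_left)
  then show ?thesis
    using assms Suc by (simp add: add_relabel pair.coend_add)
qed

lemma cup_smult:
  assumes "l \<in> Pos n A Y" "r \<in> carrier R" "\<delta> \<in> Ext C A" "C \<in> Ob K" "A \<in> Ob K" "Y \<in> Ob K"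
  shows "cup R K E n C A \<delta> Y (r \<odot>\<^bsub>val (pos_ext R K E n) A Y\<^esub> l)
    = r \<odot>\<^bsub>val (pos_ext R K E (Suc n)) C Y\<^esub> cup R K E n C A \<delta> Y l"
proof (cases n)
  case 0
  then show ?thesis
    using assms by (auto simp: smult_relabel push_smult_mor)
next
  case (Suc m)
  then show ?thesis
    using assms by (simp add: smult_relabel pair.coend_smult pair.smult_sum_def)
qed

lemma cup_push_arg:
  assumes "l \<in> Pos n A Y" "h \<in> arr K Y Y'" "\<delta> \<in> Ext C A" "C \<in> Ob K" "A \<in> Ob K" "Y \<in> Ob K" "Y' \<in> Ob K"
  shows "cup R K E n C A \<delta> Y' (push K (pos_ext R K E n) A h l)
    = push K (pos_ext R K E (Suc n)) C h (cup R K E n C A \<delta> Y l)"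
proof (cases n)
  case 0
  then show ?thesis
    using assms by (auto simp: push_relabel push_cmp[of _ C A])
next
  case (Suc m)
  have "push K (coend R K (pos_ext R K E (Suc m)) E) C h (pair.cls m C Y [(A, l, \<delta>)])
      = pair.cls m C Y' [(A, push K (pos_ext R K E (Suc m)) A h l, \<delta>)]"
    unfolding push_def[of K "coend R K (pos_ext R K E (Suc m)) E"]
    using assms Suc by (simp add: pair.coend_act[of _ m C Y _ C h Y'] pair.act_sum_def)
  then show ?thesis
    using assms Suc by (simp add: push_relabel)
qed

lemma cup_push:
  assumes "l \<in> Pos n A' Y" "a \<in> arr K A A'" "\<delta> \<in> Ext C A" "C \<in> Ob K" "A \<in> Ob K" "A' \<in> Ob K" "Y \<in> Ob K"
  shows "cup R K E n C A' (push K E C a \<delta>) Y l = cup R K E n C A \<delta> Y (pull K (pos_ext R K E n) Y a l)"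
proof (cases n)
  case 0
  then show ?thesis
    using assms by (auto simp: pull_relabel push_cmp[of _ C A])
next
  case (Suc m)
  have "pair.cls m C Y [(A, pull K (pos_ext R K E (Suc m)) Y a l, \<delta>)] = pair.cls m C Y [(A', l, push K E C a \<delta>)]"
    using assms Suc by (intro pair.cls_cong coend_eq.dinatural) auto
  then show ?thesis using Suc by simp
qed

lemma cup_pull:
  assumes "l \<in> Pos n A Y" "c \<in> arr K C' C" "\<delta> \<in> Ext C A" "C \<in> Ob K" "C' \<in> Ob K" "A \<in> Ob K" "Y \<in> Ob K"
  shows "cup R K E n C' A (pull K E A c \<delta>) Y l = pull K (pos_ext R K E (Suc n)) Y c (cup R K E n C A \<delta> Y l)"
proof (cases n)
  case 0
  then show ?thesis
    using assms by (auto simp: pull_relabel pull_push[of _ C A c C'])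
next
  case (Suc m)
  have "pull K (coend R K (pos_ext R K E (Suc m)) E) Y c (pair.cls m C Y [(A, l, \<delta>)])
      = pair.cls m C' Y [(A, l, pull K E A c \<delta>)]"
    unfolding pull_def[of K "coend R K (pos_ext R K E (Suc m)) E"]
    using assms Suc by (simp add: pair.coend_act[of _ m C Y c C' _ Y] pair.act_sum_def)
  then show ?thesis
    using assms Suc by (simp add: pull_relabel)
qed

text \<open>
  If every extension of \<open>C\<close> is a pushout of \<open>\<kappa>\<close>, then by dinaturality every element of the coend
  can be moved to the summand of \<open>\<kappa>\<close>.
\<close>

lemma cup_surj:
  assumes \<kappa>: "\<kappa> \<in> Ext C N" "C \<in> Ob K" "N \<in> Ob K"
    and gen: "\<And>M l. \<lbrakk>M \<in> Ob K; l \<in> Ext C M\<rbrakk> \<Longrightarrow> \<exists>a \<in> arr K N M. push K E C a \<kappa> = l"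
    and u: "u \<in> Pos (Suc n) C Y" "Y \<in> Ob K"
  shows "\<exists>l \<in> Pos n N Y. cup R K E n C N \<kappa> Y l = u"
proof (cases n)
  case 0
  then obtain e where e: "e \<in> Ext C Y" "u = Ext_el e" using u by auto
  obtain a where "a \<in> arr K N Y" "push K E C a \<kappa> = e" using gen e u by blast
  then show ?thesis using 0 e by (intro bexI[of _ "Hom_el a"]) auto
next
  case (Suc m)
  let ?P = "pos_ext R K E (Suc m)"
  obtain ts where ts: "ts \<in> pair.sums m C Y" "u = Sum_el (pair.cls m C Y ts)"
    using u Suc by (auto simp: pair.coend_carrier)
  have "\<exists>l \<in> Pos (Suc m) N Y. pair.sum_eq m C Y ts [(N, l, \<kappa>)]"
    using ts(1)
  proof (induction ts)
    case Nil
    show ?case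
      using \<kappa> u by (intro bexI[of _ "\<zero>\<^bsub>val ?P N Y\<^esub>"] coend_eq.sym[OF coend_eq.zero]) auto
  next
    case (Cons t ts)
    obtain M \<rho> l where t: "t = (M, \<rho>, l)" by (cases t)
    have M: "M \<in> Ob K" "\<rho> \<in> Pos (Suc m) M Y" "l \<in> Ext C M" and ts: "ts \<in> pair.sums m C Y"
      using Cons.prems unfolding t by simp_all
    obtain l' where l': "l' \<in> Pos (Suc m) N Y" "pair.sum_eq m C Y ts [(N, l', \<kappa>)]"
      using Cons.IH ts by blast
    obtain a where a: "a \<in> arr K N M" "push K E C a \<kappa> = l" using gen M by blast
    have p: "pull K ?P Y a \<rho> \<in> Pos (Suc m) N Y" using M a \<kappa> u by auto
    have "pair.sum_eq m C Y [t] [(N, pull K ?P Y a \<rho>, \<kappa>)]"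
      using coend_eq.sym[OF coend_eq.dinatural[OF \<kappa>(3) M(1) a(1) M(2) \<kappa>(1)]] by (simp add: t a)
    from coend_eq.append[OF this l'(2)]
    have "pair.sum_eq m C Y (t # ts) [(N, pull K ?P Y a \<rho>, \<kappa>), (N, l', \<kappa>)]" by simp
    from coend_eq.trans[OF this coend_eq.sym[OF coend_eq.add_left[OF \<kappa>(3) p l'(1) \<kappa>(1)]]]
    show ?case using p l'(1) \<kappa> u by (intro bexI[of _ "pull K ?P Y a \<rho> \<oplus>\<^bsub>val ?P N Y\<^esub> l'"]) auto
  qed
  then show ?thesis
    using ts Suc by (auto intro: pair.cls_cong coend_eq.sym)
qed

definition eval_sum :: "('r, 'w) module \<Rightarrow> ('t \<Rightarrow> 'w) \<Rightarrow> 't list \<Rightarrow> 'w"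
  where "eval_sum M \<Psi> ts = foldr (\<lambda>t v. \<Psi> t \<oplus>\<^bsub>M\<^esub> v) ts \<zero>\<^bsub>M\<^esub>"

lemma eval_sum_closed:
  "\<lbrakk>abelian_group M; \<And>t. t \<in> set ts \<Longrightarrow> \<Psi> t \<in> carrier M\<rbrakk> \<Longrightarrow> eval_sum M \<Psi> ts \<in> carrier M"
  by (induction ts) (auto simp: eval_sum_def abelian_group_def abelian_monoid.a_closed abelian_monoid.zero_closed)

lemma eval_sum_append:
  assumes "abelian_group M" "\<And>t. t \<in> set ts \<Longrightarrow> \<Psi> t \<in> carrier M" "\<And>t. t \<in> set us \<Longrightarrow> \<Psi> t \<in> carrier M"
  shows "eval_sum M \<Psi> (ts @ us) = eval_sum M \<Psi> ts \<oplus>\<^bsub>M\<^esub> eval_sum M \<Psi> us"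
proof -
  interpret M: abelian_group M by fact
  have "eval_sum M \<Psi> us \<in> carrier M" using assms by (intro eval_sum_closed)
  then show ?thesis
    using assms(2)
  proof (induction ts)
    case Nil
    then show ?case by (simp add: eval_sum_def)
  next
    case (Cons t ts)
    have "eval_sum M \<Psi> ts \<in> carrier M" using Cons.prems assms(1) by (intro eval_sum_closed) auto
    with Cons show ?case by (simp add: eval_sum_def M.a_assoc)
  qed
qed

text \<open>
  Right exactness of \<open>\<bbbE>\<^bsup>n\<^esup>(Q, Y) \<rightarrow> \<bbbE>\<^bsup>n\<^esup>(N, Y) \<rightarrow> \<bbbE>\<^bsup>n+1\<^esup>(C, Y)\<close>, as a factorization property: a linear map \<open>h\<close>
  which vanishes on the image of \<open>k\<^sup>*\<close> depends only on \<open>l \<union> \<kappa>\<close>. For a coend one extends \<open>h\<close> to formal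
  sums, sending \<open>\<rho> \<otimes> l\<close> to \<open>h (a\<^sup>* \<rho>)\<close> for any \<open>a\<close> with \<open>a\<^sub>* \<kappa> = l\<close>. Two choices of \<open>a\<close> differ by a
  morphism that factors through \<open>k\<close>, so this is well-defined and respects the relations; on
  \<open>\<rho> \<otimes> \<kappa>\<close> the choice \<open>a = 1\<close> gives \<open>h \<rho>\<close> back.
\<close>

lemma cup_factor:
  assumes tri: "(k, Q, g) \<in> s C N \<kappa>" and C: "C \<in> Ob K" and N: "N \<in> Ob K" and \<kappa>: "\<kappa> \<in> Ext C N"
    and gen: "\<And>M l. \<lbrakk>M \<in> Ob K; l \<in> Ext C M\<rbrakk> \<Longrightarrow> \<exists>a \<in> arr K N M. push K E C a \<kappa> = l"
    and Y: "Y \<in> Ob K" and V: "module R V" and h: "h \<in> lin_maps R (val (pos_ext R K E n) N Y) V"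
    and h0: "\<And>\<mu>. \<mu> \<in> Pos n Q Y \<Longrightarrow> h (pull K (pos_ext R K E n) Y k \<mu>) = \<zero>\<^bsub>V\<^esub>"
    and l: "l \<in> Pos n N Y" "l' \<in> Pos n N Y" "cup R K E n C N \<kappa> Y l = cup R K E n C N \<kappa> Y l'"
  shows "h l = h l'"
proof -
  interpret V: module R V by fact
  note t = real_seq[OF tri C N \<kappa>]
  have diff: "\<exists>d \<in> arr K Q M. a = a' \<oplus>\<^bsub>Hom K N M\<^esub> d \<star> k"
    if asm: "a \<in> arr K N M" "a' \<in> arr K N M" "push K E C a \<kappa> = push K E C a' \<kappa>" "M \<in> Ob K" for a a' M
  proof -
    interpret NM: abelian_group "Hom K N M" using N asm by (intro hom_group)
    interpret CM: abelian_group "val E C M" using C asm by (intro val_group)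
    have aa': "a \<oplus>\<^bsub>Hom K N M\<^esub> \<ominus>\<^bsub>Hom K N M\<^esub> a' \<in> arr K N M"
      using asm N by simp
    have "push K E C (a \<oplus>\<^bsub>Hom K N M\<^esub> \<ominus>\<^bsub>Hom K N M\<^esub> a') \<kappa> = \<zero>\<^bsub>val E C M\<^esub>"
      using asm \<kappa> C N by (simp add: push_add_mor push_minus_mor CM.r_neg)
    then obtain d where "d \<in> arr K Q M" "d \<star> k = a \<oplus>\<^bsub>Hom K N M\<^esub> \<ominus>\<^bsub>Hom K N M\<^esub> a'"
      using extend_along_inflation[OF tri C N \<kappa> aa' _ asm(4)] by blast
    moreover then have "a = a' \<oplus>\<^bsub>Hom K N M\<^esub> d \<star> k"
      using asm by (simp add: NM.a_lcomm[of a' a] NM.r_neg)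
    ultimately show ?thesis by blast
  qed
  show ?thesis
  proof (cases n)
    case 0
    obtain f f' where f: "f \<in> arr K N Y" "f' \<in> arr K N Y" "l = Hom_el f" "l' = Hom_el f'"
      using l 0 by auto
    with l 0 have "push K E C f \<kappa> = push K E C f' \<kappa>" by simp
    then obtain d where d: "d \<in> arr K Q Y" "f = f' \<oplus>\<^bsub>Hom K N Y\<^esub> d \<star> k"
      using diff[OF f(1,2) _ Y] by blast
    have dk: "pull K (pos_ext R K E 0) Y k (Hom_el d) = Hom_el (d \<star> k)"
      using d t N Y by (intro pull_pos0)
    have "l = l' \<oplus>\<^bsub>val (pos_ext R K E n) N Y\<^esub> pull K (pos_ext R K E n) Y k (Hom_el d)"
      using f(3,4) d(2) 0 by (simp only: dk add_pos0)
    moreover have "Hom_el d \<in> Pos n Q Y" using d 0 by simp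
    moreover then have "pull K (pos_ext R K E n) Y k (Hom_el d) \<in> Pos n N Y"
      by (rule P.pull_closed[OF _ t(2,1) N Y])
    ultimately show ?thesis
      using lin_maps_add[OF h l(2)] lin_maps_closed[OF h l(2)] h0 by simp
  next
    case (Suc m)
    let ?P = "pos_ext R K E n"
    have n: "pos_ext R K E (Suc m) = ?P" using Suc by simp
    define lift where "lift = (\<lambda>M l. SOME a. a \<in> arr K N M \<and> push K E C a \<kappa> = l)"
    define \<Psi> where "\<Psi> = (\<lambda>(M, \<rho>, l). h (pull K ?P Y (lift M l) \<rho>))"
    have lift: "lift M l \<in> arr K N M" "push K E C (lift M l) \<kappa> = l" if "M \<in> Ob K" "l \<in> Ext C M" for M l
      using someI_ex[of "\<lambda>a. a \<in> arr K N M \<and> push K E C a \<kappa> = l"] gen[OF that] unfolding lift_def by blast+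
    have \<Psi>_eq: "\<Psi> (M, \<rho>, l) = h (pull K ?P Y a \<rho>)"
      if asm: "a \<in> arr K N M" "push K E C a \<kappa> = l" "M \<in> Ob K" "\<rho> \<in> Pos n M Y" for M \<rho> l a
    proof -
      have l: "l \<in> Ext C M" using asm \<kappa> C N by auto
      obtain d where d: "d \<in> arr K Q M" "lift M l = a \<oplus>\<^bsub>Hom K N M\<^esub> d \<star> k"
        using diff[OF lift(1)[OF asm(3) l] asm(1)] lift[OF asm(3) l] asm by auto
      have *: "pull K ?P Y d \<rho> \<in> Pos n Q Y" "pull K ?P Y a \<rho> \<in> Pos n N Y"
        using d asm t N Y by (auto intro: P.pull_closed)
      then have "pull K ?P Y k (pull K ?P Y d \<rho>) \<in> Pos n N Y"
        by (intro P.pull_closed[OF _ t(2,1) N Y])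
      moreover have "pull K ?P Y (lift M l) \<rho> = pull K ?P Y a \<rho> \<oplus>\<^bsub>val ?P N Y\<^esub> pull K ?P Y k (pull K ?P Y d \<rho>)"
        using d asm t N Y by (simp add: P.pull_add_mor[of _ n M] P.pull_cmp[of _ n M] cmp_arr[of k N Q])
      ultimately show ?thesis
        using * lin_maps_add[OF h] lin_maps_closed[OF h] h0 by (simp add: \<Psi>_def)
    qed
    have \<Psi>_closed: "\<Psi> t \<in> carrier V" if "ts \<in> pair.sums m C Y" "t \<in> set ts" for ts t
    proof -
      obtain M \<rho> l where t: "t = (M, \<rho>, l)" by (cases t)
      have M: "M \<in> Ob K" "\<rho> \<in> Pos n M Y" "l \<in> Ext C M"
        using pair.sumsD[OF that(1)] that(2) unfolding t n by blast+
      have "pull K ?P Y (lift M l) \<rho> \<in> Pos n N Y"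
        by (rule P.pull_closed) (use M lift N Y in auto)
      then show ?thesis unfolding t \<Psi>_def using lin_maps_closed[OF h] by simp
    qed
    have eval_append: "eval_sum V \<Psi> (ts @ us) = eval_sum V \<Psi> ts \<oplus>\<^bsub>V\<^esub> eval_sum V \<Psi> us"
      if "ts \<in> pair.sums m C Y" "us \<in> pair.sums m C Y" for ts us
      by (rule eval_sum_append[OF V.M.abelian_group_axioms \<Psi>_closed[OF that(1)] \<Psi>_closed[OF that(2)]])
    have eval_closed: "eval_sum V \<Psi> ts \<in> carrier V" if "ts \<in> pair.sums m C Y" for ts
      by (rule eval_sum_closed[OF V.M.abelian_group_axioms \<Psi>_closed[OF that]])
    have "eval_sum V \<Psi> ts = eval_sum V \<Psi> us" if "pair.sum_eq m C Y ts us" for ts us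
      using that
    proof (induction rule: coend_eq.induct)
      case (append ts ts' us us')
      note S = pair.sum_eq_sums[OF append(1) C Y] pair.sum_eq_sums[OF append(2) C Y]
      show ?case
        using eval_append[of ts us] eval_append[of ts' us'] S append(3,4) by simp
    next
      case (commute ts us)
      then show ?case
        using eval_append[of ts us] eval_append[of us ts] eval_closed[of ts] eval_closed[of us]
        by (simp add: V.M.a_comm)
    next
      case (zero M l)
      have "pull K ?P Y (lift M l) \<zero>\<^bsub>val ?P M Y\<^esub> = \<zero>\<^bsub>val ?P N Y\<^esub>"
        by (rule P.pull_zero) (use zero lift N Y in auto)
      then have "\<Psi> (M, \<zero>\<^bsub>val ?P M Y\<^esub>, l) = \<zero>\<^bsub>V\<^esub>"
        using lin_maps_zero[OF P.val_module[OF N Y] V h] by (simp add: \<Psi>_def)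
      then show ?case by (simp add: eval_sum_def n)
    next
      case (add_left M \<rho> \<rho>' l)
      note M = add_left[unfolded n] lift[OF add_left(1,4)]
      have p: "pull K ?P Y (lift M l) \<rho> \<in> Pos n N Y" "pull K ?P Y (lift M l) \<rho>' \<in> Pos n N Y"
        using P.pull_closed[OF _ M(5) M(1) N Y] M by auto
      have "\<Psi> (M, \<rho> \<oplus>\<^bsub>val ?P M Y\<^esub> \<rho>', l) = \<Psi> (M, \<rho>, l) \<oplus>\<^bsub>V\<^esub> \<Psi> (M, \<rho>', l)"
        using P.pull_add[OF M(5,2,3,1) N Y] lin_maps_add[OF h p] by (simp add: \<Psi>_def)
      moreover have "\<Psi> (M, \<rho>, l) \<in> carrier V" "\<Psi> (M, \<rho>', l) \<in> carrier V"
        using lin_maps_closed[OF h p(1)] lin_maps_closed[OF h p(2)] by (simp_all add: \<Psi>_def)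
      ultimately show ?case by (simp add: eval_sum_def n)
    next
      case (add_right M \<rho> l l')
      note M = add_right[unfolded n]
      note a = lift[OF M(1,3)] and a' = lift[OF M(1,4)]
      have p: "pull K ?P Y (lift M l) \<rho> \<in> Pos n N Y" "pull K ?P Y (lift M l') \<rho> \<in> Pos n N Y"
        using P.pull_closed[OF M(2) _ M(1) N Y] a a' by auto
      have "\<Psi> (M, \<rho>, l \<oplus>\<^bsub>val E C M\<^esub> l') = h (pull K ?P Y (lift M l \<oplus>\<^bsub>Hom K N M\<^esub> lift M l') \<rho>)"
        by (rule \<Psi>_eq) (use M a a' push_add_mor[OF \<kappa> a(1) a'(1)] C N in auto)
      also have "\<dots> = \<Psi> (M, \<rho>, l) \<oplus>\<^bsub>V\<^esub> \<Psi> (M, \<rho>, l')"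
        using P.pull_add_mor[OF M(2) a(1) a'(1) M(1) N Y] lin_maps_add[OF h p] by (simp add: \<Psi>_def)
      finally have "\<Psi> (M, \<rho>, l \<oplus>\<^bsub>val E C M\<^esub> l') = \<Psi> (M, \<rho>, l) \<oplus>\<^bsub>V\<^esub> \<Psi> (M, \<rho>, l')" .
      moreover have "\<Psi> (M, \<rho>, l) \<in> carrier V" "\<Psi> (M, \<rho>, l') \<in> carrier V"
        using lin_maps_closed[OF h p(1)] lin_maps_closed[OF h p(2)] by (simp_all add: \<Psi>_def)
      ultimately show ?case by (simp add: eval_sum_def)
    next
      case (balanced M r \<rho> l)
      note M = balanced[unfolded n]
      note a = lift[OF M(1,4)]
      have "\<Psi> (M, \<rho>, r \<odot>\<^bsub>val E C M\<^esub> l) = h (pull K ?P Y (r \<odot>\<^bsub>Hom K N M\<^esub> lift M l) \<rho>)"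
        by (rule \<Psi>_eq) (use M a push_smult_mor[OF \<kappa> M(2) a(1)] C N in auto)
      also have "\<dots> = h (pull K ?P Y (lift M l) (r \<odot>\<^bsub>val ?P M Y\<^esub> \<rho>))"
        using P.pull_smult_mor[OF M(3,2) a(1) M(1) N Y] P.pull_smult[OF a(1) M(2,3,1) N Y] by simp
      finally show ?case by (simp add: eval_sum_def \<Psi>_def n)
    next
      case (dinatural M M' f \<rho> l)
      note M = dinatural[unfolded n]
      note a = lift[OF M(1,5)]
      have "\<Psi> (M', \<rho>, push K E C f l) = h (pull K ?P Y (f \<star> lift M l) \<rho>)"
        by (rule \<Psi>_eq) (use M a push_cmp[OF \<kappa> a(1) M(3)] C N in auto)
      also have "\<dots> = \<Psi> (M, pull K ?P Y f \<rho>, l)"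
        using P.pull_cmp[OF M(4,3) a(1) M(2) Y M(1) N] by (simp add: \<Psi>_def)
      finally show ?case by (simp add: eval_sum_def n)
    qed auto
    moreover have "pair.sum_eq m C Y [(N, l, \<kappa>)] [(N, l', \<kappa>)]"
      using l Suc \<kappa> N by (intro pair.sum_eq_if_cls) auto
    ultimately have "eval_sum V \<Psi> [(N, l, \<kappa>)] = eval_sum V \<Psi> [(N, l', \<kappa>)]" by blast
    moreover have "\<Psi> (N, \<mu>, \<kappa>) = h \<mu>" if "\<mu> \<in> Pos n N Y" for \<mu>
      using \<Psi>_eq[of "ident K N" N \<kappa> \<mu>] that \<kappa> C N Y by simp
    ultimately show ?thesis
      using l lin_maps_closed[OF h] by (simp add: eval_sum_def)
  qed
qed

end

section \<open>Negative extensions\<close>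

subsection \<open>The dual of a bilinear functor\<close>

text \<open>The bifunctor of natural transformations from \<open>F(A, -)\<close> to \<open>\<C>(C, -)\<close>.\<close>

definition hom_dual :: "('r, 'z) ring_scheme \<Rightarrow> ('r, 'o, 'm) lincat \<Rightarrow> ('r, 'o, 'm, 'x) bifun
    \<Rightarrow> ('r, 'o, 'm, 'o \<Rightarrow> 'x \<Rightarrow> 'm) bifun"
  where "hom_dual R K F = \<lparr>
     val = (\<lambda>C A. \<lparr>
       carrier = nat_trans R K (cov K F A) (cov K (hom_bifun K) C),
       mult = (\<lambda>_ _. undefined), one = undefined,
       zero = (\<lambda>Y \<in> Ob K. \<lambda>l \<in> carrier (val F A Y). \<zero>\<^bsub>Hom K C Y\<^esub>),
       add = (\<lambda>\<eta> \<zeta>. \<lambda>Y \<in> Ob K. \<lambda>l \<in> carrier (val F A Y). \<eta> Y l \<oplus>\<^bsub>Hom K C Y\<^esub> \<zeta> Y l),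
       smult = (\<lambda>r \<eta>. \<lambda>Y \<in> Ob K. \<lambda>l \<in> carrier (val F A Y). r \<odot>\<^bsub>Hom K C Y\<^esub> \<eta> Y l)\<rparr>),
     act = (\<lambda>c a \<eta>. \<lambda>Y \<in> Ob K. \<lambda>l \<in> carrier (val F (cod K a) Y). \<eta> Y (pull K F Y a l) \<cdot>\<^bsub>K\<^esub> c)\<rparr>"

lemma neg_ext_eq: "neg_ext R K E n = hom_dual R K (pos_ext R K E n)"
  by (simp add: neg_ext_def hom_dual_def)

context bilinear_functor
begin

abbreviation dual :: "('r, 'o, 'm, 'o \<Rightarrow> 'x \<Rightarrow> 'm) bifun"
  where "dual \<equiv> hom_dual R K F"

abbreviation Dual :: "'o \<Rightarrow> 'o \<Rightarrow> ('o \<Rightarrow> 'x \<Rightarrow> 'm) set"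
  where "Dual C A \<equiv> carrier (val dual C A)"

lemma dual_linear: "\<lbrakk>\<eta> \<in> Dual C A; Y \<in> Ob K\<rbrakk> \<Longrightarrow> \<eta> Y \<in> lin_maps R (val F A Y) (Hom K C Y)"
  by (auto simp: hom_dual_def nat_trans_def cov_def)

lemma dual_closed: "\<lbrakk>\<eta> \<in> Dual C A; l \<in> carrier (val F A Y); Y \<in> Ob K\<rbrakk> \<Longrightarrow> \<eta> Y l \<in> arr K C Y"
  using dual_linear lin_maps_closed by metis

lemma dual_push: "\<lbrakk>\<eta> \<in> Dual C A; l \<in> carrier (val F A Y); f \<in> arr K Y Y'; C \<in> Ob K; Y \<in> Ob K; Y' \<in> Ob K\<rbrakk>
    \<Longrightarrow> \<eta> Y' (push K F A f l) = f \<star> \<eta> Y l"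
  using dual_closed[of \<eta> C A l Y] push_hom[of "\<eta> Y l" C Y f Y']
  by (auto simp: hom_dual_def nat_trans_def cov_def)

lemma dual_eqI:
  assumes "\<eta> \<in> Dual C A" "\<zeta> \<in> Dual C A"
    and "\<And>Y l. \<lbrakk>Y \<in> Ob K; l \<in> carrier (val F A Y)\<rbrakk> \<Longrightarrow> \<eta> Y l = \<zeta> Y l"
  shows "\<eta> = \<zeta>"
proof (intro ext)
  fix Y l
  show "\<eta> Y l = \<zeta> Y l"
  proof (cases "Y \<in> Ob K")
    case True
    then show ?thesis
      using assms(3)[OF True] lin_maps_extensional[OF dual_linear[OF assms(1) True]]
        lin_maps_extensional[OF dual_linear[OF assms(2) True]]
      by (cases "l \<in> carrier (val F A Y)") (auto simp: extensional_def)
  next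
    case False
    have "\<eta> \<in> extensional (Ob K)" "\<zeta> \<in> extensional (Ob K)"
      using assms by (auto simp: hom_dual_def nat_trans_def PiE_def)
    then show ?thesis using False by (simp add: extensional_def)
  qed
qed

lemma dual_restrictI:
  assumes "C \<in> Ob K" "A \<in> Ob K"
    and "\<And>Y l. \<lbrakk>Y \<in> Ob K; l \<in> carrier (val F A Y)\<rbrakk> \<Longrightarrow> h Y l \<in> arr K C Y"
    and "\<And>Y l l'. \<lbrakk>Y \<in> Ob K; l \<in> carrier (val F A Y); l' \<in> carrier (val F A Y)\<rbrakk>
      \<Longrightarrow> h Y (l \<oplus>\<^bsub>val F A Y\<^esub> l') = h Y l \<oplus>\<^bsub>Hom K C Y\<^esub> h Y l'"
    and "\<And>Y r l. \<lbrakk>Y \<in> Ob K; r \<in> carrier R; l \<in> carrier (val F A Y)\<rbrakk>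
      \<Longrightarrow> h Y (r \<odot>\<^bsub>val F A Y\<^esub> l) = r \<odot>\<^bsub>Hom K C Y\<^esub> h Y l"
    and "\<And>Y Y' f l. \<lbrakk>Y \<in> Ob K; Y' \<in> Ob K; f \<in> arr K Y Y'; l \<in> carrier (val F A Y)\<rbrakk>
      \<Longrightarrow> h Y' (push K F A f l) = f \<star> h Y l"
  shows "(\<lambda>Y \<in> Ob K. \<lambda>l \<in> carrier (val F A Y). h Y l) \<in> Dual C A"
proof -
  have "(\<lambda>l \<in> carrier (val F A Y). h Y l) \<in> lin_maps R (val F A Y) (Hom K C Y)" if "Y \<in> Ob K" for Y
    using that assms by (intro restrict_in_lin_maps val_module) auto
  moreover have "h Y' (push K F A f l) = push K (hom_bifun K) C f (h Y l)"
    if "Y \<in> Ob K" "Y' \<in> Ob K" "f \<in> arr K Y Y'" "l \<in> carrier (val F A Y)" for Y Y' f l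
    using that assms(3)[OF that(1,4)] assms(1,6) by simp
  ultimately show ?thesis
    using assms(1,2) by (auto simp: hom_dual_def nat_trans_def cov_def)
qed

lemma dual_add: "\<lbrakk>\<eta> \<in> Dual C A; l \<in> carrier (val F A Y); l' \<in> carrier (val F A Y); Y \<in> Ob K\<rbrakk>
    \<Longrightarrow> \<eta> Y (l \<oplus>\<^bsub>val F A Y\<^esub> l') = \<eta> Y l \<oplus>\<^bsub>Hom K C Y\<^esub> \<eta> Y l'"
  by (rule lin_maps_add[OF dual_linear])

lemma dual_smult: "\<lbrakk>\<eta> \<in> Dual C A; r \<in> carrier R; l \<in> carrier (val F A Y); Y \<in> Ob K\<rbrakk>
    \<Longrightarrow> \<eta> Y (r \<odot>\<^bsub>val F A Y\<^esub> l) = r \<odot>\<^bsub>Hom K C Y\<^esub> \<eta> Y l"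
  by (rule lin_maps_smult[OF dual_linear])

lemma add_dual_apply: "\<lbrakk>Y \<in> Ob K; l \<in> carrier (val F A Y)\<rbrakk>
    \<Longrightarrow> (\<eta> \<oplus>\<^bsub>val dual C A\<^esub> \<zeta>) Y l = \<eta> Y l \<oplus>\<^bsub>Hom K C Y\<^esub> \<zeta> Y l"
  and smult_dual_apply: "\<lbrakk>Y \<in> Ob K; l \<in> carrier (val F A Y)\<rbrakk>
    \<Longrightarrow> (r \<odot>\<^bsub>val dual C A\<^esub> \<eta>) Y l = r \<odot>\<^bsub>Hom K C Y\<^esub> \<eta> Y l"
  and zero_dual_apply: "\<lbrakk>Y \<in> Ob K; l \<in> carrier (val F A Y)\<rbrakk>
    \<Longrightarrow> \<zero>\<^bsub>val dual C A\<^esub> Y l = \<zero>\<^bsub>Hom K C Y\<^esub>"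
  by (simp_all add: hom_dual_def)

lemma act_dual_apply: "\<lbrakk>Y \<in> Ob K; l \<in> carrier (val F A' Y); a \<in> arr K A A'; A \<in> Ob K; A' \<in> Ob K\<rbrakk>
    \<Longrightarrow> act dual c a \<eta> Y l = \<eta> Y (pull K F Y a l) \<star> c"
  using dom_cod[of A A' a] by (simp add: hom_dual_def)

lemma push_dual_apply: "\<lbrakk>\<eta> \<in> Dual C A; Y \<in> Ob K; l \<in> carrier (val F A' Y); a \<in> arr K A A'; C \<in> Ob K; A \<in> Ob K; A' \<in> Ob K\<rbrakk>
    \<Longrightarrow> push K dual C a \<eta> Y l = \<eta> Y (pull K F Y a l)"
  using dual_closed[of \<eta> C A "pull K F Y a l" Y] cmp_ident_right[of "\<eta> Y (pull K F Y a l)" C Y]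
    pull_closed[of l A' Y a A]
  by (simp add: push_def act_dual_apply)

lemma pull_dual_apply: "\<lbrakk>\<eta> \<in> Dual C A; Y \<in> Ob K; l \<in> carrier (val F A Y); A \<in> Ob K\<rbrakk>
    \<Longrightarrow> pull K dual A c \<eta> Y l = \<eta> Y l \<star> c"
  using act_dual_apply[of Y l A "ident K A" A c \<eta>] pull_ident[of l A Y] by (simp add: pull_def[of K "dual"])

lemma add_dual_closed:
  assumes "\<eta> \<in> Dual C A" "\<zeta> \<in> Dual C A" "C \<in> Ob K" "A \<in> Ob K"
  shows "\<eta> \<oplus>\<^bsub>val dual C A\<^esub> \<zeta> \<in> Dual C A"
proof -
  have "(\<lambda>Y \<in> Ob K. \<lambda>l \<in> carrier (val F A Y). \<eta> Y l \<oplus>\<^bsub>Hom K C Y\<^esub> \<zeta> Y l) \<in> Dual C A"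
  proof (rule dual_restrictI[OF assms(3,4)])
    fix Y l l' assume Y: "Y \<in> Ob K" and l: "l \<in> carrier (val F A Y)" "l' \<in> carrier (val F A Y)"
    interpret H: abelian_group "Hom K C Y" using Y assms by (intro hom_group)
    note cl = dual_closed[OF assms(1) l(1) Y] dual_closed[OF assms(1) l(2) Y]
      dual_closed[OF assms(2) l(1) Y] dual_closed[OF assms(2) l(2) Y]
    show "\<eta> Y (l \<oplus>\<^bsub>val F A Y\<^esub> l') \<oplus>\<^bsub>Hom K C Y\<^esub> \<zeta> Y (l \<oplus>\<^bsub>val F A Y\<^esub> l')
        = (\<eta> Y l \<oplus>\<^bsub>Hom K C Y\<^esub> \<zeta> Y l) \<oplus>\<^bsub>Hom K C Y\<^esub> (\<eta> Y l' \<oplus>\<^bsub>Hom K C Y\<^esub> \<zeta> Y l')"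
      using cl by (simp add: dual_add[OF assms(1) l Y] dual_add[OF assms(2) l Y] H.a_ac)
  next
    fix Y r l assume Y: "Y \<in> Ob K" and r: "r \<in> carrier R" and l: "l \<in> carrier (val F A Y)"
    interpret H: module R "Hom K C Y" using Y assms by (intro hom_module)
    show "\<eta> Y (r \<odot>\<^bsub>val F A Y\<^esub> l) \<oplus>\<^bsub>Hom K C Y\<^esub> \<zeta> Y (r \<odot>\<^bsub>val F A Y\<^esub> l)
        = r \<odot>\<^bsub>Hom K C Y\<^esub> (\<eta> Y l \<oplus>\<^bsub>Hom K C Y\<^esub> \<zeta> Y l)"
      using r by (simp add: dual_smult[OF assms(1) r l Y] dual_smult[OF assms(2) r l Y] H.smult_r_distr
          dual_closed[OF assms(1) l Y] dual_closed[OF assms(2) l Y])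
  next
    fix Y Y' f l assume Y: "Y \<in> Ob K" "Y' \<in> Ob K" "f \<in> arr K Y Y'" and l: "l \<in> carrier (val F A Y)"
    then show "\<eta> Y' (push K F A f l) \<oplus>\<^bsub>Hom K C Y'\<^esub> \<zeta> Y' (push K F A f l) = f \<star> (\<eta> Y l \<oplus>\<^bsub>Hom K C Y\<^esub> \<zeta> Y l)"
      using assms dual_closed[OF assms(1) l] dual_closed[OF assms(2) l]
      by (simp add: dual_push[OF assms(1) l] dual_push[OF assms(2) l] cmp_add)
  next
    fix Y l assume "Y \<in> Ob K" "l \<in> carrier (val F A Y)"
    then show "\<eta> Y l \<oplus>\<^bsub>Hom K C Y\<^esub> \<zeta> Y l \<in> arr K C Y"
      using assms dual_closed[of \<eta> C A l Y] dual_closed[of \<zeta> C A l Y] by simp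
  qed
  then show ?thesis by (simp add: hom_dual_def)
qed

lemma smult_dual_closed:
  assumes "\<eta> \<in> Dual C A" "r \<in> carrier R" "C \<in> Ob K" "A \<in> Ob K"
  shows "r \<odot>\<^bsub>val dual C A\<^esub> \<eta> \<in> Dual C A"
proof -
  have "(\<lambda>Y \<in> Ob K. \<lambda>l \<in> carrier (val F A Y). r \<odot>\<^bsub>Hom K C Y\<^esub> \<eta> Y l) \<in> Dual C A"
  proof (rule dual_restrictI[OF assms(3,4)])
    fix Y l l' assume Y: "Y \<in> Ob K" and l: "l \<in> carrier (val F A Y)" "l' \<in> carrier (val F A Y)"
    interpret H: module R "Hom K C Y" using Y assms by (intro hom_module)
    show "r \<odot>\<^bsub>Hom K C Y\<^esub> \<eta> Y (l \<oplus>\<^bsub>val F A Y\<^esub> l') = r \<odot>\<^bsub>Hom K C Y\<^esub> \<eta> Y l \<oplus>\<^bsub>Hom K C Y\<^esub> r \<odot>\<^bsub>Hom K C Y\<^esub> \<eta> Y l'"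
      using assms dual_closed[OF assms(1) l(1) Y] dual_closed[OF assms(1) l(2) Y]
      by (simp add: dual_add[OF assms(1) l Y] H.smult_r_distr)
  next
    fix Y r' l assume Y: "Y \<in> Ob K" and r: "r' \<in> carrier R" and l: "l \<in> carrier (val F A Y)"
    interpret H: module R "Hom K C Y" using Y assms by (intro hom_module)
    show "r \<odot>\<^bsub>Hom K C Y\<^esub> \<eta> Y (r' \<odot>\<^bsub>val F A Y\<^esub> l) = r' \<odot>\<^bsub>Hom K C Y\<^esub> (r \<odot>\<^bsub>Hom K C Y\<^esub> \<eta> Y l)"
      using r assms dual_closed[OF assms(1) l Y]
      by (simp add: dual_smult[OF assms(1) r l Y] H.smult_assoc1[symmetric] H.R.m_comm)
  next
    fix Y Y' f l assume Y: "Y \<in> Ob K" "Y' \<in> Ob K" "f \<in> arr K Y Y'" and l: "l \<in> carrier (val F A Y)"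
    then show "r \<odot>\<^bsub>Hom K C Y'\<^esub> \<eta> Y' (push K F A f l) = f \<star> (r \<odot>\<^bsub>Hom K C Y\<^esub> \<eta> Y l)"
      using assms dual_closed[OF assms(1) l] by (simp add: dual_push[OF assms(1) l] cmp_smult)
  next
    fix Y l assume "Y \<in> Ob K" "l \<in> carrier (val F A Y)"
    then show "r \<odot>\<^bsub>Hom K C Y\<^esub> \<eta> Y l \<in> arr K C Y"
      using assms dual_closed[of \<eta> C A l Y] by simp
  qed
  then show ?thesis by (simp add: hom_dual_def)
qed

lemma zero_dual_closed:
  assumes "C \<in> Ob K" "A \<in> Ob K"
  shows "\<zero>\<^bsub>val dual C A\<^esub> \<in> Dual C A"
proof -
  have "(\<lambda>Y \<in> Ob K. \<lambda>l \<in> carrier (val F A Y). \<zero>\<^bsub>Hom K C Y\<^esub>) \<in> Dual C A"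
    by (rule dual_restrictI[OF assms]) (use assms in \<open>auto simp: hom_l_zero cmp_zero module.smult_r_null[OF hom_module]\<close>)
  then show ?thesis by (simp add: hom_dual_def)
qed

lemma act_dual_closed:
  assumes "\<eta> \<in> Dual C A" "c \<in> arr K C' C" "a \<in> arr K A A'" "C \<in> Ob K" "A \<in> Ob K" "C' \<in> Ob K" "A' \<in> Ob K"
  shows "act dual c a \<eta> \<in> Dual C' A'"
proof -
  have p: "pull K F Y a l \<in> carrier (val F A Y)" if "Y \<in> Ob K" "l \<in> carrier (val F A' Y)" for Y l
    using that assms by (intro pull_closed[of l A'])
  have cl: "\<eta> Y (pull K F Y a l) \<in> arr K C Y" if "Y \<in> Ob K" "l \<in> carrier (val F A' Y)" for Y l
    using that by (intro dual_closed[OF assms(1)] p)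
  have "(\<lambda>Y \<in> Ob K. \<lambda>l \<in> carrier (val F A' Y). \<eta> Y (pull K F Y a l) \<star> c) \<in> Dual C' A'"
  proof (rule dual_restrictI[OF assms(6,7)])
    fix Y Y' f l assume Y: "Y \<in> Ob K" "Y' \<in> Ob K" "f \<in> arr K Y Y'" and l: "l \<in> carrier (val F A' Y)"
    have "pull K F Y' a (push K F A' f l) = push K F A f (pull K F Y a l)"
      by (rule pull_push) (use Y l assms in auto)
    then show "\<eta> Y' (pull K F Y' a (push K F A' f l)) \<star> c = f \<star> (\<eta> Y (pull K F Y a l) \<star> c)"
      using dual_push[OF assms(1) p[OF Y(1) l] Y(3) assms(4) Y(1,2)]
        assoc[OF assms(2) cl[OF Y(1) l] Y(3) assms(6,4) Y(1,2)] by simp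
  next
    fix Y l l' assume Y: "Y \<in> Ob K" and l: "l \<in> carrier (val F A' Y)" "l' \<in> carrier (val F A' Y)"
    show "\<eta> Y (pull K F Y a (l \<oplus>\<^bsub>val F A' Y\<^esub> l')) \<star> c
        = \<eta> Y (pull K F Y a l) \<star> c \<oplus>\<^bsub>Hom K C' Y\<^esub> \<eta> Y (pull K F Y a l') \<star> c"
      using pull_add[OF assms(3) l assms(7,5) Y] dual_add[OF assms(1) p[OF Y l(1)] p[OF Y l(2)] Y]
        add_cmp[OF assms(2) cl[OF Y l(1)] cl[OF Y l(2)] assms(6,4) Y] by simp
  next
    fix Y r l assume Y: "Y \<in> Ob K" and r: "r \<in> carrier R" and l: "l \<in> carrier (val F A' Y)"
    show "\<eta> Y (pull K F Y a (r \<odot>\<^bsub>val F A' Y\<^esub> l)) \<star> c = r \<odot>\<^bsub>Hom K C' Y\<^esub> (\<eta> Y (pull K F Y a l) \<star> c)"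
      using pull_smult[OF assms(3) r l assms(7,5) Y] dual_smult[OF assms(1) r p[OF Y l] Y]
        smult_cmp[OF assms(2) r cl[OF Y l] assms(6,4) Y] by simp
  next
    fix Y l assume Y: "Y \<in> Ob K" and l: "l \<in> carrier (val F A' Y)"
    show "\<eta> Y (pull K F Y a l) \<star> c \<in> arr K C' Y"
      by (rule cmp_arr[OF assms(2) cl[OF Y l] assms(6,4) Y])
  qed
  then show ?thesis using dom_cod[OF assms(5,7,3)] by (simp add: hom_dual_def)
qed

lemma dual_module:
  assumes CA: "C \<in> Ob K" "A \<in> Ob K"
  shows "module R (val dual C A)"
proof -
  note H = hom_module[OF CA(1)] and R = cring.cring_simprules[OF cring_R]
  note group = abelian_group.axioms(1)[OF hom_group[OF CA(1)]]
  note pointwise = add_dual_apply smult_dual_apply zero_dual_apply dual_closed[of _ C A]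
    abelian_monoid.a_assoc[OF group] abelian_monoid.a_comm[OF group] abelian_monoid.l_zero[OF group]
    module.smult_l_distr[OF H] module.smult_r_distr[OF H] module.smult_assoc1[OF H] module.smult_one[OF H]
  note closed = add_dual_closed[OF _ _ CA] smult_dual_closed[OF _ _ CA] zero_dual_closed[OF CA]
  show ?thesis
  proof (intro moduleI abelian_groupI cring_R closed)
    fix \<eta> assume e: "\<eta> \<in> Dual C A"
    let ?\<zeta> = "(\<ominus>\<^bsub>R\<^esub> \<one>\<^bsub>R\<^esub>) \<odot>\<^bsub>val dual C A\<^esub> \<eta>"
    have "?\<zeta> \<oplus>\<^bsub>val dual C A\<^esub> \<eta> = \<zero>\<^bsub>val dual C A\<^esub>"
    proof (rule dual_eqI[of _ C A])
      fix Y l assume Y: "Y \<in> Ob K" and l: "l \<in> carrier (val F A Y)"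
      interpret H: module R "Hom K C Y" using H Y .
      show "(?\<zeta> \<oplus>\<^bsub>val dual C A\<^esub> \<eta>) Y l = \<zero>\<^bsub>val dual C A\<^esub> Y l"
        using dual_closed[OF e l Y] Y l
        by (simp add: add_dual_apply smult_dual_apply zero_dual_apply H.smult_l_minus H.M.l_neg)
    qed (use e closed R in auto)
    then show "\<exists>\<zeta> \<in> Dual C A. \<zeta> \<oplus>\<^bsub>val dual C A\<^esub> \<eta> = \<zero>\<^bsub>val dual C A\<^esub>"
      using closed(2)[OF e] R by blast
  qed (assumption | (rule dual_eqI[of _ C A]; simp add: pointwise closed R))+
qed

lemma act_dual_eqI:
  assumes "\<eta> \<in> Dual C A" "c \<in> arr K C' C" "a \<in> arr K A A'" "C \<in> Ob K" "A \<in> Ob K" "C' \<in> Ob K" "A' \<in> Ob K"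
    and "\<zeta> \<in> Dual C' A'"
    and "\<And>Y l. \<lbrakk>Y \<in> Ob K; l \<in> carrier (val F A' Y); pull K F Y a l \<in> carrier (val F A Y)\<rbrakk>
      \<Longrightarrow> \<eta> Y (pull K F Y a l) \<star> c = \<zeta> Y l"
  shows "act dual c a \<eta> = \<zeta>"
  using assms
  by (intro dual_eqI[OF act_dual_closed[OF assms(1-7)] assms(8)]) (simp add: act_dual_apply[of _ _ A' a A] pull_closed[of _ A' _ a A])

lemma dual_bilinear: "bilinear_functor R K dual"
proof (rule bilinear_functorI[OF dual_module])
  fix C A C' A' c a
  assume ob: "C \<in> Ob K" "A \<in> Ob K" "C' \<in> Ob K" "A' \<in> Ob K" and c: "c \<in> arr K C' C" and a: "a \<in> arr K A A'"
  note closed = act_dual_closed[OF _ _ _ ob] add_dual_closed smult_dual_closed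
  note pointwise = add_dual_apply smult_dual_apply act_dual_apply[of _ _ A' _ A] dual_closed[of _ C A]
    dual_add[of _ C A] dual_smult[of _ C A] pull_closed[of _ A' _ _ A]
    add_cmp[of _ C' C] smult_cmp[of _ C' C] cmp_add[of _ C] cmp_smult[of _ C]
  note eqI = act_dual_eqI[OF _ _ _ ob]
  show "(\<lambda>u \<in> Dual C A. act dual c a u)
      \<in> lin_maps R (val dual C A) (val dual C' A')"
    using c a ob
    by (intro restrict_in_lin_maps[OF dual_module[OF ob(1,2)]] eqI closed) (simp_all add: closed pointwise)
  fix \<eta> assume e: "\<eta> \<in> Dual C A"
  {
    fix c' assume c': "c' \<in> arr K C' C"
    show "act dual (c \<oplus>\<^bsub>Hom K C' C\<^esub> c') a \<eta>
        = act dual c a \<eta> \<oplus>\<^bsub>val dual C' A'\<^esub> act dual c' a \<eta>"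
      using e c c' a ob by (intro eqI closed) (simp_all add: pointwise)
  next
    fix r assume r: "r \<in> carrier R"
    show "act dual (r \<odot>\<^bsub>Hom K C' C\<^esub> c) a \<eta>
        = r \<odot>\<^bsub>val dual C' A'\<^esub> act dual c a \<eta>"
      using e c r a ob by (intro eqI closed) (simp_all add: pointwise)
    show "act dual c (r \<odot>\<^bsub>Hom K A A'\<^esub> a) \<eta>
        = r \<odot>\<^bsub>val dual C' A'\<^esub> act dual c a \<eta>"
      using e c r a ob by (intro eqI closed) (simp_all add: pointwise pull_smult_mor[of _ A'])
  next
    fix a' assume a': "a' \<in> arr K A A'"
    show "act dual c (a \<oplus>\<^bsub>Hom K A A'\<^esub> a') \<eta>
        = act dual c a \<eta> \<oplus>\<^bsub>val dual C' A'\<^esub> act dual c a' \<eta>"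
      using e c a a' ob by (intro eqI closed) (simp_all add: pointwise pull_add_mor[of _ A'])
  next
    fix C'' A'' c' a' assume ob': "C'' \<in> Ob K" "A'' \<in> Ob K" and c': "c' \<in> arr K C'' C'" and a': "a' \<in> arr K A' A''"
    show "act dual (c \<star> c') (a' \<star> a) \<eta>
        = act dual c' a' (act dual c a \<eta>)"
    proof (rule act_dual_eqI[OF e _ _ ob(1,2) ob' act_dual_closed[OF act_dual_closed[OF e c a ob] c' a' ob(3,4) ob']])
      fix Y l assume Y: "Y \<in> Ob K" and l: "l \<in> carrier (val F A'' Y)"
      have pl: "pull K F Y a' l \<in> carrier (val F A' Y)"
        by (rule pull_closed[OF l a' ob'(2) ob(4) Y])
      then show "\<eta> Y (pull K F Y (a' \<star> a) l) \<star> (c \<star> c')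
          = act dual c' a' (act dual c a \<eta>) Y l"
        using Y l a a' c c' ob ob' e dual_closed[OF e pull_closed[OF pl a ob(4,2) Y] Y]
        by (simp add: act_dual_apply[of _ _ A'' _ A'] act_dual_apply[of _ _ A' _ A] pull_cmp[of l A'' Y a' A' a A]
            assoc[of c' C'' C' c C, symmetric])
    qed (use c c' a a' ob ob' in \<open>auto intro: cmp_in\<close>)
  }
next
  fix C A \<eta> assume *: "C \<in> Ob K" "A \<in> Ob K" "\<eta> \<in> Dual C A"
  then show "act dual (ident K C) (ident K A) \<eta> = \<eta>"
    by (intro act_dual_eqI[of _ C A _ C _ A]) (auto simp: cmp_ident_right[OF dual_closed[OF *(3)]])
qed

end

subsection \<open>Negative extensions as an effaceable sequence\<close>

declare pos_ext.simps [simp del] cup.simps [simp del]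

context extriangulated_category
begin

sublocale N: bilinear_functor R K "neg_ext R K E n" for n
  unfolding neg_ext_eq by (rule P.dual_bilinear)

abbreviation Neg :: "nat \<Rightarrow> 'o \<Rightarrow> 'o \<Rightarrow> ('o \<Rightarrow> ('o, 'm, 'e) pos \<Rightarrow> 'm) set"
  where "Neg n X A \<equiv> carrier (val (neg_ext R K E n) X A)"

lemmas neg_linear = P.dual_linear[folded neg_ext_eq]
  and neg_closed = P.dual_closed[folded neg_ext_eq]
  and neg_push_arg = P.dual_push[folded neg_ext_eq]
  and neg_eqI = P.dual_eqI[folded neg_ext_eq]
  and neg_restrictI = P.dual_restrictI[folded neg_ext_eq]
  and neg_add = P.dual_add[folded neg_ext_eq]
  and neg_smult = P.dual_smult[folded neg_ext_eq]
  and add_neg_apply = P.add_dual_apply[folded neg_ext_eq]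
  and smult_neg_apply = P.smult_dual_apply[folded neg_ext_eq]
  and zero_neg_apply = P.zero_dual_apply[folded neg_ext_eq]
  and push_neg_apply = P.push_dual_apply[folded neg_ext_eq]
  and pull_neg_apply = P.pull_dual_apply[folded neg_ext_eq]

lemma neg_conn_apply: "\<lbrakk>\<eta> \<in> Neg (Suc n) X C; l \<in> Pos n A Y; X \<in> Ob K; Y \<in> Ob K\<rbrakk>
    \<Longrightarrow> neg_conn R K E n C A \<delta> X \<eta> Y l = \<eta> Y (cup R K E n C A \<delta> Y l)"
  by (simp add: neg_conn_def)

lemma neg_conn_closed:
  assumes \<eta>: "\<eta> \<in> Neg (Suc n) X C" and \<delta>: "\<delta> \<in> Ext C A" and ob: "C \<in> Ob K" "A \<in> Ob K" "X \<in> Ob K"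
  shows "neg_conn R K E n C A \<delta> X \<eta> \<in> Neg n X A"
proof -
  have "(\<lambda>Y \<in> Ob K. \<lambda>l \<in> Pos n A Y. \<eta> Y (cup R K E n C A \<delta> Y l)) \<in> Neg n X A"
  proof (rule neg_restrictI[OF ob(3,2)])
    fix Y l assume Y: "Y \<in> Ob K" and l: "l \<in> Pos n A Y"
    show "\<eta> Y (cup R K E n C A \<delta> Y l) \<in> arr K X Y"
      by (rule neg_closed[OF \<eta> cup_closed[OF l \<delta> ob(1,2) Y] Y])
    show "\<eta> Y (cup R K E n C A \<delta> Y (l \<oplus>\<^bsub>val (pos_ext R K E n) A Y\<^esub> l'))
        = \<eta> Y (cup R K E n C A \<delta> Y l) \<oplus>\<^bsub>Hom K X Y\<^esub> \<eta> Y (cup R K E n C A \<delta> Y l')" if l': "l' \<in> Pos n A Y" for l'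
      using cup_add[OF l l' \<delta> ob(1,2) Y] neg_add[OF \<eta> cup_closed[OF l \<delta> ob(1,2) Y] cup_closed[OF l' \<delta> ob(1,2) Y] Y]
      by simp
    show "\<eta> Y (cup R K E n C A \<delta> Y (r \<odot>\<^bsub>val (pos_ext R K E n) A Y\<^esub> l)) = r \<odot>\<^bsub>Hom K X Y\<^esub> \<eta> Y (cup R K E n C A \<delta> Y l)"
      if r: "r \<in> carrier R" for r
      using cup_smult[OF l r \<delta> ob(1,2) Y] neg_smult[OF \<eta> r cup_closed[OF l \<delta> ob(1,2) Y] Y] by simp
    show "\<eta> Y' (cup R K E n C A \<delta> Y' (push K (pos_ext R K E n) A f l)) = f \<star> \<eta> Y (cup R K E n C A \<delta> Y l)"
      if Y': "Y' \<in> Ob K" and f: "f \<in> arr K Y Y'" for Y' f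
      using cup_push_arg[OF l f \<delta> ob(1,2) Y Y'] neg_push_arg[OF \<eta> cup_closed[OF l \<delta> ob(1,2) Y] f ob(3) Y Y'] by simp
  qed
  then show ?thesis using \<eta> ob by (simp add: neg_conn_def)
qed

lemma neg_conn_linear:
  assumes \<delta>: "\<delta> \<in> Ext C A" and ob: "C \<in> Ob K" "A \<in> Ob K" "X \<in> Ob K"
  shows "neg_conn R K E n C A \<delta> X \<in> lin_maps R (val (neg_ext R K E (Suc n)) X C) (val (neg_ext R K E n) X A)"
proof -
  note closed = neg_conn_closed[OF _ \<delta> ob]
  note c = cup_closed[OF _ \<delta> ob(1,2)]
  have "(\<lambda>\<eta> \<in> Neg (Suc n) X C. neg_conn R K E n C A \<delta> X \<eta>)
      \<in> lin_maps R (val (neg_ext R K E (Suc n)) X C) (val (neg_ext R K E n) X A)"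
  proof (rule restrict_in_lin_maps[OF N.val_module[OF ob(3,1)] closed])
    fix \<eta> \<zeta> assume e: "\<eta> \<in> Neg (Suc n) X C" "\<zeta> \<in> Neg (Suc n) X C"
    show "neg_conn R K E n C A \<delta> X (\<eta> \<oplus>\<^bsub>val (neg_ext R K E (Suc n)) X C\<^esub> \<zeta>)
        = neg_conn R K E n C A \<delta> X \<eta> \<oplus>\<^bsub>val (neg_ext R K E n) X A\<^esub> neg_conn R K E n C A \<delta> X \<zeta>"
    proof (rule neg_eqI[of _ n X A])
      fix Y l assume Y: "Y \<in> Ob K" and l: "l \<in> Pos n A Y"
      show "neg_conn R K E n C A \<delta> X (\<eta> \<oplus>\<^bsub>val (neg_ext R K E (Suc n)) X C\<^esub> \<zeta>) Y l
          = (neg_conn R K E n C A \<delta> X \<eta> \<oplus>\<^bsub>val (neg_ext R K E n) X A\<^esub> neg_conn R K E n C A \<delta> X \<zeta>) Y l"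
        using e ob Y l c[OF l Y] by (simp add: add_neg_apply neg_conn_apply)
    qed (use e ob closed in auto)
  next
    fix r \<eta> assume r: "r \<in> carrier R" and e: "\<eta> \<in> Neg (Suc n) X C"
    show "neg_conn R K E n C A \<delta> X (r \<odot>\<^bsub>val (neg_ext R K E (Suc n)) X C\<^esub> \<eta>)
        = r \<odot>\<^bsub>val (neg_ext R K E n) X A\<^esub> neg_conn R K E n C A \<delta> X \<eta>"
    proof (rule neg_eqI[of _ n X A])
      fix Y l assume Y: "Y \<in> Ob K" and l: "l \<in> Pos n A Y"
      show "neg_conn R K E n C A \<delta> X (r \<odot>\<^bsub>val (neg_ext R K E (Suc n)) X C\<^esub> \<eta>) Y l
          = (r \<odot>\<^bsub>val (neg_ext R K E n) X A\<^esub> neg_conn R K E n C A \<delta> X \<eta>) Y l"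
        using e r ob Y l c[OF l Y] by (simp add: smult_neg_apply neg_conn_apply)
    qed (use e r ob closed in auto)
  qed
  moreover have "(\<lambda>\<eta> \<in> Neg (Suc n) X C. neg_conn R K E n C A \<delta> X \<eta>) = neg_conn R K E n C A \<delta> X"
    using ob by (auto simp: neg_conn_def)
  ultimately show ?thesis by simp
qed

lemma neg_connected: "connected_sequence R K E s (neg_ext R K E) (neg_conn R K E)"
proof (rule connected_sequence.intro[OF extriangulated_category_axioms], rule connected_sequence_axioms.intro)
  show "bilinear_functor R K (neg_ext R K E n)" for n
    by (rule N.bilinear_functor_axioms)
next
  fix C A \<delta> n assume ob: "C \<in> Ob K" "A \<in> Ob K" and \<delta>: "\<delta> \<in> Ext C A"
  have nat: "neg_conn R K E n C A \<delta> X' (pull K (neg_ext R K E (Suc n)) C f \<eta>)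
      = pull K (neg_ext R K E n) A f (neg_conn R K E n C A \<delta> X \<eta>)"
    if X: "X \<in> Ob K" "X' \<in> Ob K" and f: "f \<in> arr K X' X" and \<eta>: "\<eta> \<in> Neg (Suc n) X C" for X X' f \<eta>
  proof (rule neg_eqI[of _ n X' A])
    have p: "pull K (neg_ext R K E (Suc n)) C f \<eta> \<in> Neg (Suc n) X' C"
      by (rule N.pull_closed[OF \<eta> f X ob(1)])
    show "neg_conn R K E n C A \<delta> X' (pull K (neg_ext R K E (Suc n)) C f \<eta>) \<in> Neg n X' A"
      by (rule neg_conn_closed[OF p \<delta> ob X(2)])
    show "pull K (neg_ext R K E n) A f (neg_conn R K E n C A \<delta> X \<eta>) \<in> Neg n X' A"
      by (rule N.pull_closed[OF neg_conn_closed[OF \<eta> \<delta> ob X(1)] f X ob(2)])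
    fix Y l assume Y: "Y \<in> Ob K" and l: "l \<in> Pos n A Y"
    show "neg_conn R K E n C A \<delta> X' (pull K (neg_ext R K E (Suc n)) C f \<eta>) Y l
        = pull K (neg_ext R K E n) A f (neg_conn R K E n C A \<delta> X \<eta>) Y l"
      using neg_conn_apply[OF p l X(2) Y, of \<delta>] neg_conn_apply[OF \<eta> l X(1) Y, of \<delta>]
        pull_neg_apply[OF neg_conn_closed[OF \<eta> \<delta> ob X(1)] Y l ob(2), of f]
        pull_neg_apply[OF \<eta> Y cup_closed[OF l \<delta> ob Y] ob(1), of f] by simp
  qed
  have "neg_conn R K E n C A \<delta> \<in> extensional (Ob K)"
    by (simp add: neg_conn_def)
  then show "neg_conn R K E n C A \<delta>
      \<in> nat_trans R (opp K) (contra K (neg_ext R K E (Suc n)) C) (contra K (neg_ext R K E n) A)"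
    using neg_conn_linear[OF \<delta> ob, of _ n] nat by (auto simp: nat_trans_def contra_def opp_def PiE_def)
next
  fix C A C' A' \<delta> \<delta>' a c X \<eta> n
  assume ob: "C \<in> Ob K" "A \<in> Ob K" "C' \<in> Ob K" "A' \<in> Ob K" and \<delta>: "\<delta> \<in> Ext C A" "\<delta>' \<in> Ext C' A'"
    and mor: "ext_morphism K E C A \<delta> C' A' \<delta>' a c" and X: "X \<in> Ob K" and \<eta>: "\<eta> \<in> Neg (Suc n) X C"
  have a: "a \<in> arr K A A'" and c: "c \<in> arr K C C'" and eq: "push K E C a \<delta> = pull K E A' c \<delta>'"
    using mor by (auto simp: ext_morphism_def)
  have p: "push K (neg_ext R K E (Suc n)) X c \<eta> \<in> Neg (Suc n) X C'"
    by (rule N.push_closed[OF \<eta> c X ob(1,3)])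
  have q: "neg_conn R K E n C A \<delta> X \<eta> \<in> Neg n X A"
    by (rule neg_conn_closed[OF \<eta> \<delta>(1) ob(1,2) X])
  show "push K (neg_ext R K E n) X a (neg_conn R K E n C A \<delta> X \<eta>)
      = neg_conn R K E n C' A' \<delta>' X (push K (neg_ext R K E (Suc n)) X c \<eta>)"
  proof (rule neg_eqI[of _ n X A'])
    show "push K (neg_ext R K E n) X a (neg_conn R K E n C A \<delta> X \<eta>) \<in> Neg n X A'"
      by (rule N.push_closed[OF q a X ob(2,4)])
    show "neg_conn R K E n C' A' \<delta>' X (push K (neg_ext R K E (Suc n)) X c \<eta>) \<in> Neg n X A'"
      by (rule neg_conn_closed[OF p \<delta>(2) ob(3,4) X])
    fix Y l assume Y: "Y \<in> Ob K" and l: "l \<in> Pos n A' Y"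
    have "push K (neg_ext R K E n) X a (neg_conn R K E n C A \<delta> X \<eta>) Y l
        = \<eta> Y (cup R K E n C A \<delta> Y (pull K (pos_ext R K E n) Y a l))"
      using push_neg_apply[OF q Y l a X ob(2,4)]
        neg_conn_apply[OF \<eta> P.pull_closed[OF l a ob(4,2) Y] X Y, of \<delta>] by simp
    also have "\<dots> = \<eta> Y (pull K (pos_ext R K E (Suc n)) Y c (cup R K E n C' A' \<delta>' Y l))"
      using cup_push[OF l a \<delta>(1) ob(1,2,4) Y] cup_pull[OF l c \<delta>(2) ob(3,1,4) Y] eq by simp
    also have "\<dots> = neg_conn R K E n C' A' \<delta>' X (push K (neg_ext R K E (Suc n)) X c \<eta>) Y l"
      using neg_conn_apply[OF p l X Y, of \<delta>'] push_neg_apply[OF \<eta> Y cup_closed[OF l \<delta>(2) ob(3,4) Y] c X ob(1,3)]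
      by simp
    finally show "push K (neg_ext R K E n) X a (neg_conn R K E n C A \<delta> X \<eta>) Y l
        = neg_conn R K E n C' A' \<delta>' X (push K (neg_ext R K E (Suc n)) X c \<eta>) Y l" .
  qed
qed

subsubsection \<open>Degree zero\<close>

lemma pos0_carrier: "Pos 0 A Y = Hom_el ` arr K A Y"
  by (simp add: pos_ext.simps)

definition yoneda_inv :: "'o \<Rightarrow> 'm \<Rightarrow> 'o \<Rightarrow> ('o, 'm, 'e) pos \<Rightarrow> 'm"
  where "yoneda_inv A t = (\<lambda>Y \<in> Ob K. \<lambda>l \<in> Pos 0 A Y. the_inv Hom_el l \<star> t)"

lemma yoneda_inv_apply: "\<lbrakk>f \<in> arr K A Y; Y \<in> Ob K\<rbrakk> \<Longrightarrow> yoneda_inv A t Y (Hom_el f) = f \<star> t"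
  by (simp add: yoneda_inv_def pos0_carrier)

lemma yoneda_inv_closed:
  assumes "t \<in> arr K X A" "X \<in> Ob K" "A \<in> Ob K"
  shows "yoneda_inv A t \<in> Neg 0 X A"
  unfolding yoneda_inv_def
proof (rule neg_restrictI[OF assms(2,3)])
  fix Y l assume Y: "Y \<in> Ob K" and l: "l \<in> Pos 0 A Y"
  then obtain f where f: "f \<in> arr K A Y" "l = Hom_el f" by (auto simp: pos0_carrier)
  show "the_inv Hom_el l \<star> t \<in> arr K X Y"
    using f assms Y by simp
  show "the_inv Hom_el (r \<odot>\<^bsub>val (pos_ext R K E 0) A Y\<^esub> l) \<star> t = r \<odot>\<^bsub>Hom K X Y\<^esub> (the_inv Hom_el l \<star> t)"
    if "r \<in> carrier R" for r
    using f assms Y that by (simp add: smult_pos0 smult_cmp)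
  show "the_inv Hom_el (l \<oplus>\<^bsub>val (pos_ext R K E 0) A Y\<^esub> l') \<star> t
      = the_inv Hom_el l \<star> t \<oplus>\<^bsub>Hom K X Y\<^esub> the_inv Hom_el l' \<star> t" if "l' \<in> Pos 0 A Y" for l'
    using f assms Y that by (auto simp: pos0_carrier add_pos0 add_cmp)
  show "the_inv Hom_el (push K (pos_ext R K E 0) A h l) \<star> t = h \<star> (the_inv Hom_el l \<star> t)"
    if "Y' \<in> Ob K" "h \<in> arr K Y Y'" for Y' h
    using f assms Y that assoc[of t X A f Y h Y'] by (simp add: push_pos0[of f A Y h Y'])
qed

lemma neg0_apply:
  assumes "\<eta> \<in> Neg 0 X A" "f \<in> arr K A Y" "X \<in> Ob K" "A \<in> Ob K" "Y \<in> Ob K"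
  shows "\<eta> Y (Hom_el f) = f \<star> \<eta> A (Hom_el (ident K A))"
  using neg_push_arg[OF assms(1) _ assms(2,3,4,5), of "Hom_el (ident K A)"] push_pos0[of "ident K A" A A f Y] assms
  by (simp add: pos0_carrier)

lemma neg0_ident: "\<lbrakk>\<eta> \<in> Neg 0 X A; A \<in> Ob K\<rbrakk> \<Longrightarrow> \<eta> A (Hom_el (ident K A)) \<in> arr K X A"
  by (rule neg_closed) (auto simp: pos0_carrier)

lemma neg0_eqI:
  assumes "\<eta> \<in> Neg 0 X A" "\<zeta> \<in> Neg 0 X A" "X \<in> Ob K" "A \<in> Ob K"
    and "\<eta> A (Hom_el (ident K A)) = \<zeta> A (Hom_el (ident K A))"
  shows "\<eta> = \<zeta>"
proof (rule neg_eqI[OF assms(1,2)])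
  fix Y l assume Y: "Y \<in> Ob K" and "l \<in> Pos 0 A Y"
  then obtain f where "f \<in> arr K A Y" "l = Hom_el f" by (auto simp: pos0_carrier)
  then show "\<eta> Y l = \<zeta> Y l"
    using neg0_apply[OF assms(1) _ assms(3,4) Y] neg0_apply[OF assms(2) _ assms(3,4) Y] assms(5) by simp
qed

lemma yoneda_iso: "yoneda R K E \<in> bifun_iso R K (neg_ext R K E 0) (hom_bifun K)"
proof -
  have y: "yoneda R K E X A \<eta> = \<eta> A (Hom_el (ident K A))" if "X \<in> Ob K" "A \<in> Ob K" "\<eta> \<in> Neg 0 X A" for X A \<eta>
    using that by (simp add: yoneda_def)
  have id: "Hom_el (ident K A) \<in> Pos 0 A A" if "A \<in> Ob K" for A
    using that by (auto simp: pos0_carrier)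
  have "yoneda R K E \<in> bifun_trans R K (neg_ext R K E 0) (hom_bifun K)"
  proof (rule bifun_transI[OF N.bilinear_functor_axioms hom_bifun_bilinear])
    fix X A assume X: "X \<in> Ob K" "A \<in> Ob K"
    have "(\<lambda>\<eta> \<in> Neg 0 X A. \<eta> A (Hom_el (ident K A))) \<in> lin_maps R (val (neg_ext R K E 0) X A) (Hom K X A)"
      by (rule restrict_in_lin_maps[OF N.val_module[OF X]])
        (use X in \<open>auto simp: neg0_ident add_neg_apply[OF _ id] smult_neg_apply[OF _ id]\<close>)
    then show "yoneda R K E X A \<in> lin_maps R (val (neg_ext R K E 0) X A) (val (hom_bifun K) X A)"
      using X by (simp add: yoneda_def)
  next
    fix X A A' a \<eta> assume *: "X \<in> Ob K" "A \<in> Ob K" "A' \<in> Ob K" "a \<in> arr K A A'" "\<eta> \<in> Neg 0 X A"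
    have "push K (neg_ext R K E 0) X a \<eta> A' (Hom_el (ident K A')) = a \<star> \<eta> A (Hom_el (ident K A))"
      using push_neg_apply[OF *(5,3) id[OF *(3)] *(4,1,2,3)] pull_pos0[of "ident K A'" A' A' a A] *
        neg0_apply[OF *(5,4,1,2,3)] by simp
    then show "yoneda R K E X A' (push K (neg_ext R K E 0) X a \<eta>) = push K (hom_bifun K) X a (yoneda R K E X A \<eta>)"
      using * y[OF *(1,3) N.push_closed[OF *(5,4,1,2,3)]] y[OF *(1,2,5)] push_hom[OF neg0_ident[OF *(5,2)] *(4,1,2,3)]
      by simp
  next
    fix X X' A c \<eta> assume *: "X \<in> Ob K" "X' \<in> Ob K" "A \<in> Ob K" "c \<in> arr K X' X" "\<eta> \<in> Neg 0 X A"
    show "yoneda R K E X' A (pull K (neg_ext R K E 0) A c \<eta>) = pull K (hom_bifun K) A c (yoneda R K E X A \<eta>)"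
      using * y[OF *(2,3) N.pull_closed[OF *(5,4,1,2,3)]] y[OF *(1,3,5)] pull_hom[OF neg0_ident[OF *(5,3)] *(4,1,2,3)]
        pull_neg_apply[OF *(5,3) id[OF *(3)] *(3)] by simp
  qed (auto simp: yoneda_def)
  moreover have "bij_betw (yoneda R K E X A) (Neg 0 X A) (arr K X A)" if X: "X \<in> Ob K" "A \<in> Ob K" for X A
  proof (rule bij_betwI[where g = "yoneda_inv A"])
    show "yoneda R K E X A \<in> Neg 0 X A \<rightarrow> arr K X A"
      using X by (auto simp: y neg0_ident)
    show "yoneda_inv A \<in> arr K X A \<rightarrow> Neg 0 X A"
      using X by (auto intro: yoneda_inv_closed)
    show inv: "yoneda R K E X A (yoneda_inv A t) = t" if "t \<in> arr K X A" for t
      using y[OF X yoneda_inv_closed[OF that X]] yoneda_inv_apply[of "ident K A" A A t] X that by simp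
    show "yoneda_inv A (yoneda R K E X A \<eta>) = \<eta>" if "\<eta> \<in> Neg 0 X A" for \<eta>
    proof (rule neg0_eqI[OF _ that X])
      have t: "yoneda R K E X A \<eta> \<in> arr K X A" using that X by (simp add: y neg0_ident)
      then show "yoneda_inv A (yoneda R K E X A \<eta>) \<in> Neg 0 X A" using X by (rule yoneda_inv_closed)
      show "yoneda_inv A (yoneda R K E X A \<eta>) A (Hom_el (ident K A)) = \<eta> A (Hom_el (ident K A))"
        using yoneda_inv_apply[of "ident K A" A A "yoneda R K E X A \<eta>"] t X y[OF X that] by simp
    qed
  qed
  ultimately show ?thesis by (simp add: bifun_iso_def)
qed

lemma neg_middle_exact_0:
  assumes tri: "(x, B, y) \<in> s C A \<delta>" and ob: "C \<in> Ob K" "A \<in> Ob K" "\<delta> \<in> Ext C A" and X: "X \<in> Ob K"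
    and v: "v \<in> Neg 0 X B" and v0: "push K (neg_ext R K E 0) X y v = \<zero>\<^bsub>val (neg_ext R K E 0) X C\<^esub>"
  shows "v \<in> push K (neg_ext R K E 0) X x ` Neg 0 X A"
proof -
  note t = real_seq[OF tri ob]
  let ?u = "v B (Hom_el (ident K B))"
  have u: "?u \<in> arr K X B" using v t(1) by (rule neg0_ident)
  have id: "Hom_el (ident K Y) \<in> Pos 0 Y Y" if "Y \<in> Ob K" for Y
    using that by (auto simp: pos0_carrier)
  have "y \<star> ?u = v C (Hom_el y)"
    using neg0_apply[OF v t(3) X t(1) ob(1)] by simp
  also have "\<dots> = push K (neg_ext R K E 0) X y v C (Hom_el (ident K C))"
    using push_neg_apply[OF v ob(1) id[OF ob(1)] t(3) X t(1) ob(1)] pull_pos0[of "ident K C" C C y B] t ob by simp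
  also have "\<dots> = \<zero>\<^bsub>Hom K X C\<^esub>"
    unfolding v0 using zero_neg_apply[OF ob(1) id[OF ob(1)]] by simp
  finally obtain a where a: "a \<in> arr K X A" "x \<star> a = ?u"
    using factor_through_inflation[OF tri ob u _ X] by blast
  have c: "yoneda_inv A a \<in> Neg 0 X A" using a(1) X ob(2) by (rule yoneda_inv_closed)
  have "push K (neg_ext R K E 0) X x (yoneda_inv A a) = v"
  proof (rule neg0_eqI[OF N.push_closed[OF c t(2) X ob(2) t(1)] v X t(1)])
    show "push K (neg_ext R K E 0) X x (yoneda_inv A a) B (Hom_el (ident K B)) = ?u"
      using push_neg_apply[OF c t(1) id[OF t(1)] t(2) X ob(2) t(1)] pull_pos0[of "ident K B" B B x A]
        yoneda_inv_apply[OF t(2,1)] a t ob by simp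
  qed
  then show ?thesis using c by blast
qed

lemma projective_generates:
  assumes tri: "(k, Q, g) \<in> s C N \<kappa>" and g: "projective_morphism K E Q C g"
    and ob: "C \<in> Ob K" "N \<in> Ob K" "\<kappa> \<in> Ext C N" and l: "M \<in> Ob K" "l \<in> Ext C M"
  shows "\<exists>a \<in> arr K N M. push K E C a \<kappa> = l"
  using ext_is_pushout[OF tri ob l(2,1)] g l unfolding projective_morphism_def by blast

text \<open>
  For a projective deflation \<open>Q \<rightarrow> C\<close> the map \<open>l \<mapsto> l \<union> \<kappa>\<close> is a cokernel of \<open>k\<^sup>*\<close>, so \<open>Hom(-, \<C>(X, -))\<close> turns it into
  a kernel of \<open>k\<^sub>*\<close>. Surjectivity gives injectivity of \<open>\<kappa>\<^sub>\<sharp>\<close>, and the factorization property gives its image.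
\<close>

lemma neg_conn_inj:
  assumes tri: "(k, Q, g) \<in> s C N \<kappa>" and g: "projective_morphism K E Q C g"
    and ob: "C \<in> Ob K" "N \<in> Ob K" "\<kappa> \<in> Ext C N" and X: "X \<in> Ob K"
  shows "inj_on (neg_conn R K E n C N \<kappa> X) (Neg (Suc n) X C)"
proof (rule inj_onI)
  fix \<eta> \<zeta> assume e: "\<eta> \<in> Neg (Suc n) X C" "\<zeta> \<in> Neg (Suc n) X C"
    and eq: "neg_conn R K E n C N \<kappa> X \<eta> = neg_conn R K E n C N \<kappa> X \<zeta>"
  show "\<eta> = \<zeta>"
  proof (rule neg_eqI[OF e])
    fix Y u assume Y: "Y \<in> Ob K" and u: "u \<in> Pos (Suc n) C Y"
    obtain l where l: "l \<in> Pos n N Y" "cup R K E n C N \<kappa> Y l = u"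
      using cup_surj[OF ob(3,1,2) projective_generates[OF tri g ob] u Y] by blast
    then show "\<eta> Y u = \<zeta> Y u"
      using neg_conn_apply[OF e(1) l(1) X Y, of \<kappa>] neg_conn_apply[OF e(2) l(1) X Y, of \<kappa>] eq by simp
  qed
qed

lemma neg_conn_surj:
  assumes tri: "(k, Q, g) \<in> s C N \<kappa>" and g: "projective_morphism K E Q C g"
    and ob: "C \<in> Ob K" "N \<in> Ob K" "\<kappa> \<in> Ext C N" and X: "X \<in> Ob K"
    and v: "v \<in> Neg n X N" and v0: "push K (neg_ext R K E n) X k v = \<zero>\<^bsub>val (neg_ext R K E n) X Q\<^esub>"
  shows "v \<in> neg_conn R K E n C N \<kappa> X ` Neg (Suc n) X C"
proof -
  note t = real_seq[OF tri ob] and gen = projective_generates[OF tri g ob]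
  let ?c = "cup R K E n C N \<kappa>"
  define w where "w = (\<lambda>Y u. SOME l. l \<in> Pos n N Y \<and> ?c Y l = u)"
  have w: "w Y u \<in> Pos n N Y" "?c Y (w Y u) = u" if "Y \<in> Ob K" "u \<in> Pos (Suc n) C Y" for Y u
    using someI_ex[of "\<lambda>l. l \<in> Pos n N Y \<and> ?c Y l = u"] cup_surj[OF ob(3,1,2) gen that(2,1)] unfolding w_def by blast+
  have factor: "v Y (w Y (?c Y l)) = v Y l" if Y: "Y \<in> Ob K" and l: "l \<in> Pos n N Y" for Y l
  proof (rule cup_factor[OF tri ob gen Y hom_module[OF X Y] neg_linear[OF v Y]])
    fix \<mu> assume \<mu>: "\<mu> \<in> Pos n Q Y"
    show "v Y (pull K (pos_ext R K E n) Y k \<mu>) = \<zero>\<^bsub>Hom K X Y\<^esub>"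
      using push_neg_apply[OF v Y \<mu> t(2) X ob(2) t(1)] zero_neg_apply[OF Y \<mu>] v0 by simp
  qed (use w[OF Y cup_closed[OF l ob(3,1,2) Y]] l in auto)
  have wc: "v Y (w Y u) \<in> arr K X Y" if "Y \<in> Ob K" "u \<in> Pos (Suc n) C Y" for Y u
    by (rule neg_closed[OF v w(1)[OF that] that(1)])
  let ?\<zeta> = "\<lambda>Y \<in> Ob K. \<lambda>u \<in> Pos (Suc n) C Y. v Y (w Y u)"
  have \<zeta>: "?\<zeta> \<in> Neg (Suc n) X C"
  proof (rule neg_restrictI[OF X ob(1) wc])
    fix Y u u' assume Y: "Y \<in> Ob K" and u: "u \<in> Pos (Suc n) C Y" "u' \<in> Pos (Suc n) C Y"
    note w1 = w[OF Y u(1)] and w2 = w[OF Y u(2)]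
    have "u \<oplus>\<^bsub>val (pos_ext R K E (Suc n)) C Y\<^esub> u' = ?c Y (w Y u \<oplus>\<^bsub>val (pos_ext R K E n) N Y\<^esub> w Y u')"
      using cup_add[OF w1(1) w2(1) ob(3,1,2) Y] w1(2) w2(2) by simp
    then show "v Y (w Y (u \<oplus>\<^bsub>val (pos_ext R K E (Suc n)) C Y\<^esub> u')) = v Y (w Y u) \<oplus>\<^bsub>Hom K X Y\<^esub> v Y (w Y u')"
      using factor[OF Y P.val_add[OF w1(1) w2(1) ob(2) Y]] neg_add[OF v w1(1) w2(1) Y] by simp
  next
    fix Y r u assume Y: "Y \<in> Ob K" and r: "r \<in> carrier R" and u: "u \<in> Pos (Suc n) C Y"
    note w1 = w[OF Y u]
    have "r \<odot>\<^bsub>val (pos_ext R K E (Suc n)) C Y\<^esub> u = ?c Y (r \<odot>\<^bsub>val (pos_ext R K E n) N Y\<^esub> w Y u)"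
      using cup_smult[OF w1(1) r ob(3,1,2) Y] w1(2) by simp
    then show "v Y (w Y (r \<odot>\<^bsub>val (pos_ext R K E (Suc n)) C Y\<^esub> u)) = r \<odot>\<^bsub>Hom K X Y\<^esub> v Y (w Y u)"
      using factor[OF Y P.val_smult[OF r w1(1) ob(2) Y]] neg_smult[OF v r w1(1) Y] by simp
  next
    fix Y Y' f u assume Y: "Y \<in> Ob K" "Y' \<in> Ob K" and f: "f \<in> arr K Y Y'" and u: "u \<in> Pos (Suc n) C Y"
    note w1 = w[OF Y(1) u]
    have "push K (pos_ext R K E (Suc n)) C f u = ?c Y' (push K (pos_ext R K E n) N f (w Y u))"
      using cup_push_arg[OF w1(1) f ob(3,1,2) Y] w1(2) by simp
    then show "v Y' (w Y' (push K (pos_ext R K E (Suc n)) C f u)) = f \<star> v Y (w Y u)"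
      using factor[OF Y(2) P.push_closed[OF w1(1) f ob(2) Y]] neg_push_arg[OF v w1(1) f X Y] by simp
  qed
  have eq: "neg_conn R K E n C N \<kappa> X ?\<zeta> = v"
  proof (rule neg_eqI[OF neg_conn_closed[OF \<zeta> ob(3,1,2) X] v])
    fix Y l assume Y: "Y \<in> Ob K" and l: "l \<in> Pos n N Y"
    show "neg_conn R K E n C N \<kappa> X ?\<zeta> Y l = v Y l"
      using neg_conn_apply[OF \<zeta> l X Y, of \<kappa>] factor[OF Y l] cup_closed[OF l ob(3,1,2) Y] Y by simp
  qed
  show ?thesis by (rule image_eqI[where x = ?\<zeta>]) (rule eq[symmetric], rule \<zeta>)
qed

lemma neg_effaceable:
  assumes "enough_projective_morphisms K E s"
  shows "effaceable_sequence R K E s (neg_ext R K E) (neg_conn R K E)"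
  by (rule effaceable_sequence.intro[OF neg_connected], rule effaceable_sequence_axioms.intro, rule assms,
    erule (5) neg_conn_inj, erule (7) neg_conn_surj, erule (6) neg_middle_exact_0)

end

theorem corollary5p19:
  fixes R :: "('r, 'z) ring_scheme"
    and K :: "('r, 'o, 'm) lincat"
    and E :: "('r, 'o, 'm, 'e) bifun"
    and s :: "('o, 'm, 'e) realization"
  assumes "extriangulated_category R K E s"
    and "enough_projective_morphisms K E s"
  shows "delta_functor_on_hom R K E s (neg_ext R K E) (neg_conn R K E) (yoneda R K E) \<and>
    (\<forall>(G :: nat \<Rightarrow> ('r, 'o, 'm, 'g) bifun) conn \<theta>.
       delta_functor_on_hom R K E s G conn \<theta> \<longrightarrow>
       (\<exists>!\<phi>. delta_morphism R K E G conn \<theta>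
          (neg_ext R K E) (neg_conn R K E) (yoneda R K E) \<phi>))"
proof -
  interpret extriangulated_category R K E s by fact
  interpret N: effaceable_sequence R K E s "neg_ext R K E" "neg_conn R K E"
    by (rule neg_effaceable[OF assms(2)])
  have "delta_functor_on_hom R K E s (neg_ext R K E) (neg_conn R K E) (yoneda R K E)"
    unfolding delta_functor_on_hom_def using N.partial_delta_functor yoneda_iso by blast
  moreover have "\<exists>!\<phi>. delta_morphism R K E G conn \<theta> (neg_ext R K E) (neg_conn R K E) (yoneda R K E) \<phi>"
    if G: "delta_functor_on_hom R K E s G conn \<theta>" for G :: "nat \<Rightarrow> ('r, 'o, 'm, 'g) bifun" and conn \<theta>
  proof (rule N.universal[OF _ _ yoneda_iso])
    have "partial_delta_functor R K E s G conn"
      using G by (simp add: delta_functor_on_hom_def)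
    then show "connected_sequence R K E s G conn"
      by (intro connected_sequence.intro extriangulated_category_axioms connected_sequence_axioms.intro)
        (auto dest: partial_delta_functor.terms partial_delta_functor.conn_morphism partial_delta_functor.conn_natural)
    show "\<theta> \<in> bifun_iso R K (G 0) (hom_bifun K)"
      using G by (simp add: delta_functor_on_hom_def)
  qed
  ultimately show ?thesis by blast
qed

end
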